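(* Up to automorphism of $\mathbb{P}^2_{\mathbb{C}}$ there are exactly three convex foliations of degree $2$ on the complex projective plane $\mathbb{P}^2_{\mathbb{C}}$, namely the foliations $\mathcal{H}_1^2$, $\mathcal{F}_1^2$ and $\mathcal{F}_0^2$ described respectively in an affine chart $(x,y)$ by the $1$-forms 1. $\omega_1^2 = y^2\,\mathrm{d}x - x^2\,\mathrm{d}y$; 2. $\overline{\omega}_1^2 = y^2\,\mathrm{d}x + x^2(x\,\mathrm{d}y - y\,\mathrm{d}x)$; 3. $\overline{\omega}_0^2 = (x^2-x)\,\mathrm{d}y - (y^2-y)\,\mathrm{d}x$. That is, these three foliations are convex of degree $2$ and pairwise non-conjugate under $\mathrm{Aut}(\mathbb{P}^2_{\mathbb{C}})$, and every convex foliation of degree $2$ on $\mathbb{P}^2_{\mathbb{C}}$ is conjugate by an element of $\mathrm{Aut}(\mathbb{P}^2_{\mathbb{C}})$ to one of them.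
   Context: A (holomorphic) foliation $\mathcal{F}$ of degree $d$ on $\mathbb{P}^2_{\mathbb{C}}$ is defined in homogeneous coordinates $[x:y:z]$, up to multiplication by a nonzero constant, by a $1$-form $\omega = a\,\mathrm{d}x + b\,\mathrm{d}y + c\,\mathrm{d}z$, where $a,b,c\in\mathbb{C}[x,y,z]$ are homogeneous polynomials of degree $d+1$ without common factor satisfying $i_{\mathrm{R}}\omega = xa+yb+zc = 0$, with $\mathrm{R}=x\partial_x+y\partial_y+z\partial_z$. In an affine chart (e.g. $z=1$) the foliation is given by the restriction of $\omega$; conversely a polynomial $1$-form $A\,\mathrm{d}x+B\,\mathrm{d}y$ with $A,B\in\mathbb{C}[x,y]$ coprime determines a unique foliation on $\mathbb{P}^2_{\mathbb{C}}$. Two foliations are conjugate if one is the pullback of the other by an element of $\mathrm{Aut}(\mathbb{P}^2_{\mathbb{C}})=\mathrm{PGL}_3(\mathbb{C})$. Inflection divisor: let $\mathrm{Z}=E\partial_x+F\partial_y+G\partial_z$ be a homogeneous vector field of degree $d$ on $\mathbb{C}^3$, not collinear to $\mathrm{R}$, describing $\mathcal{F}$, i.e. such that $\omega = i_{\mathrm{R}} i_{\mathrm{Z}}(\mathrm{d}x\wedge \mathrm{d}y\wedge \mathrm{d}z)$. The inflection divisor $\mathrm{I}_{\mathcal{F}}$ is the divisor on $\mathbb{P}^2_{\mathbb{C}}$ defined by $$\begin{vmatrix} x & E & \mathrm{Z}(E)\\ y & F & \mathrm{Z}(F)\\ z & G & \mathrm{Z}(G)\end{vmatrix}=0 .$$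 The foliation $\mathcal{F}$ is called convex if $\mathrm{I}_{\mathcal{F}}$ is totally invariant by $\mathcal{F}$, i.e. if $\mathrm{I}_{\mathcal{F}}$ is a product of lines invariant by $\mathcal{F}$ (equivalently, the leaves of $\mathcal{F}$ which are not straight lines have no inflection points). *)

theory Defs
  imports "HOL-Analysis.Analysis" "HOL-Computational_Algebra.Polynomial"
begin

text \<open>
  \<open>\<complex>[x,y]\<close> is \<open>\<complex>[x][y]\<close> and \<open>\<complex>[x,y,z]\<close> is \<open>\<complex>[x][y][z]\<close>: in both types the innermost
  polynomial variable is \<open>x\<close>, and the outermost one is \<open>y\<close>, respectively \<open>z\<close>.
\<close>

type_synonym poly2 = "complex poly poly"
type_synonym poly3 = "complex poly poly poly"

definition x2 :: poly2 where "x2 = [:[:0, 1:]:]"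
definition y2 :: poly2 where "y2 = [:0, 1:]"

definition const3 :: "complex \<Rightarrow> poly3" where
  "const3 c = [:[:[:c:]:]:]"

text \<open>The coordinates \<open>(x, y, z)\<close>; this is also the radial vector field \<open>R\<close>.\<close>

definition coord :: "poly3 ^ 3" where
  "coord = vector [[:[:[:0, 1:]:]:], [:[:0, 1:]:], [:0, 1:]]"

definition pd :: "3 \<Rightarrow> poly3 \<Rightarrow> poly3" where
  "pd i p = (if i = 1 then map_poly (map_poly pderiv) p
             else if i = 2 then map_poly pderiv p
             else pderiv p)"

definition homogeneous :: "nat \<Rightarrow> poly3 \<Rightarrow> bool" where
  "homogeneous n p \<longleftrightarrow>
     (\<forall>i j k. coeff (coeff (coeff p k) j) i \<noteq> 0 \<longrightarrow> i + j + k = n)"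

text \<open>\<open>subst3 v p = p(v\<^sub>1, v\<^sub>2, v\<^sub>3)\<close>\<close>

definition subst3 :: "poly3 ^ 3 \<Rightarrow> poly3 \<Rightarrow> poly3" where
  "subst3 v p =
     poly (map_poly (\<lambda>q. poly (map_poly (\<lambda>r. poly (map_poly const3 r) (v $ 1)) q) (v $ 2)) p) (v $ 3)"


text \<open>
  The vector \<open>\<omega> :: poly3 ^ 3\<close> stands for the 1-form \<open>\<omega>\<^sub>1 dx + \<omega>\<^sub>2 dy + \<omega>\<^sub>3 dz\<close>, the vector
  \<open>Z :: poly3 ^ 3\<close> for the vector field \<open>Z\<^sub>1 \<partial>\<^sub>x + Z\<^sub>2 \<partial>\<^sub>y + Z\<^sub>3 \<partial>\<^sub>z\<close>.
\<close>

definition foliation_form :: "nat \<Rightarrow> poly3 ^ 3 \<Rightarrow> bool" where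
  "foliation_form d \<omega> \<longleftrightarrow>
     (\<forall>i. homogeneous (d + 1) (\<omega> $ i)) \<and>
     (\<forall>h. (\<forall>i. h dvd \<omega> $ i) \<longrightarrow> h dvd 1) \<and>
     (\<Sum>i\<in>UNIV. coord $ i * \<omega> $ i) = 0"

text \<open>A foliation is the set of all 1-forms defining it.\<close>

definition foliation_of :: "poly3 ^ 3 \<Rightarrow> (poly3 ^ 3) set" where
  "foliation_of \<omega> = {const3 c *s \<omega> | c. c \<noteq> 0}"

definition foliation :: "nat \<Rightarrow> (poly3 ^ 3) set \<Rightarrow> bool" where
  "foliation d F \<longleftrightarrow> (\<exists>\<omega>. foliation_form d \<omega> \<and> F = foliation_of \<omega>)"

text \<open>
  The foliation whose restriction to the chart \<open>z = 1\<close> is \<open>A dx + B dy\<close>. It exists and is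
  unique if \<open>A\<close> and \<open>B\<close> are coprime.
\<close>

definition affine_foliation :: "poly2 \<Rightarrow> poly2 \<Rightarrow> (poly3 ^ 3) set" where
  "affine_foliation A B =
     (THE F. (\<exists>d. foliation d F) \<and> (\<exists>\<omega>\<in>F. poly (\<omega> $ 1) 1 = A \<and> poly (\<omega> $ 2) 1 = B))"

text \<open>
  The pullback by the linear map \<open>v \<mapsto> M v\<close> is
  \<open>\<Sum>\<^sub>i \<omega>\<^sub>i(M v) d(M v)\<^sub>i = \<Sum>\<^sub>j (\<Sum>\<^sub>i M\<^sub>i\<^sub>j \<omega>\<^sub>i(M v)) dv\<^sub>j\<close>. A scalar matrix only multiplies a
  homogeneous form by a constant, so \<open>PGL\<^sub>3\<close> acts on foliations.
\<close>

definition pullback :: "complex ^ 3 ^ 3 \<Rightarrow> poly3 ^ 3 \<Rightarrow> poly3 ^ 3" where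
  "pullback M \<omega> =
     (\<chi> j. \<Sum>i\<in>UNIV. const3 (M $ i $ j) *
        subst3 (\<chi> k. \<Sum>l\<in>UNIV. const3 (M $ k $ l) * coord $ l) (\<omega> $ i))"

definition conjugate :: "(poly3 ^ 3) set \<Rightarrow> (poly3 ^ 3) set \<Rightarrow> bool" where
  "conjugate F G \<longleftrightarrow> (\<exists>M :: complex ^ 3 ^ 3. invertible M \<and> F = pullback M ` G)"

definition vf_apply :: "poly3 ^ 3 \<Rightarrow> poly3 \<Rightarrow> poly3" where
  "vf_apply Z p = (\<Sum>i\<in>UNIV. Z $ i * pd i p)"

text \<open>
  \<open>i\<^sub>R i\<^sub>Z (dx \<and> dy \<and> dz)\<close> for \<open>Z = E \<partial>\<^sub>x + F \<partial>\<^sub>y + G \<partial>\<^sub>z\<close>: since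
  \<open>i\<^sub>Z (dx \<and> dy \<and> dz) = E dy \<and> dz + F dz \<and> dx + G dx \<and> dy\<close>, it is
  \<open>(zF - yG) dx + (xG - zE) dy + (yE - xF) dz\<close>.
\<close>

definition contract_vol :: "poly3 ^ 3 \<Rightarrow> poly3 ^ 3" where
  "contract_vol Z = vector
     [coord $ 3 * Z $ 2 - coord $ 2 * Z $ 3,
      coord $ 1 * Z $ 3 - coord $ 3 * Z $ 1,
      coord $ 2 * Z $ 1 - coord $ 1 * Z $ 2]"

text \<open>
  A homogeneous field of degree \<open>d\<close> describing the foliation of \<open>\<omega>\<close>. It is not collinear to \<open>R\<close>,
  because the components of \<open>contract_vol Z\<close> are the 2-by-2 minors of \<open>(R, Z)\<close> up to sign
  and the form of a foliation is nonzero.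
\<close>

definition describing_field :: "nat \<Rightarrow> poly3 ^ 3 \<Rightarrow> poly3 ^ 3 \<Rightarrow> bool" where
  "describing_field d \<omega> Z \<longleftrightarrow> (\<forall>i. homogeneous d (Z $ i)) \<and> \<omega> = contract_vol Z"

definition inflection_poly :: "poly3 ^ 3 \<Rightarrow> poly3" where
  "inflection_poly Z =
     det (\<chi> i. vector [coord $ i, Z $ i, vf_apply Z (Z $ i)] :: poly3 ^ 3 ^ 3)"

text \<open>The curve \<open>f = 0\<close> is invariant by \<open>\<omega>\<close> if \<open>f\<close> divides every coefficient of \<open>df \<and> \<omega>\<close>.\<close>

definition invariant_curve :: "poly3 \<Rightarrow> poly3 ^ 3 \<Rightarrow> bool" where
  "invariant_curve f \<omega> \<longleftrightarrow> (\<forall>i j. f dvd pd i f * \<omega> $ j - pd j f * \<omega> $ i)"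

definition linear_form :: "complex ^ 3 \<Rightarrow> poly3" where
  "linear_form v = (\<Sum>i\<in>UNIV. const3 (v $ i) * coord $ i)"

text \<open>
  Two fields describing the same form differ by a multiple of \<open>R\<close> and have the same
  inflection polynomial; rescaling the form rescales this polynomial by a nonzero constant.
  So the choice of \<open>\<omega>\<close> and \<open>Z\<close> is immaterial. The list \<open>vs\<close> allows for multiplicities.
\<close>

definition convex_foliation :: "nat \<Rightarrow> (poly3 ^ 3) set \<Rightarrow> bool" where
  "convex_foliation d F \<longleftrightarrow> foliation d F \<and>
     (\<exists>\<omega>\<in>F. \<exists>Z. describing_field d \<omega> Z \<and>
        (\<exists>c vs. c \<noteq> 0 \<and>
           (\<forall>v\<in>set vs. v \<noteq> 0 \<and> invariant_curve (linear_form v) \<omega>) \<and>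
           inflection_poly Z = const3 c * prod_list (map linear_form vs)))"


definition fol_H1 :: "(poly3 ^ 3) set" where
  "fol_H1 = affine_foliation (y2^2) (- (x2^2))"

text \<open>\<open>y\<^sup>2 dx + x\<^sup>2 (x dy - y dx) = (y\<^sup>2 - x\<^sup>2 y) dx + x\<^sup>3 dy\<close>\<close>

definition fol_F1 :: "(poly3 ^ 3) set" where
  "fol_F1 = affine_foliation (y2^2 - x2^2 * y2) (x2^3)"

definition fol_F0 :: "(poly3 ^ 3) set" where
  "fol_F0 = affine_foliation (- (y2^2 - y2)) (x2^2 - x2)"

end

theory Submission
  imports Defs
begin

text \<open>
Replace a form by a quadratic field \<open>Z\<close> on \<open>\<complex>\<^sup>3\<close>, taken modulo multiples of the radial field
\<open>R\<close>, and polynomials by their values. For such a field convexity says that every factor of the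
inflection polynomial \<open>I\<close> is an invariant line, in particular that every point of \<open>I = 0\<close> lies on an
invariant line contained in \<open>I = 0\<close>. This last property is what drives the classification: it is
inherited by every quotient of \<open>I\<close> by linear forms.

Put an invariant line at \<open>z = 0\<close> and make \<open>Z = (E, F, 0)\<close>. Then \<open>I = z J\<close>, and with the restrictions
\<open>E\<^sub>0, F\<^sub>0\<close> of \<open>E, F\<close> to the line one has \<open>J = - T K / 2\<close> on \<open>z = 0\<close>, where \<open>T = y E\<^sub>0 - x F\<^sub>0\<close>
vanishes at the singular points on the line and \<open>K\<close> is the Jacobian determinant of \<open>(E\<^sub>0, F\<^sub>0)\<close>.

If \<open>E\<^sub>0, F\<^sub>0\<close> are independent, a second invariant line passes through every zero of \<open>K\<close>, and two
invariant lines meet in a singular point. Hence the critical points of the map \<open>[E\<^sub>0 : F\<^sub>0]\<close> of the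
projective line are fixed. Either the map is \<open>[x\<^sup>2 : y\<^sup>2]\<close> up to coordinates, and the invariant lines
through the two critical points and through the third fixed point leave only \<open>H\<^sub>1\<close> and \<open>F\<^sub>0\<close>; or
\<open>E\<^sub>0, F\<^sub>0\<close> have a common zero, and then a comparison of \<open>J\<close> with the invariant lines through it and
through the other fixed points leaves only \<open>H\<^sub>1\<close>. This is \<open>equiv_to_model_if_indep\<close>.

It remains to treat the fields for which the restriction is dependent along every invariant line.
With two invariant lines \<open>x = 0\<close> and \<open>z = 0\<close> the two dependencies make the field triangular, and one
finds \<open>H\<^sub>1\<close> or \<open>F\<^sub>1\<close> (\<open>two_lines\<close>). With a single invariant line \<open>z = 0\<close>, \<open>I\<close> would be a multiple of
\<open>z\<^sup>6\<close>, which is impossible (\<open>single_line\<close>).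

The three models are told apart by their singular points: those of \<open>F\<^sub>1\<close> lie on one line, those
of \<open>H\<^sub>1\<close> and \<open>F\<^sub>0\<close> do not, and \<open>F\<^sub>0\<close> has four singular points in general position whereas all
but one of those of \<open>H\<^sub>1\<close> are collinear.
\<close>

section \<open>Quadratic vector fields and products of lines\<close>

definition lform :: "complex ^ 3 \<Rightarrow> complex ^ 3 \<Rightarrow> complex" where
  "lform l v = l $ 1 * v $ 1 + l $ 2 * v $ 2 + l $ 3 * v $ 3"

definition invariant_lines :: "(complex ^ 3 \<Rightarrow> complex ^ 3) \<Rightarrow> (complex ^ 3) set" where
  "invariant_lines Z = {l. l \<noteq> 0 \<and> (\<forall>v. lform l v = 0 \<longrightarrow> lform l (Z v) = 0)}"

text \<open>
The list may repeat lines, so multiplicities are recorded; \<open>S\<close> will be the set of invariant lines.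
\<close>

definition splits_over :: "(complex ^ 3) set \<Rightarrow> (complex ^ 3 \<Rightarrow> complex) \<Rightarrow> bool" where
  "splits_over S f \<longleftrightarrow> (\<exists>c vs. c \<noteq> 0 \<and> set vs \<subseteq> S \<and>
     (\<forall>v. f v = c * prod_list (map (\<lambda>l. lform l v) vs)))"

definition col_matrix :: "complex ^ 3 \<Rightarrow> complex ^ 3 \<Rightarrow> complex ^ 3 \<Rightarrow> complex ^ 3 ^ 3" where
  "col_matrix u v w = (\<chi> i. vector [u $ i, v $ i, w $ i])"

text \<open>
For quadratic \<open>Z\<close> the difference \<open>Z (v + w) - Z w\<close> is \<open>Z v\<close> plus the derivative of \<open>Z\<close> at \<open>v\<close> in
direction \<open>w\<close>. With \<open>w = Z v\<close> the last column agrees with \<open>Z(Z)\<close> modulo the second one, so this is the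
inflection determinant, written without derivatives.
\<close>

definition inflection :: "(complex ^ 3 \<Rightarrow> complex ^ 3) \<Rightarrow> complex ^ 3 \<Rightarrow> complex" where
  "inflection Z v = det (col_matrix v (Z v) (Z (v + Z v) - Z (Z v)))"

definition qform :: "complex \<Rightarrow> complex \<Rightarrow> complex \<Rightarrow> complex \<Rightarrow> complex \<Rightarrow> complex \<Rightarrow> complex ^ 3 \<Rightarrow> complex" where
  "qform a b c d e f v = a * (v $ 1)^2 + b * v $ 1 * v $ 2 + c * (v $ 2)^2
     + d * v $ 1 * v $ 3 + e * v $ 2 * v $ 3 + f * (v $ 3)^2"

definition is_qform :: "(complex ^ 3 \<Rightarrow> complex) \<Rightarrow> bool" where
  "is_qform p \<longleftrightarrow> (\<exists>a b c d e f. \<forall>v. p v = qform a b c d e f v)"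

text \<open>
The middle condition says that the form of the foliation has no linear factor: a field
\<open>l G + L R\<close> with \<open>G\<close> linear has a form divisible by \<open>l\<close>. An irreducible quadratic factor \<open>h\<close> would
mean \<open>Z = h C + L R\<close> with \<open>C\<close> constant; then all orbits are lines and the inflection determinant is
zero, which the last condition rules out.
\<close>

definition convex_field :: "(complex ^ 3 \<Rightarrow> complex ^ 3) \<Rightarrow> bool" where
  "convex_field Z \<longleftrightarrow> (\<forall>i. is_qform (\<lambda>v. Z v $ i)) \<and>
     (\<forall>l (G :: complex ^ 3 ^ 3) L. l \<noteq> 0 \<longrightarrow> (\<exists>v. Z v \<noteq> lform l v *s (G *v v) + lform L v *s v)) \<and>
     splits_over (invariant_lines Z) (inflection Z)"

text \<open>
A change of coordinates, a rescaling, and a change of representative modulo \<open>R\<close>: exactly the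
operations that preserve the foliation up to conjugation.
\<close>

definition field_equiv :: "(complex ^ 3 \<Rightarrow> complex ^ 3) \<Rightarrow> (complex ^ 3 \<Rightarrow> complex ^ 3) \<Rightarrow> bool" where
  "field_equiv Z Z' \<longleftrightarrow> (\<exists>N c L. invertible N \<and> c \<noteq> 0 \<and>
     (\<forall>v. Z' (N *v v) = c *s (N *v Z v) + lform L v *s (N *v v)))"

lemma vec3_eq_iff: "(u :: 'a ^ 3) = v \<longleftrightarrow> u $ 1 = v $ 1 \<and> u $ 2 = v $ 2 \<and> u $ 3 = v $ 3"
  by (simp add: vec_eq_iff forall_3)

lemma mv3: "((N :: complex ^ 3 ^ 3) *v v) $ i = N $ i $ 1 * v $ 1 + N $ i $ 2 * v $ 2 + N $ i $ 3 * v $ 3"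
  by (simp add: matrix_vector_mult_def sum_3)

lemma lform_add: "lform l (v + w) = lform l v + lform l w"
  and lform_smult: "lform l (c *s v) = c * lform l v"
  and lform_smult_left: "lform (c *s l) v = c * lform l v"
  and lform_add_left: "lform (l + m) v = lform l v + lform m v"
  and lform_0 [simp]: "lform l 0 = 0"
  by (simp_all add: lform_def algebra_simps)

lemma lform_mv: "lform l (N *v v) = lform (transpose N *v l) v"
  by (simp add: lform_def mv3 transpose_def algebra_simps)

lemma lform_eq0_iff: "(\<forall>v. lform l v = 0) \<longleftrightarrow> l = 0"
proof
  assume *: "\<forall>v. lform l v = 0"
  from *[rule_format, of "vector [1,0,0]"] *[rule_format, of "vector [0,1,0]"] *[rule_format, of "vector [0,0,1]"]
  show "l = 0" by (simp add: lform_def vec3_eq_iff)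
qed (simp add: lform_def)

lemma mv_col_matrix: "(N :: complex ^ 3 ^ 3) ** col_matrix u v w = col_matrix (N *v u) (N *v v) (N *v w)"
  by (simp add: col_matrix_def vec_eq_iff forall_3 matrix_matrix_mult_def mv3 sum_3)

lemma det_col_matrix: "det (col_matrix u v w) = u$1 * v$2 * w$3 + v$1 * w$2 * u$3 + w$1 * u$2 * v$3
   - u$1 * w$2 * v$3 - v$1 * u$2 * w$3 - w$1 * v$2 * u$3"
  by (simp add: col_matrix_def det_3 algebra_simps)

text \<open>
Along \<open>p + t q\<close> the product is a nonzero polynomial in \<open>t\<close>.
\<close>

lemma prod_lform_nonzero_on_line:
  assumes "\<And>l. l \<in> set vs \<Longrightarrow> lform l p \<noteq> 0 \<or> lform l q \<noteq> 0"
  shows "\<exists>t. prod_list (map (\<lambda>l. lform l (p + t *s q)) vs) \<noteq> 0"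
proof -
  define P where "P = prod_list (map (\<lambda>l. [:lform l p, lform l q:]) vs)"
  have "P \<noteq> 0" unfolding P_def using assms by (auto simp: prod_list_zero_iff)
  then obtain t where t: "poly P t \<noteq> 0" using poly_all_0_iff_0 by blast
  have "poly P t = prod_list (map (\<lambda>l. lform l (p + t *s q)) vs)"
    unfolding P_def by (induction vs) (auto simp: lform_add lform_smult algebra_simps)
  with t show ?thesis by auto
qed

lemma proportional_if_vanishing_on_kernel:
  assumes l: "l \<noteq> 0"
  obtains p q where "lform l p = 0" "lform l q = 0"
    "\<And>m. lform m p = 0 \<Longrightarrow> lform m q = 0 \<Longrightarrow> \<exists>k. m = k *s l"
proof -
  consider "l $ 1 \<noteq> 0" | "l $ 2 \<noteq> 0" | "l $ 3 \<noteq> 0" using l by (auto simp: vec3_eq_iff)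
  then show ?thesis
  proof cases
    case 1
    show ?thesis
    proof (rule that[of "vector [- l $ 2, l $ 1, 0]" "vector [- l $ 3, 0, l $ 1]"])
      fix m assume "lform m (vector [- l $ 2, l $ 1, 0]) = 0" "lform m (vector [- l $ 3, 0, l $ 1]) = 0"
      then have "m = (m $ 1 / l $ 1) *s l" using 1 by (simp add: lform_def vec3_eq_iff field_simps)
      then show "\<exists>k. m = k *s l" ..
    qed (simp_all add: lform_def)
  next
    case 2
    show ?thesis
    proof (rule that[of "vector [l $ 2, - l $ 1, 0]" "vector [0, - l $ 3, l $ 2]"])
      fix m assume "lform m (vector [l $ 2, - l $ 1, 0]) = 0" "lform m (vector [0, - l $ 3, l $ 2]) = 0"
      then have "m = (m $ 2 / l $ 2) *s l" using 2 by (simp add: lform_def vec3_eq_iff field_simps)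
      then show "\<exists>k. m = k *s l" ..
    qed (simp_all add: lform_def)
  next
    case 3
    show ?thesis
    proof (rule that[of "vector [l $ 3, 0, - l $ 1]" "vector [0, l $ 3, - l $ 2]"])
      fix m assume "lform m (vector [l $ 3, 0, - l $ 1]) = 0" "lform m (vector [0, l $ 3, - l $ 2]) = 0"
      then have "m = (m $ 3 / l $ 3) *s l" using 3 by (simp add: lform_def vec3_eq_iff field_simps)
      then show "\<exists>k. m = k *s l" ..
    qed (simp_all add: lform_def)
  qed
qed

text \<open>
A plane is not a finite union of proper subspaces; \<open>p\<close> and \<open>q\<close> below span the plane \<open>l = 0\<close>.
\<close>

lemma prod_lform_vanishing:
  assumes "l \<noteq> 0" and nz: "0 \<notin> set vs"
    and van: "\<And>v. lform l v = 0 \<Longrightarrow> prod_list (map (\<lambda>l. lform l v) vs) = 0"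
  shows "\<exists>k. k \<noteq> 0 \<and> k *s l \<in> set vs"
proof (rule ccontr)
  assume no: "\<not> ?thesis"
  obtain p q where pq: "lform l p = 0" "lform l q = 0"
    "\<And>m. lform m p = 0 \<Longrightarrow> lform m q = 0 \<Longrightarrow> \<exists>k. m = k *s l"
    using proportional_if_vanishing_on_kernel[OF assms(1)] by metis
  have "lform m p \<noteq> 0 \<or> lform m q \<noteq> 0" if "m \<in> set vs" for m
  proof (rule ccontr)
    assume "\<not> ?thesis"
    then obtain k where "m = k *s l" using pq(3) by blast
    then show False using no nz that by (cases "k = 0") auto
  qed
  then obtain t where "prod_list (map (\<lambda>l. lform l (p + t *s q)) vs) \<noteq> 0"
    using prod_lform_nonzero_on_line by blast
  then show False using van[of "p + t *s q"] pq by (simp add: lform_add lform_smult)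
qed

text \<open>
This is the half of convexity that produces contradictions and normal forms: a line found inside
\<open>I = 0\<close> by inspection has to be invariant.
\<close>

lemma splits_line:
  assumes "splits_over (invariant_lines Z) f" "l \<noteq> 0" "\<And>v. lform l v = 0 \<Longrightarrow> f v = 0"
  shows "l \<in> invariant_lines Z"
proof -
  obtain c vs where c: "c \<noteq> 0" "set vs \<subseteq> invariant_lines Z" "\<And>v. f v = c * prod_list (map (\<lambda>l. lform l v) vs)"
    using assms(1) unfolding splits_over_def by blast
  have "\<exists>k. k \<noteq> 0 \<and> k *s l \<in> set vs"
  proof (rule prod_lform_vanishing[OF assms(2)])
    show "0 \<notin> set vs" using c(2) by (auto simp: invariant_lines_def)
    show "prod_list (map (\<lambda>l. lform l v) vs) = 0" if "lform l v = 0" for v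
      using assms(3)[OF that] c by simp
  qed
  then obtain k where k: "k \<noteq> 0" "k *s l \<in> invariant_lines Z" using c(2) by blast
  then show ?thesis using assms(2) by (auto simp: invariant_lines_def lform_smult_left)
qed

lemma splits_root:
  assumes "splits_over S f" "f p = 0"
  obtains l where "l \<in> S" "lform l p = 0" "\<And>v. lform l v = 0 \<Longrightarrow> f v = 0"
proof -
  obtain c vs where c: "c \<noteq> 0" "set vs \<subseteq> S" "\<And>v. f v = c * prod_list (map (\<lambda>l. lform l v) vs)"
    using assms(1) unfolding splits_over_def by blast
  have "prod_list (map (\<lambda>l. lform l p) vs) = 0" using c assms(2) by simp
  then obtain l where l: "l \<in> set vs" "lform l p = 0" by (auto simp: prod_list_zero_iff)
  show ?thesis
  proof (rule that[of l])
    show "l \<in> S" using l c by auto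
    show "f v = 0" if "lform l v = 0" for v
      using l(1) that unfolding c(3) by (auto simp: prod_list_zero_iff image_iff)
  qed fact
qed

lemma splits_not_zero:
  assumes "splits_over (invariant_lines Z) f"
  shows "\<exists>v. f v \<noteq> 0"
proof (rule ccontr)
  assume "\<not> ?thesis"
  then have f0: "f v = 0" for v by auto
  obtain c vs where c: "c \<noteq> 0" "set vs \<subseteq> invariant_lines Z" "\<And>v. f v = c * prod_list (map (\<lambda>l. lform l v) vs)"
    using assms(1) unfolding splits_over_def by blast
  define P where "P = prod_list (map (\<lambda>l. [:[:l$1, l$2:], [:l$3:]:]) vs)"
  have "P \<noteq> 0" unfolding P_def using c(2) by (auto simp: prod_list_zero_iff invariant_lines_def vec3_eq_iff)
  then obtain q where q: "poly P q \<noteq> 0" using poly_all_0_iff_0 by blast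
  then obtain t where t: "poly (poly P q) t \<noteq> 0" using poly_all_0_iff_0 by blast
  have "poly (poly P q) t = prod_list (map (\<lambda>l. lform l (vector [1, t, poly q t])) vs)"
    unfolding P_def by (induction vs) (auto simp: lform_def algebra_simps)
  with t c f0[of "vector [1, t, poly q t]"] show False by simp
qed

text \<open>
The complement of the line is dense.
\<close>

lemma eq_off_line_imp_eq:
  assumes "l \<noteq> 0" "continuous_on UNIV f" "continuous_on UNIV g"
    and off: "\<And>v. lform l v \<noteq> 0 \<Longrightarrow> f v = (g v :: complex)"
  shows "f v = g v"
proof -
  obtain w where w: "lform l w \<noteq> 0" using lform_eq0_iff assms(1) by blast
  define h where "h t = f (v + t *s w) - g (v + t *s w)" for t :: complex
  have cont: "continuous_on UNIV (\<lambda>t::complex. v + t *s w)"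
    unfolding vector_scalar_mult_def
    by (intro continuous_intros continuous_on_vec_lambda)
  have "continuous_on UNIV h" unfolding h_def
    by (intro continuous_intros continuous_on_compose2[OF assms(2) cont]
        continuous_on_compose2[OF assms(3) cont]) auto
  then have lim: "(h \<longlongrightarrow> h 0) (at 0)"
    by (simp add: continuous_on_eq_continuous_at isCont_def)
  show ?thesis
  proof (cases "lform l v = 0")
    case True
    then have "h t = 0" if "t \<noteq> 0" for t
      using off[of "v + t *s w"] w that by (simp add: h_def lform_add lform_smult)
    then have "(h \<longlongrightarrow> 0) (at 0)"
      by (intro tendsto_eventually) (auto simp: eventually_at_filter)
    with lim have "h 0 = 0" using tendsto_unique[OF _ lim] by (metis at_neq_bot)
    then show ?thesis by (simp add: h_def)
  qed (use off in auto)
qed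

lemma continuous_lform: "continuous_on UNIV (lform l)"
  unfolding lform_def by (intro continuous_intros)

lemma continuous_prod_lform: "continuous_on UNIV (\<lambda>v. prod_list (map (\<lambda>l. lform l v) vs))"
  by (induction vs) (auto intro!: continuous_intros continuous_on_mult continuous_lform)

text \<open>
Passing to quotients is how multiplicities enter the argument: a point of \<open>z = 0\<close> that is still a
zero of \<open>I / z\<close> lies on a second line, unless \<open>z\<close> is a multiple factor.
\<close>

lemma splits_div:
  assumes sp: "splits_over S f" and S: "0 \<notin> S"
    and f: "\<And>v. f v = lform l v * J v" and l: "l \<noteq> 0" and cont: "continuous_on UNIV J"
  shows "splits_over S J"
proof -
  obtain c vs where c: "c \<noteq> 0" "set vs \<subseteq> S" "\<And>v. f v = c * prod_list (map (\<lambda>l. lform l v) vs)"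
    using sp unfolding splits_over_def by blast
  have "\<exists>k. k \<noteq> 0 \<and> k *s l \<in> set vs"
  proof (rule prod_lform_vanishing[OF l])
    show "0 \<notin> set vs" using c(2) S by auto
    show "prod_list (map (\<lambda>l. lform l v) vs) = 0" if "lform l v = 0" for v
      using f[of v] c that by simp
  qed
  then obtain k where k: "k \<noteq> 0" "k *s l \<in> set vs" by blast
  then obtain vs1 vs2 where vs: "vs = vs1 @ (k *s l) # vs2" by (meson split_list)
  have "J v = (c * k) * prod_list (map (\<lambda>l. lform l v) (vs1 @ vs2))" for v
  proof (rule eq_off_line_imp_eq[OF l cont])
    show "continuous_on UNIV (\<lambda>v. (c * k) * prod_list (map (\<lambda>l. lform l v) (vs1 @ vs2)))"
      by (intro continuous_intros continuous_prod_lform)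
    fix v assume "lform l v \<noteq> 0"
    moreover have "lform l v * J v = lform l v * ((c * k) * prod_list (map (\<lambda>l. lform l v) (vs1 @ vs2)))"
      unfolding f[symmetric] c(3) vs by (simp add: lform_smult_left mult_ac)
    ultimately show "J v = (c * k) * prod_list (map (\<lambda>l. lform l v) (vs1 @ vs2))" by simp
  qed
  then show ?thesis unfolding splits_over_def using c k vs
    by (intro exI[of _ "c * k"] exI[of _ "vs1 @ vs2"]) auto
qed

lemma zero_notin_invariant_lines: "0 \<notin> invariant_lines Z" by (simp add: invariant_lines_def)

section \<open>Equivalence of quadratic fields\<close>

lemma is_qform_add: "is_qform p \<Longrightarrow> is_qform q \<Longrightarrow> is_qform (\<lambda>v. p v + q v)"
proof -
  assume "is_qform p" "is_qform q"
  then obtain a b c d e f a' b' c' d' e' f' where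
    "\<And>v. p v = qform a b c d e f v" "\<And>v. q v = qform a' b' c' d' e' f' v"
    unfolding is_qform_def by blast
  then have "\<forall>v. p v + q v = qform (a+a') (b+b') (c+c') (d+d') (e+e') (f+f') v"
    by (simp add: qform_def algebra_simps)
  then show ?thesis unfolding is_qform_def by blast
qed

lemma is_qform_cmult: "is_qform p \<Longrightarrow> is_qform (\<lambda>v. k * p v)"
proof -
  assume "is_qform p"
  then obtain a b c d e f where "\<And>v. p v = qform a b c d e f v"
    unfolding is_qform_def by blast
  then have "\<forall>v. k * p v = qform (k*a) (k*b) (k*c) (k*d) (k*e) (k*f) v"
    by (simp add: qform_def algebra_simps)
  then show ?thesis unfolding is_qform_def by blast
qed

lemma is_qform_lform_mult: "is_qform (\<lambda>v. lform l v * lform m v)"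
proof -
  have "\<forall>v. lform l v * lform m v = qform (l$1*m$1) (l$1*m$2+l$2*m$1) (l$2*m$2)
     (l$1*m$3+l$3*m$1) (l$2*m$3+l$3*m$2) (l$3*m$3) v"
    by (simp add: qform_def lform_def power2_eq_square algebra_simps)
  then show ?thesis unfolding is_qform_def by blast
qed

lemma mv_eq_lform: "((N :: complex ^ 3 ^ 3) *v v) $ i = lform (N $ i) v"
  by (simp add: mv3 lform_def)

lemma is_qform_comp:
  assumes "is_qform p" shows "is_qform (\<lambda>v. p (N *v v))"
proof -
  from assms obtain a b c d e f where p: "\<And>v. p v = qform a b c d e f v"
    unfolding is_qform_def by blast
  have "is_qform (\<lambda>v. a * (lform (N$1) v * lform (N$1) v) + b * (lform (N$1) v * lform (N$2) v)
     + c * (lform (N$2) v * lform (N$2) v) + d * (lform (N$1) v * lform (N$3) v)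
     + e * (lform (N$2) v * lform (N$3) v) + f * (lform (N$3) v * lform (N$3) v))"
    by (intro is_qform_add is_qform_cmult is_qform_lform_mult)
  then show ?thesis by (simp add: p qform_def mv_eq_lform power2_eq_square mult.assoc)
qed

text \<open>
Polarization for the direction \<open>c w + k v\<close>, the direction in which an equivalent field is
differentiated.
\<close>

lemma is_qform_polar:
  assumes "is_qform p"
  shows "p (v + (c *s w + k *s v)) - p (c *s w + k *s v)
    = c * (p (v + w) - p w) + (1 + 2 * k - c) * p v"
proof -
  from assms obtain a b c d e f where p: "\<And>v. p v = qform a b c d e f v"
    unfolding is_qform_def by blast
  show ?thesis by (simp add: p qform_def power2_eq_square algebra_simps)
qed

text \<open>
In the determinant the change \<open>L R\<close> only adds multiples of the earlier columns.
\<close>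

lemma inflection_field_equiv:
  assumes Z: "\<And>i. is_qform (\<lambda>v. Z v $ i)"
    and Z': "\<And>v. Z' (N *v v) = c *s (N *v Z v) + lform L v *s (N *v v)"
  shows "inflection Z' (N *v v) = c^3 * det N * inflection Z v"
proof -
  define k where "k = lform L v"
  define w where "w = c *s Z v + k *s v"
  define D where "D = Z (v + Z v) - Z (Z v)"
  have u: "Z' (N *v v) = N *v w"
    unfolding Z' w_def k_def by (simp add: vec.add vec.scale)
  have polar: "Z (v + w) - Z w = c *s D + (1 + 2 * k - c) *s Z v"
    unfolding D_def w_def vec_eq_iff
    by (simp add: is_qform_polar[OF Z]) (simp add: algebra_simps)
  have "Z' (N *v v + Z' (N *v v)) - Z' (Z' (N *v v)) = Z' (N *v (v + w)) - Z' (N *v w)"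
    unfolding u by (simp add: vec.add)
  also have "\<dots> = N *v (c *s (Z (v + w) - Z w) + (lform L (v + w) *s (v + w) - lform L w *s w))"
    unfolding Z' by (simp add: vec_eq_iff mv3 algebra_simps)
  also have "lform L (v + w) *s (v + w) - lform L w *s w = k *s (v + w) + lform L w *s v"
    by (simp add: lform_add k_def vec_eq_iff algebra_simps)
  also have "c *s (Z (v + w) - Z w) + (k *s (v + w) + lform L w *s v)
     = (c^2) *s D + (c * (1 + 2 * k - c) + k * c) *s Z v + (k + k^2 + lform L w) *s v"
    unfolding polar by (simp add: w_def vec_eq_iff power2_eq_square algebra_simps)
  finally have "inflection Z' (N *v v) = det (N ** col_matrix v w ((c^2) *s D + (c * (1 + 2 * k - c) + k * c) *s Z v + (k + k^2 + lform L w) *s v))"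
    unfolding inflection_def u mv_col_matrix by simp
  also have "\<dots> = det N * det (col_matrix v w ((c^2) *s D + (c * (1 + 2 * k - c) + k * c) *s Z v + (k + k^2 + lform L w) *s v))"
    by (rule det_mul)
  also have "det (col_matrix v w ((c^2) *s D + b *s Z v + a *s v)) = c^3 * det (col_matrix v (Z v) D)" for a b
    unfolding det_col_matrix w_def by (simp add: power2_eq_square power3_eq_cube algebra_simps)
  finally show ?thesis unfolding inflection_def D_def by simp
qed

lemma field_equiv_trans:
  assumes "field_equiv Z Z'" "field_equiv Z' Z''" shows "field_equiv Z Z''"
proof -
  from assms(1) obtain N c L where 1: "invertible N" "c \<noteq> 0"
    "\<And>v. Z' (N *v v) = c *s (N *v Z v) + lform L v *s (N *v v)" unfolding field_equiv_def by blast
  from assms(2) obtain M d K where 2: "invertible M" "d \<noteq> 0"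
    "\<And>v. Z'' (M *v v) = d *s (M *v Z' v) + lform K v *s (M *v v)" unfolding field_equiv_def by blast
  have "Z'' ((M ** N) *v v) = (d * c) *s ((M ** N) *v Z v)
     + lform (d *s L + transpose N *v K) v *s ((M ** N) *v v)" for v
    by (simp add: matrix_vector_mul_assoc[symmetric] 2(3) 1(3) lform_mv vec.add vec.scale lform_add_left lform_smult_left
        vec_eq_iff algebra_simps)
  then show ?thesis unfolding field_equiv_def using 1 2
    by (intro exI[of _ "M ** N"] exI[of _ "d * c"] exI[of _ "d *s L + transpose N *v K"])
      (auto simp: invertible_mult)
qed

text \<open>
Invariant lines are transported by the transposed inverse matrix, and the inflection determinant
changes by a nonzero constant only.
\<close>

lemma convex_field_equiv:
  assumes Z: "convex_field Z" and "field_equiv Z Z'" shows "convex_field Z'"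
proof -
  from assms(2) obtain N c L where N: "invertible N" and c: "c \<noteq> 0"
    and Z': "\<And>v. Z' (N *v v) = c *s (N *v Z v) + lform L v *s (N *v v)" unfolding field_equiv_def by blast
  obtain M where M: "N ** M = mat 1" "M ** N = mat 1" using N unfolding invertible_def by blast
  have NM: "N *v (M *v u) = u" and MN: "M *v (N *v u) = u" for u
    by (simp_all add: matrix_vector_mul_assoc M)
  have detN: "det N \<noteq> 0" using N by (simp add: invertible_det_nz)
  have Zu: "Z' u = c *s (N *v Z (M *v u)) + lform L (M *v u) *s u" for u
    using Z'[of "M *v u"] by (simp add: NM)
  have qZ: "\<And>i. is_qform (\<lambda>v. Z v $ i)" using Z by (simp add: convex_field_def)
  have "is_qform (\<lambda>u. Z' u $ i)" for i
  proof -
    have ui: "u $ i = lform (axis i 1) u" for u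
      using exhaust_3[of i] by (auto simp: lform_def axis_def)
    have "is_qform (\<lambda>u. c * (N$i$1 * Z (M *v u) $ 1 + N$i$2 * Z (M *v u) $ 2 + N$i$3 * Z (M *v u) $ 3)
       + lform (transpose M *v L) u * lform (axis i 1) u)"
      by (intro is_qform_add is_qform_cmult is_qform_lform_mult is_qform_comp[OF qZ])
    then show ?thesis by (simp add: Zu mv3 lform_mv ui[symmetric])
  qed
  moreover have "\<exists>u. Z' u \<noteq> lform l u *s (G *v u) + lform K u *s u" if l: "l \<noteq> 0" for l G K
  proof (rule ccontr)
    assume "\<not> ?thesis"
    then have *: "Z' u = lform l u *s (G *v u) + lform K u *s u" for u by blast
    define l' where "l' = (1 / c) *s (transpose N *v l)"
    have "l' \<noteq> 0"
    proof
      assume "l' = 0"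
      then have "lform (transpose N *v l) v = 0" for v using c
        by (metis l'_def lform_eq0_iff lform_smult_left divide_eq_0_iff mult_eq_0_iff one_neq_zero)
      then have "lform l u = 0" for u using NM[of u] lform_mv[of l N] by metis
      then show False using l lform_eq0_iff by blast
    qed
    moreover have "Z v = lform l' v *s ((M ** G ** N) *v v) + lform ((1 / c) *s (transpose N *v K - L)) v *s v" for v
    proof -
      have "Z v = (1 / c) *s (M *v (c *s (N *v Z v)))"
        using c by (simp add: vec.scale MN vector_smult_assoc)
      also have "c *s (N *v Z v) = Z' (N *v v) - lform L v *s (N *v v)" by (simp add: Z')
      also have "\<dots> = lform l (N *v v) *s (G *v (N *v v)) + (lform K (N *v v) - lform L v) *s (N *v v)"
        unfolding * by (simp add: vec_eq_iff algebra_simps)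
      also have "M *v \<dots> = lform l (N *v v) *s (M *v (G *v (N *v v))) + (lform K (N *v v) - lform L v) *s v"
        by (simp add: vec.add vec.scale vec.diff vector_sub_rdistrib MN)
      finally show ?thesis
        by (simp add: l'_def lform_mv lform_smult_left matrix_vector_mul_assoc matrix_mul_assoc vec_eq_iff)
          (simp add: lform_def algebra_simps add_divide_distrib)
    qed
    ultimately show False using Z unfolding convex_field_def by blast
  qed
  moreover have "splits_over (invariant_lines Z') (inflection Z')"
  proof -
    obtain c0 vs where s: "c0 \<noteq> 0" "set vs \<subseteq> invariant_lines Z"
      "\<And>v. inflection Z v = c0 * prod_list (map (\<lambda>l. lform l v) vs)"
      using Z unfolding convex_field_def splits_over_def by blast
    have "inflection Z' u = (c^3 * det N * c0) * prod_list (map (\<lambda>l. lform l u) (map ((*v) (transpose M)) vs))" for u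
      using inflection_field_equiv[OF qZ Z', of "M *v u"] by (simp add: NM s(3) lform_mv o_def)
    moreover have "transpose M *v l \<in> invariant_lines Z'" if "l \<in> invariant_lines Z" for l
    proof -
      have "lform l (M *v Z' u) = 0" if "lform l (M *v u) = 0" for u
        using \<open>l \<in> invariant_lines Z\<close> that by (simp add: Zu vec.add vec.scale MN lform_add lform_smult invariant_lines_def)
      moreover have "transpose M *v l \<noteq> 0"
      proof
        assume "transpose M *v l = 0"
        then have "lform l (M *v u) = 0" for u unfolding lform_mv by (simp add: lform_def)
        then have "lform l v = 0" for v using MN by metis
        then show False using \<open>l \<in> invariant_lines Z\<close> lform_eq0_iff by (auto simp: invariant_lines_def)
      qed
      ultimately show ?thesis by (simp add: invariant_lines_def lform_mv)
    qed
    ultimately show ?thesis unfolding splits_over_def using s c detN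
      by (intro exI[of _ "c^3 * det N * c0"] exI[of _ "map ((*v) (transpose M)) vs"]) auto
  qed
  ultimately show ?thesis unfolding convex_field_def by blast
qed

definition model_H1 where "model_H1 v = (vector [(v $ 1)^2, (v $ 2)^2, 0] :: complex ^ 3)" for v :: "complex ^ 3"
definition model_F1 where "model_F1 v = (vector [0, (v $ 2)^2, (v $ 1)^2] :: complex ^ 3)" for v :: "complex ^ 3"
text \<open>
The sign matches the one produced by contracting the volume form into the given affine form.
\<close>

definition model_F0 where "model_F0 v = (vector [v $ 1 * v $ 3 - (v $ 1)^2, v $ 2 * v $ 3 - (v $ 2)^2, 0] :: complex ^ 3)"
  for v :: "complex ^ 3"

definition equiv_to_model :: "(complex ^ 3 \<Rightarrow> complex ^ 3) \<Rightarrow> bool" where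
  "equiv_to_model Z \<longleftrightarrow> field_equiv Z model_H1 \<or> field_equiv Z model_F1 \<or> field_equiv Z model_F0"

lemma equiv_to_model_trans: "field_equiv Z Z' \<Longrightarrow> equiv_to_model Z' \<Longrightarrow> equiv_to_model Z"
  unfolding equiv_to_model_def using field_equiv_trans by blast

definition row_matrix :: "complex ^ 3 \<Rightarrow> complex ^ 3 \<Rightarrow> complex ^ 3 \<Rightarrow> complex ^ 3 ^ 3" where
  "row_matrix a b c = vector [a, b, c]"

lemma row_matrix_mv: "row_matrix a b c *v v = vector [lform a v, lform b v, lform c v]"
  by (simp add: vec3_eq_iff mv_eq_lform row_matrix_def)

lemma det_row_matrix: "det (row_matrix a b c) = a$1 * b$2 * c$3 + b$1 * c$2 * a$3 + c$1 * a$2 * b$3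
   - a$1 * c$2 * b$3 - b$1 * a$2 * c$3 - c$1 * b$2 * a$3"
  by (simp add: row_matrix_def det_3 algebra_simps)

lemma field_equivI:
  assumes "det (row_matrix a b c) \<noteq> 0" "k \<noteq> 0"
    "\<And>v. Z' (vector [lform a v, lform b v, lform c v]) =
       k *s vector [lform a (Z v), lform b (Z v), lform c (Z v)] + lform L v *s vector [lform a v, lform b v, lform c v]"
  shows "field_equiv Z Z'"
  unfolding field_equiv_def using assms
  by (intro exI[of _ "row_matrix a b c"] exI[of _ k] exI[of _ L]) (simp add: row_matrix_mv invertible_det_nz)

text \<open>
The linear forms \<open>a, b, c\<close> become the coordinate functions, so that invariance of one of them turns
into the divisibility of a component by a coordinate.
\<close>

lemma field_equiv_coords:
  assumes "det (row_matrix a b c) \<noteq> 0"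
  obtains Z' where "field_equiv Z Z'"
    "\<And>v. Z' (vector [lform a v, lform b v, lform c v]) = vector [lform a (Z v), lform b (Z v), lform c (Z v)]"
    "\<And>u :: complex ^ 3. \<exists>v. u = vector [lform a v, lform b v, lform c v]"
proof -
  have N: "invertible (row_matrix a b c)" using assms by (simp add: invertible_det_nz)
  then obtain M where M: "row_matrix a b c ** M = mat 1" "M ** row_matrix a b c = mat 1" unfolding invertible_def by blast
  define Z' where "Z' u = row_matrix a b c *v Z (M *v u)" for u
  have eq: "Z' (row_matrix a b c *v v) = row_matrix a b c *v Z v" for v
    by (simp add: Z'_def matrix_vector_mul_assoc M)
  show ?thesis
  proof (rule that[of Z'])
    show "field_equiv Z Z'" unfolding field_equiv_def
      by (rule exI[of _ "row_matrix a b c"], rule exI[of _ 1], rule exI[of _ 0]) (simp add: N eq lform_def)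
    show "Z' (vector [lform a v, lform b v, lform c v]) = vector [lform a (Z v), lform b (Z v), lform c (Z v)]" for v
      using eq[of v] by (simp add: row_matrix_mv)
    show "\<exists>v. u = vector [lform a v, lform b v, lform c v]" for u :: "complex ^ 3"
      by (rule exI[of _ "M *v u"]) (simp add: row_matrix_mv[symmetric] matrix_vector_mul_assoc M)
  qed
qed

section \<open>Fields tangent to the line at infinity\<close>

definition qform_deriv :: "complex \<Rightarrow> complex \<Rightarrow> complex \<Rightarrow> complex \<Rightarrow> complex \<Rightarrow> complex \<Rightarrow> complex ^ 3 \<Rightarrow> complex ^ 3 \<Rightarrow> complex" where
  "qform_deriv a b c d e f v w = (2 * a * v $ 1 + b * v $ 2 + d * v $ 3) * w $ 1
     + (b * v $ 1 + 2 * c * v $ 2 + e * v $ 3) * w $ 2 + (d * v $ 1 + e * v $ 2 + 2 * f * v $ 3) * w $ 3"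

lemma qform_shift: "qform a b c d e f (v + w) - qform a b c d e f w = qform a b c d e f v + qform_deriv a b c d e f v w"
  by (simp add: qform_def qform_deriv_def power2_eq_square algebra_simps)

lemma inflection_qforms:
  assumes "\<And>v. Z v = vector [qform a b c d e f v, qform a' b' c' d' e' f' v, qform a'' b'' c'' d'' e'' f'' v]"
  shows "inflection Z v = det (col_matrix v (Z v) (vector [qform_deriv a b c d e f v (Z v), qform_deriv a' b' c' d' e' f' v (Z v),
     qform_deriv a'' b'' c'' d'' e'' f'' v (Z v)]))"
proof -
  have "Z (v + Z v) - Z (Z v) = Z v + vector [qform_deriv a b c d e f v (Z v), qform_deriv a' b' c' d' e' f' v (Z v),
     qform_deriv a'' b'' c'' d'' e'' f'' v (Z v)]" (is "_ = _ + ?D")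
    unfolding assms[of "v + Z v"] assms[of "Z v"]
    by (simp add: vec3_eq_iff qform_shift) (simp add: assms[of v])
  moreover have "det (col_matrix v (Z v) (Z v + ?D)) = det (col_matrix v (Z v) ?D)"
    unfolding det_col_matrix by (simp add: algebra_simps)
  ultimately show ?thesis unfolding inflection_def by simp
qed

lemma qform_zero: "qform 0 0 0 0 0 0 v = 0" by (simp add: qform_def)

lemma inflection_planar:
  assumes "\<And>v. Z v = vector [qform a b c d e f v, qform a' b' c' d' e' f' v, 0]"
  shows "inflection Z v = v $ 3 *
    (qform a b c d e f v * ((2*a'* v$1 + b'* v$2 + d'* v$3) * qform a b c d e f v + (b'* v$1 + 2*c'* v$2 + e'* v$3) * qform a' b' c' d' e' f' v)
   - qform a' b' c' d' e' f' v * ((2*a* v$1 + b* v$2 + d* v$3) * qform a b c d e f v + (b* v$1 + 2*c* v$2 + e* v$3) * qform a' b' c' d' e' f' v))"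
proof -
  have "inflection Z v = det (col_matrix v (Z v) (vector [qform_deriv a b c d e f v (Z v), qform_deriv a' b' c' d' e' f' v (Z v),
     qform_deriv 0 0 0 0 0 0 v (Z v)]))"
    by (rule inflection_qforms) (simp add: assms qform_zero)
  then show ?thesis by (simp add: det_col_matrix qform_deriv_def assms algebra_simps)
qed

text \<open>
Nearly every contradiction below ends here, with a common linear factor made explicit.
\<close>

lemma convex_field_coprime:
  assumes "convex_field Z" "l \<noteq> 0"
    "\<And>v. Z v = lform l v *s vector [lform g1 v, lform g2 v, lform g3 v] + lform L v *s v"
  shows False
proof -
  have "Z v = lform l v *s (row_matrix g1 g2 g3 *v v) + lform L v *s v" for v
    using assms(3) by (simp add: row_matrix_mv)
  then show False using assms(1,2) unfolding convex_field_def by blast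
qed

lemma convex_field_splits: "convex_field Z \<Longrightarrow> splits_over (invariant_lines Z) (inflection Z)"
  by (simp add: convex_field_def)

lemma invariant_linesD: "l \<in> invariant_lines Z \<Longrightarrow> lform l v = 0 \<Longrightarrow> lform l (Z v) = 0"
  by (auto simp: invariant_lines_def)

lemma vec3_nz: "(vector [a, b, c] :: complex ^ 3) = 0 \<longleftrightarrow> a = 0 \<and> b = 0 \<and> c = 0"
  by (simp add: vec3_eq_iff)

lemma quadratic_roots:
  assumes "A \<noteq> (0::complex)"
  obtains r s where "A * r^2 + B * r + C = 0" "A * s^2 + B * s + C = 0" "A * (r + s) = - B" "A * (r * s) = C"
proof -
  define D where "D = csqrt (B^2 - 4 * A * C)"
  have D: "D^2 = B^2 - 4 * A * C" by (simp add: D_def)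
  define r s where "r = (- B + D) / (2 * A)" and "s = (- B - D) / (2 * A)"
  have sum: "A * (r + s) = - B" using assms by (simp add: r_def s_def field_simps)
  have "4 * A * (A * (r * s)) = (- B + D) * (- B - D)"
    using assms by (simp add: r_def s_def field_simps)
  also have "\<dots> = B^2 - D^2" by (simp add: power2_eq_square algebra_simps)
  finally have pr: "A * (r * s) = C" using assms by (simp add: D)
  have "A * r^2 + B * r + C = A * r^2 - (A * (r + s)) * r + A * (r * s)" unfolding sum pr by simp
  then have 1: "A * r^2 + B * r + C = 0" by (simp add: power2_eq_square algebra_simps)
  have "A * s^2 + B * s + C = A * s^2 - (A * (r + s)) * s + A * (r * s)" unfolding sum pr by simp
  then have 2: "A * s^2 + B * s + C = 0" by (simp add: power2_eq_square algebra_simps)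
  show ?thesis by (rule that[OF 1 2 sum pr])
qed

section \<open>Two distinct critical points on an invariant line\<close>

text \<open>
The lines \<open>x, y, z\<close> are invariant and \<open>[E\<^sub>0 : F\<^sub>0] = [\<alpha> x\<^sup>2 : b y\<^sup>2]\<close>. The inflection polynomial is
\<open>z E F\<close> times one more linear form, the line through the third fixed point at infinity; its invariance
forces \<open>e = f\<close> or \<open>e = - f\<close>, and these cases differ by a translation of \<open>y\<close>.
\<close>

lemma triangle_two_critical_points:
  assumes convex_field: "convex_field Z"
    and Z: "\<And>v. Z v = vector [v$1 * (\<alpha> * v$1 + e * v$3), v$2 * (b * v$2 + f * v$3), 0]"
    and nz: "\<alpha> \<noteq> 0" "b \<noteq> 0"
  shows "equiv_to_model Z"
proof -
  have Zq: "Z v = vector [qform \<alpha> 0 0 e 0 0 v, qform 0 0 b 0 f 0 v, 0]" for v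
    by (simp add: Z qform_def power2_eq_square algebra_simps)
  let ?l = "vector [- (2 * \<alpha>), 2 * b, f - e] :: complex ^ 3"
  have "inflection Z v = v$3 * (v$1 * (\<alpha> * v$1 + e * v$3)) * (v$2 * (b * v$2 + f * v$3)) * lform ?l v" for v
    unfolding inflection_planar[OF Zq] by (simp add: qform_def lform_def power2_eq_square algebra_simps)
  then have "?l \<in> invariant_lines Z"
    by (intro splits_line[OF convex_field_splits[OF convex_field]]) (auto simp: vec3_nz nz)
  from invariant_linesD[OF this, of "vector [(f - e) / \<alpha>, 0, 2]"] have "(f - e) * (f + e) = 0"
    using nz by (simp add: Z lform_def power2_eq_square field_simps)
  then consider "e = 0" "f = 0" | "f = e" "e \<noteq> 0" | "f = - e" "e \<noteq> 0"
    by (cases "e = 0") (auto simp: eq_neg_iff_add_eq_0)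
  then show ?thesis
  proof cases
    case 1
    have "field_equiv Z model_H1"
      by (rule field_equivI[of "vector [\<alpha>, 0, 0]" "vector [0, b, 0]" "vector [0, 0, 1]" 1 _ _ 0])
        (use nz 1 in \<open>simp_all add: det_row_matrix lform_def Z model_H1_def vec3_eq_iff power2_eq_square\<close>)
    then show ?thesis by (simp add: equiv_to_model_def)
  next
    case 2
    have "field_equiv Z model_F0"
      by (rule field_equivI[of "vector [\<alpha>, 0, 0]" "vector [0, b, 0]" "vector [0, 0, - e]" "- 1" _ _ 0])
        (use nz 2 in \<open>simp_all add: det_row_matrix lform_def Z model_F0_def vec3_eq_iff power2_eq_square algebra_simps\<close>)
    then show ?thesis by (simp add: equiv_to_model_def)
  next
    case 3
    have "field_equiv Z model_F0"
      by (rule field_equivI[of "vector [\<alpha>, 0, 0]" "vector [0, b, - e]" "vector [0, 0, - e]" "- 1" _ _ 0])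
        (use nz 3 in \<open>simp_all add: det_row_matrix lform_def Z model_F0_def vec3_eq_iff power2_eq_square algebra_simps\<close>)
    then show ?thesis by (simp add: equiv_to_model_def)
  qed
qed

lemma splits_div3:
  assumes "splits_over (invariant_lines Z) f" "\<And>v. f v = v $ 3 * J v" "continuous_on UNIV J"
  shows "splits_over (invariant_lines Z) J"
  by (rule splits_div[OF assms(1) zero_notin_invariant_lines, of "vector [0, 0, 1]"])
    (use assms in \<open>simp_all add: lform_def vec3_nz\<close>)

lemma splits_div2:
  assumes "splits_over (invariant_lines Z) f" "\<And>v. f v = (b * v $ 2 + c * v $ 3) * J v" "b \<noteq> 0" "continuous_on UNIV J"
  shows "splits_over (invariant_lines Z) J"
  by (rule splits_div[OF assms(1) zero_notin_invariant_lines, of "vector [0, b, c]"])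
    (use assms in \<open>simp_all add: lform_def vec3_nz\<close>)

text \<open>
The line through the first critical point \<open>[1 : 0 : 0]\<close> is already \<open>y = 0\<close>. The second critical point
is \<open>[k : 1 : 0]\<close>; the invariant line through it becomes the new coordinate \<open>x\<close>.
\<close>

lemma two_critical_points:
  assumes convex_field: "convex_field Z"
    and Z: "\<And>v. Z v = vector [qform \<alpha> \<beta> \<gamma> d e f v, qform 0 0 b 0 g 0 v, 0]"
    and nz: "\<alpha> \<noteq> 0" "b \<noteq> 0"
  shows "equiv_to_model Z"
proof -
  define B where "B v = qform \<alpha> \<beta> \<gamma> d e f v * (2*b* v$2 + g* v$3 - (2*\<alpha>* v$1 + \<beta>* v$2 + d* v$3))
    - qform 0 0 b 0 g 0 v * (\<beta>* v$1 + 2*\<gamma>* v$2 + e* v$3)" for v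
  have cont: "continuous_on UNIV B" unfolding B_def qform_def by (intro continuous_intros)
  have "splits_over (invariant_lines Z) (\<lambda>v. (1 * v$2 + 0 * v$3) * ((b * v$2 + g * v$3) * B v))"
    by (rule splits_div3[OF convex_field_splits[OF convex_field]])
      (simp_all add: inflection_planar[OF Z] B_def qform_def power2_eq_square algebra_simps,
       intro continuous_intros cont)
  then have "splits_over (invariant_lines Z) (\<lambda>v. (b * v$2 + g * v$3) * B v)"
    by (rule splits_div2[OF _ refl]) (auto intro!: continuous_intros cont)
  then have sB: "splits_over (invariant_lines Z) B" by (rule splits_div2[OF _ refl]) (use nz cont in auto)
  \<comment> \<open>\<open>[k : 1]\<close> is the second critical point: there the derivative of \<open>E\<^sub>0\<close> in direction \<open>x\<close> vanishes\<close>
  define k where "k = - \<beta> / (2 * \<alpha>)"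
  have \<beta>: "\<beta> = - 2 * \<alpha> * k" using nz by (simp add: k_def)
  have "B (vector [k, 1, 0]) = 0" unfolding B_def qform_def \<beta> by (simp add: power2_eq_square algebra_simps)
  from splits_root[OF sB this] obtain l where l: "l \<in> invariant_lines Z" "lform l (vector [k, 1, 0]) = 0"
    "\<And>v. lform l v = 0 \<Longrightarrow> B v = 0" by blast
  have l1: "l $ 1 \<noteq> 0"
  proof
    assume "l $ 1 = 0"
    then have "B (vector [1, 0, 0]) = 0" by (intro l(3)) (simp add: lform_def)
    then show False using nz by (simp add: B_def qform_def)
  qed
  define c where "c = - l $ 3 / l $ 1"
  have l2: "l $ 2 = - l $ 1 * k" using l(2) by (simp add: lform_def eq_neg_iff_add_eq_0 add.commute)
  have l3: "l $ 3 = - l $ 1 * c" using l1 by (simp add: c_def)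
  have inv: "qform \<alpha> \<beta> \<gamma> d e f (vector [k*y + c*z, y, z]) = k * qform 0 0 b 0 g 0 (vector [k*y + c*z, y, z])" for y z
  proof -
    have "lform l (Z (vector [k*y + c*z, y, z])) = 0"
      by (rule invariant_linesD[OF l(1)]) (simp add: lform_def l2 l3 algebra_simps)
    then have "l $ 1 * (qform \<alpha> \<beta> \<gamma> d e f (vector [k*y + c*z, y, z]) - k * qform 0 0 b 0 g 0 (vector [k*y + c*z, y, z])) = 0"
      by (simp add: lform_def Z l2 algebra_simps)
    then show ?thesis using l1 by simp
  qed
  have \<gamma>: "\<gamma> = k * b + \<alpha> * k^2" using inv[of 1 0] unfolding \<beta> by (simp add: qform_def power2_eq_square algebra_simps)
  have f: "f = - \<alpha> * c^2 - d * c" using inv[of 0 1]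
    by (simp add: qform_def algebra_simps) (metis add.assoc add.commute eq_neg_iff_add_eq_0 minus_add_distrib)
  have e: "e = k * g - d * k" using inv[of 1 1] unfolding \<beta> \<gamma> f by (simp add: qform_def power2_eq_square algebra_simps)
  define Z' where "Z' v = (vector [v$1 * (\<alpha> * v$1 + (2*\<alpha>*c + d) * v$3), v$2 * (b * v$2 + g * v$3), 0] :: complex ^ 3)" for v :: "complex ^ 3"
  have field_equiv: "field_equiv Z Z'"
    by (rule field_equivI[of "vector [1, - k, - c]" "vector [0, 1, 0]" "vector [0, 0, 1]" 1 _ _ 0])
      (simp_all add: det_row_matrix lform_def Z Z'_def vec3_eq_iff qform_def \<beta> \<gamma> e f power2_eq_square algebra_simps)
  have "equiv_to_model Z'" by (rule triangle_two_critical_points[OF convex_field_equiv[OF convex_field field_equiv] Z'_def nz])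
  then show ?thesis using field_equiv equiv_to_model_trans by blast
qed

section \<open>A common zero on an invariant line\<close>

text \<open>
Here \<open>E\<^sub>0\<close> and \<open>F\<^sub>0\<close> share the factor \<open>y\<close>, and the quotient map \<open>[\<beta> x + \<gamma> y : x]\<close> moves its zero
\<open>[1 : 0]\<close> to \<open>[\<beta> : 1]\<close>. Through \<open>[1 : 0 : 0]\<close> pass no invariant lines except \<open>y\<close> and \<open>z\<close>, so \<open>I / (y z)\<close>, which vanishes there, vanishes on \<open>y = 0\<close>. This
makes \<open>y\<close> a factor of \<open>E\<close> as well as of \<open>F\<close>.
\<close>

lemma base_point_not_fixed:
  assumes convex_field: "convex_field Z"
    and Z: "\<And>v. Z v = vector [qform 0 \<beta> \<gamma> d e f v, qform 0 1 0 0 0 0 v, 0]"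
    and nz: "\<gamma> \<noteq> 0"
  shows False
proof -
  define B where "B v = qform 0 \<beta> \<gamma> d e f v * (qform 0 \<beta> \<gamma> d e f v + (v$1)^2)
    - v$1 * ((\<beta>* v$2 + d* v$3) * qform 0 \<beta> \<gamma> d e f v + (\<beta>* v$1 + 2*\<gamma>* v$2 + e* v$3) * (v$1 * v$2))" for v
  have cont: "continuous_on UNIV B" unfolding B_def qform_def by (intro continuous_intros)
  have "splits_over (invariant_lines Z) (\<lambda>v. (1 * v$2 + 0 * v$3) * B v)"
    by (rule splits_div3[OF convex_field_splits[OF convex_field]])
      (simp_all add: inflection_planar[OF Z] B_def qform_def power2_eq_square algebra_simps,
       intro continuous_intros cont)
  then have sB: "splits_over (invariant_lines Z) B" by (rule splits_div2[OF _ refl]) (use cont in auto)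
  have "B (vector [1, 0, 0]) = 0" by (simp add: B_def qform_def)
  from splits_root[OF sB this] obtain l where l: "l \<in> invariant_lines Z" "lform l (vector [1, 0, 0]) = 0"
    "\<And>v. lform l v = 0 \<Longrightarrow> B v = 0" by blast
  have l1: "l $ 1 = 0" using l(2) by (simp add: lform_def)
  have l2: "l $ 2 \<noteq> 0"
  proof
    assume "l $ 2 = 0"
    then have "B (vector [0, 1, 0]) = 0" using l1 by (intro l(3)) (simp add: lform_def)
    then show False using nz by (simp add: B_def qform_def)
  qed
  have "lform l (Z (vector [1, - l $ 3 / l $ 2, 1])) = 0"
    by (rule invariant_linesD[OF l(1)]) (use l1 l2 in \<open>simp add: lform_def\<close>)
  then have l3: "l $ 3 = 0" using l1 l2 by (simp add: lform_def Z qform_def)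
  have B0: "B (vector [x, 0, z]) = 0" for x z by (rule l(3)) (simp add: lform_def l1 l3)
  have f: "f = 0" using B0[of 0 1] by (simp add: B_def qform_def)
  have d: "d = 0" using B0[of 1 1] by (simp add: B_def qform_def f)
  show False
    by (rule convex_field_coprime[OF convex_field, of "vector [0, 1, 0]" "vector [\<beta>, \<gamma>, e]" "vector [1, 0, 0]" 0 0])
      (simp_all add: vec3_nz Z qform_def f d lform_def vec3_eq_iff power2_eq_square algebra_simps)
qed

text \<open>
After the three invariant lines and \<open>F\<close> are divided out, the inflection polynomial leaves a binary
quadratic form in \<open>y, z\<close>. The lines \<open>y = r z\<close> in its zero set are invariant only for \<open>r = 0\<close> and
\<open>r = - g\<close>, which leaves a single field without a common factor.
\<close>

lemma triangle_base_point:
  assumes convex_field: "convex_field Z"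
    and Z: "\<And>v. Z v = vector [v$1 * (a * v$2 + d * v$3), v$2 * (v$2 + g * v$3), 0]"
    and nz: "a \<noteq> 0" "a \<noteq> 1"
  shows "equiv_to_model Z"
proof -
  have Zq: "Z v = vector [qform 0 a 0 d 0 0 v, qform 0 0 1 0 g 0 v, 0]" for v
    by (simp add: Z qform_def power2_eq_square algebra_simps)
  have inflection: "inflection Z v = v$3 * v$1 * (v$2 * (v$2 + g * v$3)) *
      (a * (1 - a) * (v$2)^2 + 2 * d * (1 - a) * v$2 * v$3 + d * (g - d) * (v$3)^2)" for v
    unfolding inflection_planar[OF Zq] by (simp add: qform_def power2_eq_square algebra_simps)
  have root: "r = 0 \<or> r = - g" if r: "a * (1 - a) * r^2 + 2 * d * (1 - a) * r + d * (g - d) = 0" for r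
  proof -
    have "vector [0, 1, - r] \<in> invariant_lines Z"
    proof (rule splits_line[OF convex_field_splits[OF convex_field]])
      fix v assume "lform (vector [0, 1, - r]) v = 0"
      then have y: "v$2 = r * v$3" by (simp add: lform_def)
      have "a * (1 - a) * (v$2)^2 + 2 * d * (1 - a) * v$2 * v$3 + d * (g - d) * (v$3)^2
        = (v$3)^2 * (a * (1 - a) * r^2 + 2 * d * (1 - a) * r + d * (g - d))"
        unfolding y by (simp add: power2_eq_square algebra_simps)
      then show "inflection Z v = 0" unfolding inflection r by simp
    qed (simp add: vec3_nz)
    from invariant_linesD[OF this, of "vector [0, r, 1]"] have "r * (r + g) = 0" by (simp add: lform_def Z)
    then show ?thesis by (simp add: eq_neg_iff_add_eq_0)
  qed
  have d0: "d \<noteq> 0"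
  proof
    assume "d = 0"
    then show False
      by (intro convex_field_coprime[OF convex_field, of "vector [0, 1, 0]" "vector [a, 0, 0]" "vector [0, 1, g]" 0 0])
        (simp_all add: vec3_nz Z lform_def vec3_eq_iff algebra_simps)
  qed
  have dag: "d \<noteq> a * g"
  proof
    assume "d = a * g"
    then show False
      by (intro convex_field_coprime[OF convex_field, of "vector [0, 1, g]" "vector [a, 0, 0]" "vector [0, 1, 0]" 0 0])
        (simp_all add: vec3_nz Z lform_def vec3_eq_iff algebra_simps)
  qed
  have A: "a * (1 - a) \<noteq> 0" using nz by simp
  obtain r s where rs: "a * (1 - a) * r^2 + 2 * d * (1 - a) * r + d * (g - d) = 0"
    "a * (1 - a) * s^2 + 2 * d * (1 - a) * s + d * (g - d) = 0"
    "a * (1 - a) * (r + s) = - (2 * d * (1 - a))" "a * (1 - a) * (r * s) = d * (g - d)"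
    using quadratic_roots[OF A] by metis
  have "(1 - a) * (a * (r + s) + 2 * d) = a * (1 - a) * (r + s) + 2 * d * (1 - a)" by (simp add: algebra_simps)
  also have "\<dots> = 0" unfolding rs(3) by simp
  finally have "(1 - a) * (a * (r + s) + 2 * d) = 0" .
  then have sum: "a * (r + s) = - (2 * d)" using nz by (simp add: eq_neg_iff_add_eq_0)
  have "(r = 0 \<and> s = - g) \<or> (r = - g \<and> s = 0)"
  proof -
    have "\<not> (r = 0 \<and> s = 0)" using sum d0 by auto
    moreover have "\<not> (r = - g \<and> s = - g)" using sum dag by (auto simp: algebra_simps)
    ultimately show ?thesis using root[OF rs(1)] root[OF rs(2)] by auto
  qed
  then have rs0: "r + s = - g" "r * s = 0" by auto
  have "d = g" using rs(4) rs0 d0 by simp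
  moreover from this have "a = 2" using sum rs0 d0 by simp
  ultimately have ag: "a = 2" "d = g" "g \<noteq> 0" using d0 by auto
  \<comment> \<open>subtracting \<open>(2 y + g z) R\<close> leaves the field \<open>(0, - y\<^sup>2, - w\<^sup>2)\<close> in the coordinates \<open>x, y, w = y + g z\<close>\<close>
  have "field_equiv Z model_H1"
    by (rule field_equivI[of "vector [0, 1, 0]" "vector [0, 1, g]" "vector [1, 0, 0]" "- 1" _ _ "vector [0, 2, g]"])
      (use ag in \<open>simp_all add: det_row_matrix lform_def Z model_H1_def vec3_eq_iff power2_eq_square algebra_simps\<close>)
  then show ?thesis by (simp add: equiv_to_model_def)
qed

text \<open>
Now \<open>[1 : 0 : 0]\<close> is the only singular point on \<open>z = 0\<close>, so every invariant line passes through it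
and \<open>I\<close> does not depend on \<open>x\<close>. That, and the invariance of the lines in the zero set of the
remaining binary form, always produces a common factor.
\<close>

lemma base_point_doubly_fixed:
  assumes convex_field: "convex_field Z"
    and Z: "\<And>v. Z v = vector [qform 0 1 \<gamma> d e f v, qform 0 0 1 0 g 0 v, 0]"
  shows False
proof -
  have \<gamma>: "\<gamma> \<noteq> 0"
  proof
    assume "\<gamma> = 0"
    then show False
      by (intro convex_field_coprime[OF convex_field, of "vector [0, 0, 1]" "vector [d, e, f]" "vector [0, g, 0]" "vector [0, -1, 0]" "vector [0, 1, 0]"])
        (simp_all add: vec3_nz Z qform_def lform_def vec3_eq_iff power2_eq_square algebra_simps)
  qed
  have l1: "l $ 1 = 0" if "l \<in> invariant_lines Z" for l
  proof -
    have "lform l (Z (vector [- l $ 2, l $ 1, 0])) = 0" by (rule invariant_linesD[OF that]) (simp add: lform_def)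
    then have "\<gamma> * (l $ 1)^3 = 0" by (simp add: lform_def Z qform_def power2_eq_square power3_eq_cube algebra_simps)
    then show ?thesis using \<gamma> by simp
  qed
  define B where "B v = qform 0 1 \<gamma> d e f v * (v$2 + (g - d) * v$3)
    - qform 0 0 1 0 g 0 v * (v$1 + 2 * \<gamma> * v$2 + e * v$3)" for v
  have cont: "continuous_on UNIV B" unfolding B_def qform_def by (intro continuous_intros)
  have inflection: "inflection Z v = v$3 * ((1 * v$2 + 0 * v$3) * ((1 * v$2 + g * v$3) * B v))" for v
    by (simp add: inflection_planar[OF Z] B_def qform_def power2_eq_square algebra_simps)
  have "splits_over (invariant_lines Z) (\<lambda>v. (1 * v$2 + 0 * v$3) * ((1 * v$2 + g * v$3) * B v))"
    by (rule splits_div3[OF convex_field_splits[OF convex_field] inflection]) (intro continuous_intros cont)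
  then have "splits_over (invariant_lines Z) (\<lambda>v. (1 * v$2 + g * v$3) * B v)"
    by (rule splits_div2[OF _ refl]) (auto intro!: continuous_intros cont)
  then have sB: "splits_over (invariant_lines Z) B" by (rule splits_div2[OF _ refl]) (use cont in auto)
  have indep: "B (vector [x, y, z]) = B (vector [0, y, z])" for x y z
  proof -
    obtain c vs where s: "set vs \<subseteq> invariant_lines Z" "\<And>v. B v = c * prod_list (map (\<lambda>l. lform l v) vs)"
      using sB unfolding splits_over_def by blast
    have eq: "map (\<lambda>l. lform l (vector [x, y, z])) vs = map (\<lambda>l. lform l (vector [0, y, z])) vs"
      using s(1) l1 by (intro map_cong) (auto simp: lform_def)
    show ?thesis unfolding s(2) eq ..
  qed
  have root: "r = 0 \<or> r = - g" if "\<And>x z. B (vector [x, r * z, z]) = 0" for r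
  proof -
    have "vector [0, 1, - r] \<in> invariant_lines Z"
    proof (rule splits_line[OF sB])
      fix v assume "lform (vector [0, 1, - r]) v = 0"
      then have "v = vector [v$1, r * v$3, v$3]" by (simp add: lform_def vec3_eq_iff)
      then show "B v = 0" using that by metis
    qed (simp add: vec3_nz)
    from invariant_linesD[OF this, of "vector [0, r, 1]"] have "r * (r + g) = 0"
      by (simp add: lform_def Z qform_def power2_eq_square algebra_simps)
    then show ?thesis by (simp add: eq_neg_iff_add_eq_0)
  qed
  have "d * (g - d) = 0" using indep[of 1 0 1] by (simp add: B_def qform_def algebra_simps)
  then consider "d = 0" | "d = g" "g \<noteq> 0" by auto
  then show False
  proof cases
    case 1
    have B: "B v = (v$2 + g * v$3) * (f * (v$3)^2 - \<gamma> * (v$2)^2)" for v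
      by (simp add: B_def qform_def 1 power2_eq_square algebra_simps)
    have f: "f \<noteq> 0"
    proof
      assume "f = 0"
      then show False using 1
        by (intro convex_field_coprime[OF convex_field, of "vector [0, 1, 0]" "vector [1, \<gamma>, e]" "vector [0, 1, g]" 0 0])
          (simp_all add: vec3_nz Z qform_def lform_def vec3_eq_iff power2_eq_square algebra_simps)
    qed
    define r where "r = csqrt (f / \<gamma>)"
    have r2: "\<gamma> * r^2 = f" using \<gamma> by (simp add: r_def)
    have "r \<noteq> 0" using r2 f by auto
    have 1: "B (vector [x, r * z, z]) = 0" for x z by (simp add: B power_mult_distrib r2 flip: mult.assoc)
    have 2: "B (vector [x, (- r) * z, z]) = 0" for x z by (simp add: B power_mult_distrib r2 flip: mult.assoc)
    show False using root[OF 1] root[OF 2] \<open>r \<noteq> 0\<close> by auto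
  next
    case 2
    have B: "B v = v$2 * (- (\<gamma> * (v$2)^2 + (2 * \<gamma> * g) * v$2 * v$3 + (g * e - f) * (v$3)^2))" for v
      by (simp add: B_def qform_def 2 power2_eq_square algebra_simps)
    obtain r s where rs: "\<gamma> * r^2 + (2 * \<gamma> * g) * r + (g * e - f) = 0"
      "\<gamma> * s^2 + (2 * \<gamma> * g) * s + (g * e - f) = 0"
      "\<gamma> * (r + s) = - (2 * \<gamma> * g)" "\<gamma> * (r * s) = g * e - f"
      using quadratic_roots[OF \<gamma>] by metis
    have 0: "B (vector [x, r * z, z]) = 0" if "\<gamma> * r^2 + (2 * \<gamma> * g) * r + (g * e - f) = 0" for r x z
    proof -
      have "B (vector [x, r * z, z]) = - (r * z^3) * (\<gamma> * r^2 + (2 * \<gamma> * g) * r + (g * e - f))"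
        by (simp add: B power2_eq_square power3_eq_cube algebra_simps)
      then show ?thesis using that by simp
    qed
    have "\<gamma> * (r + s) = \<gamma> * (- (2 * g))" using rs(3) by simp
    then have "r + s = - (2 * g)" using \<gamma> by (simp only: mult_cancel_left) simp
    then have "r = - g" "s = - g" using root[OF 0[OF rs(1)]] root[OF 0[OF rs(2)]] 2 by auto
    then have f: "f = g * e - \<gamma> * g^2" using rs(4) by (simp add: power2_eq_square algebra_simps)
    show False
      by (rule convex_field_coprime[OF convex_field, of "vector [0, 1, g]" "vector [1, \<gamma>, e - \<gamma> * g]" "vector [0, 1, 0]" 0 0])
        (simp_all add: vec3_nz Z qform_def f 2 lform_def vec3_eq_iff power2_eq_square algebra_simps)
  qed
qed

text \<open>
For \<open>a \<noteq> 1\<close> the field has a second singular point \<open>[k : 1 : 0]\<close> at infinity, and the invariant line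
through it completes a triangle of invariant lines.
\<close>

lemma base_point_fixed:
  assumes convex_field: "convex_field Z"
    and Z: "\<And>v. Z v = vector [qform 0 a \<gamma> d e f v, qform 0 0 1 0 g 0 v, 0]"
    and nz: "a \<noteq> 0"
  shows "equiv_to_model Z"
proof (cases "a = 1")
  case True
  then show ?thesis using base_point_doubly_fixed[OF convex_field] Z by blast
next
  case False
  define B where "B v = qform 0 a \<gamma> d e f v * (2 * v$2 + g * v$3 - (a * v$2 + d * v$3))
    - qform 0 0 1 0 g 0 v * (a * v$1 + 2*\<gamma>* v$2 + e* v$3)" for v
  have cont: "continuous_on UNIV B" unfolding B_def qform_def by (intro continuous_intros)
  have "splits_over (invariant_lines Z) (\<lambda>v. (1 * v$2 + 0 * v$3) * ((1 * v$2 + g * v$3) * B v))"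
    by (rule splits_div3[OF convex_field_splits[OF convex_field]])
      (simp_all add: inflection_planar[OF Z] B_def qform_def power2_eq_square algebra_simps,
       intro continuous_intros cont)
  then have "splits_over (invariant_lines Z) (\<lambda>v. (1 * v$2 + g * v$3) * B v)"
    by (rule splits_div2[OF _ refl]) (auto intro!: continuous_intros cont)
  then have sB: "splits_over (invariant_lines Z) B" by (rule splits_div2[OF _ refl]) (use cont in auto)
  \<comment> \<open>\<open>y E\<^sub>0 - x F\<^sub>0 = y\<^sup>2 ((a - 1) x + \<gamma> y)\<close>, so \<open>[k : 1]\<close> is the other fixed point at infinity\<close>
  define k where "k = \<gamma> / (1 - a)"
  have "k * (1 - a) = \<gamma>" using False by (simp add: k_def)
  then have \<gamma>: "\<gamma> = k - a * k" by (simp add: algebra_simps)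
  have "B (vector [k, 1, 0]) = 0" unfolding B_def qform_def \<gamma> by (simp add: power2_eq_square algebra_simps)
  from splits_root[OF sB this] obtain l where l: "l \<in> invariant_lines Z" "lform l (vector [k, 1, 0]) = 0"
    "\<And>v. lform l v = 0 \<Longrightarrow> B v = 0" by blast
  have l1: "l $ 1 \<noteq> 0"
  proof
    assume l1: "l $ 1 = 0"
    then have "l $ 2 = 0" using l(2) by (simp add: lform_def)
    then have "B (vector [k + 1, 1, 0]) = 0" using l1 by (intro l(3)) (simp add: lform_def)
    then have "a * (1 - a) = 0" unfolding B_def qform_def \<gamma> by (simp add: power2_eq_square algebra_simps)
    then show False using nz False by simp
  qed
  define c where "c = - l $ 3 / l $ 1"
  have l2: "l $ 2 = - l $ 1 * k" using l(2) by (simp add: lform_def eq_neg_iff_add_eq_0 add.commute)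
  have l3: "l $ 3 = - l $ 1 * c" using l1 by (simp add: c_def)
  have inv: "qform 0 a \<gamma> d e f (vector [k*y + c*z, y, z]) = k * qform 0 0 1 0 g 0 (vector [k*y + c*z, y, z])" for y z
  proof -
    have "lform l (Z (vector [k*y + c*z, y, z])) = 0"
      by (rule invariant_linesD[OF l(1)]) (simp add: lform_def l2 l3 algebra_simps)
    then have "l $ 1 * (qform 0 a \<gamma> d e f (vector [k*y + c*z, y, z]) - k * qform 0 0 1 0 g 0 (vector [k*y + c*z, y, z])) = 0"
      by (simp add: lform_def Z l2 algebra_simps)
    then show ?thesis using l1 by simp
  qed
  have f: "f = - d * c" using inv[of 0 1]
    by (simp add: qform_def algebra_simps eq_neg_iff_add_eq_0)
  have e: "e = k * g - a * c - d * k" using inv[of 1 1] unfolding \<gamma> f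
    by (simp add: qform_def power2_eq_square algebra_simps)
  define Z' where "Z' v = (vector [v$1 * (a * v$2 + d * v$3), v$2 * (v$2 + g * v$3), 0] :: complex ^ 3)" for v :: "complex ^ 3"
  have field_equiv: "field_equiv Z Z'"
    by (rule field_equivI[of "vector [1, - k, - c]" "vector [0, 1, 0]" "vector [0, 0, 1]" 1 _ _ 0])
      (simp_all add: det_row_matrix lform_def Z Z'_def vec3_eq_iff qform_def \<gamma> e f power2_eq_square algebra_simps)
  have "equiv_to_model Z'" by (rule triangle_base_point[OF convex_field_equiv[OF convex_field field_equiv] Z'_def nz False])
  then show ?thesis using field_equiv equiv_to_model_trans by blast
qed

section \<open>Lines with independent restriction\<close>

text \<open>
For a field with third component zero: the restrictions of the first two components to \<open>z = 0\<close> are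
linearly independent.
\<close>

definition indep_at_infinity :: "(complex ^ 3 \<Rightarrow> complex ^ 3) \<Rightarrow> bool" where
  "indep_at_infinity Z \<longleftrightarrow> (\<forall>s t. (\<forall>v. v$3 = 0 \<longrightarrow> s * Z v $ 1 + t * Z v $ 2 = 0) \<longrightarrow> s = 0 \<and> t = 0)"

lemma kernel_2x2:
  assumes "a * d = b * (c :: complex)"
  obtains x y where "x \<noteq> 0 \<or> y \<noteq> 0" "a * x + b * y = 0" "c * x + d * y = 0"
proof -
  consider "a = 0" "b = 0" "c = 0" "d = 0" | "a \<noteq> 0 \<or> b \<noteq> 0" | "c \<noteq> 0 \<or> d \<noteq> 0" by blast
  then show ?thesis
  proof cases
    case 1 then show ?thesis using that[of 1 0] by simp
  next
    case 2 then show ?thesis using that[of "- b" a] assms by (auto simp: algebra_simps)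
  next
    case 3 then show ?thesis using that[of "- d" c] assms by (auto simp: algebra_simps)
  qed
qed

lemma minors_zero_dependent:
  assumes "a1 * b2 = a2 * b1" "a1 * c2 = a2 * c1" "b1 * c2 = c1 * (b2 :: complex)"
  obtains x y where "x \<noteq> 0 \<or> y \<noteq> 0" "x * a1 + y * a2 = 0" "x * b1 + y * b2 = 0" "x * c1 + y * c2 = 0"
proof -
  consider "a1 = 0" "b1 = 0" "c1 = 0" | "a1 \<noteq> 0" | "b1 \<noteq> 0" | "c1 \<noteq> 0" by blast
  then show ?thesis
  proof cases
    case 1 then show ?thesis using that[of 1 0] by simp
  next
    case 2 then show ?thesis using that[of "- a2" a1] assms by (simp add: algebra_simps)
  next
    case 3 then show ?thesis using that[of "- b2" b1] assms by (simp add: algebra_simps)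
  next
    case 4 then show ?thesis using that[of "- c2" c1] assms by (simp add: algebra_simps)
  qed
qed

text \<open>
The hypothesis on \<open>(w\<^sub>1, w\<^sub>2)\<close> says that it lies in the kernel of the Jacobian matrix at the point
\<open>[1 : 0]\<close>. If \<open>E\<^sub>0\<close> does not vanish there, the map \<open>[E\<^sub>0 : F\<^sub>0]\<close> has a second critical point;
otherwise \<open>[1 : 0]\<close> is a common zero.
\<close>

lemma critical_point_normal_form:
  assumes convex_field: "convex_field Z"
    and Z: "\<And>v. Z v = vector [qform \<alpha> \<beta> \<gamma> d e f v, qform 0 b1 b2 0 b3 0 v, 0]"
    and ind: "indep_at_infinity Z"
    and crit: "w1 \<noteq> 0 \<or> w2 \<noteq> 0" "2 * \<alpha> * w1 + \<beta> * w2 = 0" "b1 * w2 = 0"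
  shows "equiv_to_model Z"
proof -
  have ind: "s = 0 \<and> t = 0" if "s * \<alpha> = 0" "s * \<beta> + t * b1 = 0" "s * \<gamma> + t * b2 = 0" for s t
  proof -
    have "s * Z v $ 1 + t * Z v $ 2 = 0" if "v $ 3 = 0" for v
    proof -
      have "s * Z v $ 1 + t * Z v $ 2 = (s * \<alpha>) * (v$1)^2 + (s * \<beta> + t * b1) * v$1 * v$2
         + (s * \<gamma> + t * b2) * (v$2)^2"
        using that by (simp add: Z qform_def algebra_simps)
      then show ?thesis using \<open>s * \<alpha> = 0\<close> \<open>s * \<beta> + t * b1 = 0\<close> \<open>s * \<gamma> + t * b2 = 0\<close> by simp
    qed
    then show ?thesis using ind unfolding indep_at_infinity_def by blast
  qed
  consider "\<alpha> \<noteq> 0" "b1 = 0" | "\<alpha> = 0" "b1 \<noteq> 0" | "\<alpha> = 0" "b1 = 0"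
    using crit by (cases "b1 = 0"; cases "\<alpha> = 0") auto
  then show ?thesis
  proof cases
    case 1
    have "b2 \<noteq> 0" using ind[of 0 1] 1 by auto
    then show ?thesis using two_critical_points[OF convex_field, of \<alpha> \<beta> \<gamma> d e f b2 b3] Z 1 by simp
  next
    case 2
    have nz: "\<gamma> * b1 - \<beta> * b2 \<noteq> 0" using ind[of b1 "- \<beta>"] 2 by (auto simp: algebra_simps)
    define Z' where "Z' v = (vector [qform 0 (\<beta> + b2) (\<gamma> * b1 - \<beta> * b2) d (e * b1 - \<beta> * b3 - d * b2) (f * b1 - d * b3) v,
      qform 0 1 0 0 0 0 v, 0] :: complex ^ 3)" for v
    have field_equiv: "field_equiv Z Z'"
      by (rule field_equivI[of "vector [b1, b2, b3]" "vector [0, 1, 0]" "vector [0, 0, 1]" 1 _ _ 0])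
        (use 2 in \<open>simp_all add: det_row_matrix lform_def Z Z'_def vec3_eq_iff qform_def power2_eq_square algebra_simps\<close>)
    show ?thesis using base_point_not_fixed[OF convex_field_equiv[OF convex_field field_equiv] Z'_def nz] ..
  next
    case 3
    have b2: "b2 \<noteq> 0" using ind[of 0 1] 3 by auto
    have \<beta>: "\<beta> \<noteq> 0" using ind[of b2 "- \<gamma>"] 3 b2 by (auto simp: algebra_simps)
    define Z' where "Z' v = (vector [qform 0 (\<beta> / b2) (\<gamma> / b2) (d / b2) (e / b2) (f / b2) v,
      qform 0 0 1 0 (b3 / b2) 0 v, 0] :: complex ^ 3)" for v
    have field_equiv: "field_equiv Z Z'"
      by (rule field_equivI[of "vector [1, 0, 0]" "vector [0, 1, 0]" "vector [0, 0, 1]" "1 / b2" _ _ 0])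
        (use 3 b2 in \<open>simp_all add: det_row_matrix lform_def Z Z'_def vec3_eq_iff qform_def field_simps\<close>)
    have "equiv_to_model Z'" by (rule base_point_fixed[OF convex_field_equiv[OF convex_field field_equiv] Z'_def]) (use \<beta> b2 in simp)
    then show ?thesis using field_equiv equiv_to_model_trans by blast
  qed
qed

text \<open>
A zero of the Jacobian determinant at infinity lies on a further invariant line; this line becomes
\<open>y = 0\<close> and the point becomes \<open>[1 : 0 : 0]\<close>.
\<close>

lemma equiv_to_model_if_indep:
  assumes convex_field: "convex_field Z"
    and Z: "\<And>v. Z v = vector [qform a1 b1 c1 d1 e1 f1 v, qform a2 b2 c2 d2 e2 f2 v, 0]"
    and ind: "indep_at_infinity Z"
  shows "equiv_to_model Z"
proof -
  define J where "J v = qform a1 b1 c1 d1 e1 f1 v * ((2*a2* v$1 + b2* v$2 + d2* v$3) * qform a1 b1 c1 d1 e1 f1 v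
        + (b2* v$1 + 2*c2* v$2 + e2* v$3) * qform a2 b2 c2 d2 e2 f2 v)
   - qform a2 b2 c2 d2 e2 f2 v * ((2*a1* v$1 + b1* v$2 + d1* v$3) * qform a1 b1 c1 d1 e1 f1 v
        + (b1* v$1 + 2*c1* v$2 + e1* v$3) * qform a2 b2 c2 d2 e2 f2 v)" for v
  have cont: "continuous_on UNIV J" unfolding J_def qform_def by (intro continuous_intros)
  have sJ: "splits_over (invariant_lines Z) J"
    by (rule splits_div3[OF convex_field_splits[OF convex_field] _ cont]) (simp add: inflection_planar[OF Z] J_def)
  define A B C where "A = a1*b2 - a2*b1" and "B = 2 * (a1*c2 - a2*c1)" and "C = b1*c2 - c1*b2"
  have J0: "J (vector [x, y, 0]) = - ((a1 - b2) * x^2*y - a2 * x^3 + (b1 - c2) * x*y^2 + c1 * y^3) *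
     (A * x^2 + B * x * y + C * y^2)" for x y
  proof -
    define E F where "E = a1 * x^2 + b1 * x * y + c1 * y^2" and "F = a2 * x^2 + b2 * x * y + c2 * y^2"
    define e1 e2 f1 f2 where ef: "e1 = 2*a1*x + b1*y" "e2 = b1*x + 2*c1*y" "f1 = 2*a2*x + b2*y" "f2 = b2*x + 2*c2*y"
    have EF: "E = (x * e1 + y * e2) / 2" "F = (x * f1 + y * f2) / 2"
      by (simp_all add: E_def F_def ef power2_eq_square algebra_simps)
    have "E * (f1 * E + f2 * F) - F * (e1 * E + e2 * F) = - (y * E - x * F) * ((e1 * f2 - e2 * f1) / 2)"
      unfolding EF by (simp add: field_simps)
    also have "(e1 * f2 - e2 * f1) / 2 = A * x^2 + B * x * y + C * y^2"
      by (simp add: ef A_def B_def C_def power2_eq_square field_simps)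
    also have "y * E - x * F = (a1 - b2) * x^2*y - a2 * x^3 + (b1 - c2) * x*y^2 + c1 * y^3"
      by (simp add: E_def F_def power2_eq_square power3_eq_cube algebra_simps)
    finally show ?thesis by (simp add: J_def qform_def E_def F_def ef)
  qed
  have "\<exists>x0 y0. (x0 \<noteq> 0 \<or> y0 \<noteq> 0) \<and> A * x0^2 + B * x0 * y0 + C * y0^2 = 0"
  proof (cases "A = 0")
    case True then show ?thesis by (intro exI[of _ 1] exI[of _ 0]) simp
  next
    case False
    then obtain r where "A * r^2 + B * r + C = 0" using quadratic_roots by metis
    then show ?thesis by (intro exI[of _ r] exI[of _ 1]) simp
  qed
  then obtain x0 y0 where P0: "x0 \<noteq> 0 \<or> y0 \<noteq> 0" "A * x0^2 + B * x0 * y0 + C * y0^2 = 0" by blast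
  have "J (vector [x0, y0, 0]) = 0" using J0 P0(2) by simp
  from splits_root[OF sJ this] obtain l where l: "l \<in> invariant_lines Z" "lform l (vector [x0, y0, 0]) = 0"
    "\<And>v. lform l v = 0 \<Longrightarrow> J v = 0" by blast
  have l12: "l $ 1 \<noteq> 0 \<or> l $ 2 \<noteq> 0"
  proof (rule ccontr)
    assume "\<not> ?thesis"
    then have "J (vector [x, y, 0]) = 0" for x y by (intro l(3)) (simp add: lform_def)
    then have "poly ([:- a2, a1 - b2, b1 - c2, c1:] * [:A, B, C:]) y = 0" for y
      using J0[of 1 y] by (simp add: power2_eq_square power3_eq_cube algebra_simps)
    then have "[:- a2, a1 - b2, b1 - c2, c1:] * [:A, B, C:] = 0" using poly_all_0_iff_0 by blast
    then consider "a2 = 0" "a1 = b2" "b1 = c2" "c1 = 0" | "A = 0" "B = 0" "C = 0" by auto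
    then show False
    proof cases
      case 1
      show False
        by (rule convex_field_coprime[OF convex_field, of "vector [0, 0, 1]" "vector [d1, e1, f1]" "vector [d2, e2, f2]"
              "vector [- a1, - b1, 0]" "vector [a1, b1, 0]"])
          (simp_all add: vec3_nz Z qform_def 1 lform_def vec3_eq_iff power2_eq_square algebra_simps)
    next
      case 2
      then have "a1 * b2 = a2 * b1" "a1 * c2 = a2 * c1" "b1 * c2 = c1 * b2" by (auto simp: A_def B_def C_def)
      then obtain x y where xy: "x \<noteq> 0 \<or> y \<noteq> 0" "x * a1 + y * a2 = 0" "x * b1 + y * b2 = 0" "x * c1 + y * c2 = 0"
        by (rule minors_zero_dependent)
      have "x * Z v $ 1 + y * Z v $ 2 = 0" if "v$3 = 0" for v
      proof -
        have "x * Z v $ 1 + y * Z v $ 2 = (x * a1 + y * a2) * (v$1)^2 + (x * b1 + y * b2) * v$1 * v$2 + (x * c1 + y * c2) * (v$2)^2"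
          using that by (simp add: Z qform_def algebra_simps)
        then show ?thesis using xy by simp
      qed
      then show False using ind xy(1) unfolding indep_at_infinity_def by blast
    qed
  qed
  have l0: "l $ 1 * x0 + l $ 2 * y0 = 0" using l(2) by (simp add: lform_def)
  \<comment> \<open>the new \<open>x\<close> is \<open>p x + q y\<close>, with value 1 at the critical point, the new \<open>y\<close> is \<open>l\<close>, with value 0\<close>
  obtain p q where pq: "p * x0 + q * y0 = 1"
  proof (cases "x0 = 0")
    case True then show ?thesis using P0 that[of 0 "1 / y0"] by simp
  next
    case False then show ?thesis using that[of "1 / x0" 0] by simp
  qed
  have det: "p * l $ 2 - l $ 1 * q \<noteq> 0"
  proof
    assume 0: "p * l $ 2 - l $ 1 * q = 0"
    have "l $ 2 = (p * l $ 2 - l $ 1 * q) * x0 + q * (l $ 1 * x0 + l $ 2 * y0) + l $ 2 * (1 - (p * x0 + q * y0))"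
      by (simp add: algebra_simps)
    moreover have "l $ 1 = p * (l $ 1 * x0 + l $ 2 * y0) - (p * l $ 2 - l $ 1 * q) * y0 + l $ 1 * (1 - (p * x0 + q * y0))"
      by (simp add: algebra_simps)
    ultimately show False using l12 0 l0 pq by auto
  qed
  let ?a = "vector [p, q, 0] :: complex ^ 3" and ?c = "vector [0, 0, 1] :: complex ^ 3"
  have det': "det (row_matrix ?a l ?c) \<noteq> 0" using det by (simp add: det_row_matrix)
  obtain Z' where field_equiv: "field_equiv Z Z'"
    and Z': "\<And>v. Z' (vector [lform ?a v, lform l v, lform ?c v]) = vector [lform ?a (Z v), lform l (Z v), lform ?c (Z v)]"
    and surj: "\<And>u :: complex ^ 3. \<exists>v. u = vector [lform ?a v, lform l v, lform ?c v]"
    by (rule field_equiv_coords[OF det', where Z = Z]) blast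
  have cvx': "convex_field Z'" by (rule convex_field_equiv[OF convex_field field_equiv])
  then have "is_qform (\<lambda>v. Z' v $ 1)" "is_qform (\<lambda>v. Z' v $ 2)" by (auto simp: convex_field_def)
  then obtain \<alpha> \<beta> \<gamma> d e f \<alpha>' \<beta>' \<gamma>' d' e' f' where
    E: "\<And>u. Z' u $ 1 = qform \<alpha> \<beta> \<gamma> d e f u" and F: "\<And>u. Z' u $ 2 = qform \<alpha>' \<beta>' \<gamma>' d' e' f' u"
    unfolding is_qform_def by metis
  have G: "Z' u $ 3 = 0" for u
  proof -
    obtain v where "u = vector [lform ?a v, lform l v, lform ?c v]" using surj by blast
    then show ?thesis by (simp add: Z') (simp add: lform_def Z)
  qed
  have F0: "Z' u $ 2 = 0" if "u $ 2 = 0" for u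
  proof -
    obtain v where v: "u = vector [lform ?a v, lform l v, lform ?c v]" using surj by blast
    then have "lform l v = 0" using that by simp
    then show ?thesis unfolding v Z' using invariant_linesD[OF l(1)] by simp
  qed
  have z: "\<alpha>' = 0" "f' = 0" "d' = 0"
    using F0[of "vector [1, 0, 0]"] F0[of "vector [0, 0, 1]"] F0[of "vector [1, 0, 1]"]
    by (auto simp: F qform_def)
  have ZZ: "Z' u = vector [qform \<alpha> \<beta> \<gamma> d e f u, qform 0 \<beta>' \<gamma>' 0 e' 0 u, 0]" for u
    by (simp add: vec3_eq_iff E F G z)
  have ind': "indep_at_infinity Z'"
    unfolding indep_at_infinity_def
  proof (intro allI impI)
    fix s t assume *: "\<forall>u. u $ 3 = 0 \<longrightarrow> s * Z' u $ 1 + t * Z' u $ 2 = 0"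
    have "(s * p + t * l $ 1) * Z v $ 1 + (s * q + t * l $ 2) * Z v $ 2 = 0" if "v $ 3 = 0" for v
    proof -
      have "(vector [lform ?a v, lform l v, lform ?c v] :: complex ^ 3) $ 3 = 0" using that by (simp add: lform_def)
      from *[rule_format, OF this] have "s * lform ?a (Z v) + t * lform l (Z v) = 0" by (simp only: Z' vector_3)
      then show ?thesis by (simp add: lform_def Z algebra_simps)
    qed
    then have 0: "s * p + t * l $ 1 = 0" "s * q + t * l $ 2 = 0"
      using ind unfolding indep_at_infinity_def by blast+
    have "s * (p * l $ 2 - l $ 1 * q) = (s * p + t * l $ 1) * l $ 2 - (s * q + t * l $ 2) * l $ 1"
      "t * (p * l $ 2 - l $ 1 * q) = (s * q + t * l $ 2) * p - (s * p + t * l $ 1) * q"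
      by (simp_all add: algebra_simps)
    then show "s = 0 \<and> t = 0" using det unfolding 0 by simp
  qed
  have "(2*a1*x0 + b1*y0) * (b2*x0 + 2*c2*y0) - (b1*x0 + 2*c1*y0) * (2*a2*x0 + b2*y0)
     = 2 * (A * x0^2 + B * x0 * y0 + C * y0^2)"
    by (simp add: A_def B_def C_def power2_eq_square algebra_simps)
  then have "(2*a1*x0 + b1*y0) * (b2*x0 + 2*c2*y0) = (b1*x0 + 2*c1*y0) * (2*a2*x0 + b2*y0)"
    using P0(2) by simp
  then obtain w1 w2 where w: "w1 \<noteq> 0 \<or> w2 \<noteq> 0" "(2*a1*x0 + b1*y0) * w1 + (b1*x0 + 2*c1*y0) * w2 = 0"
    "(2*a2*x0 + b2*y0) * w1 + (b2*x0 + 2*c2*y0) * w2 = 0"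
    by (rule kernel_2x2)
  \<comment> \<open>being critical is expressed by additivity of \<open>Z\<close> at \<open>P\<close> in direction \<open>w\<close>, which is independent of coordinates\<close>
  let ?P = "vector [x0, y0, 0] :: complex ^ 3" and ?w = "vector [w1, w2, 0] :: complex ^ 3"
  have add: "Z (?P + ?w) = Z ?P + Z ?w"
  proof -
    have "qform a1 b1 c1 d1 e1 f1 (?P + ?w) = qform a1 b1 c1 d1 e1 f1 ?P + qform a1 b1 c1 d1 e1 f1 ?w
       + ((2*a1*x0 + b1*y0) * w1 + (b1*x0 + 2*c1*y0) * w2)"
     "qform a2 b2 c2 d2 e2 f2 (?P + ?w) = qform a2 b2 c2 d2 e2 f2 ?P + qform a2 b2 c2 d2 e2 f2 ?w
       + ((2*a2*x0 + b2*y0) * w1 + (b2*x0 + 2*c2*y0) * w2)"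
      by (simp_all add: qform_def power2_eq_square algebra_simps)
    then show ?thesis unfolding w by (simp add: Z vec3_eq_iff)
  qed
  define W1 W2 where "W1 = p * w1 + q * w2" and "W2 = l $ 1 * w1 + l $ 2 * w2"
  have *: "Z' (vector [1 + W1, W2, 0]) = Z' (vector [1, 0, 0]) + Z' (vector [W1, W2, 0])"
  proof -
    have vals: "lform ?a ?P = 1" "lform l ?P = 0" "lform ?c ?P = 0" "lform ?a ?w = W1" "lform l ?w = W2" "lform ?c ?w = 0"
      using l0 pq by (simp_all add: lform_def W1_def W2_def)
    have "vector [lform ?a (Z (?P + ?w)), lform l (Z (?P + ?w)), lform ?c (Z (?P + ?w))] =
      vector [lform ?a (Z ?P), lform l (Z ?P), lform ?c (Z ?P)] + (vector [lform ?a (Z ?w), lform l (Z ?w), lform ?c (Z ?w)] :: complex ^ 3)"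
      unfolding add lform_add by (simp only: vec3_eq_iff vector_add_component vector_3)
    then have "Z' (vector [lform ?a (?P + ?w), lform l (?P + ?w), lform ?c (?P + ?w)]) =
      Z' (vector [lform ?a ?P, lform l ?P, lform ?c ?P]) + Z' (vector [lform ?a ?w, lform l ?w, lform ?c ?w])"
      unfolding Z' .
    then show ?thesis unfolding lform_add vals by simp
  qed
  have c1: "2 * \<alpha> * W1 + \<beta> * W2 = 0" "\<beta>' * W2 = 0"
    using * by (simp_all add: ZZ vec3_eq_iff qform_def power2_eq_square algebra_simps)
  have "W1 \<noteq> 0 \<or> W2 \<noteq> 0"
  proof (rule ccontr)
    assume "\<not> ?thesis"
    then have 0: "W1 = 0" "W2 = 0" by auto
    have "w1 * (p * l $ 2 - l $ 1 * q) = W1 * l $ 2 - W2 * q" "w2 * (p * l $ 2 - l $ 1 * q) = W2 * p - W1 * l $ 1"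
      by (simp_all add: W1_def W2_def algebra_simps)
    then show False using w(1) det unfolding 0 by simp
  qed
  then have "equiv_to_model Z'" using critical_point_normal_form[OF cvx' ZZ ind' _ c1] by blast
  then show ?thesis using field_equiv equiv_to_model_trans by blast
qed

lemma splits_div_form:
  assumes "splits_over (invariant_lines Z) f" "\<And>v. f v = (a * v $ 1 + b * v $ 2 + c * v $ 3) * J v"
    "a \<noteq> 0 \<or> b \<noteq> 0 \<or> c \<noteq> 0" "continuous_on UNIV J"
  shows "splits_over (invariant_lines Z) J"
  by (rule splits_div[OF assms(1) zero_notin_invariant_lines, of "vector [a, b, c]"])
    (use assms in \<open>auto simp: lform_def vec3_nz\<close>)

lemma convex_field_inflection_nonzero:
  assumes "convex_field Z" obtains v where "inflection Z v \<noteq> 0"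
  using splits_not_zero[OF convex_field_splits[OF assms]] by blast

section \<open>Two invariant lines\<close>

text \<open>
The inflection polynomial is divisible by \<open>x\<^sup>2 z\<^sup>2\<close>. The remaining conic passes through \<open>[0 : 1 : 0]\<close>, but
the invariant lines through this point are only \<open>x\<close> and \<open>z\<close>, and the conic contains neither.
\<close>

lemma saddle_node_not_convex:
  assumes convex_field: "convex_field Z"
    and Z: "\<And>v. Z v = vector [0, h * (v$3)^2 - p * v$1 * v$2, g * (v$3)^2]"
    and nz: "p \<noteq> 0" "g \<noteq> 0"
  shows False
proof -
  have Zq: "Z v = vector [qform 0 0 0 0 0 0 v, qform 0 (- p) 0 0 0 h v, qform 0 0 0 0 0 g v]" for v
    by (simp add: Z qform_def)
  define q where "q v = g * p * (h * (v$3)^2 - v$2 * (2 * g * v$3 + p * v$1))" for v :: "complex ^ 3"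
  have cont: "continuous_on UNIV q" unfolding q_def by (intro continuous_intros)
  have inflection: "inflection Z v = (1 * v$1 + 0 * v$2 + 0 * v$3) * ((1 * v$1 + 0 * v$2 + 0 * v$3) *
     ((0 * v$1 + 0 * v$2 + 1 * v$3) * ((0 * v$1 + 0 * v$2 + 1 * v$3) * q v)))" for v
    unfolding inflection_qforms[OF Zq]
    by (simp add: det_col_matrix qform_deriv_def Z q_def power2_eq_square algebra_simps)
  have "splits_over (invariant_lines Z) (\<lambda>v. (1 * v$1 + 0 * v$2 + 0 * v$3) * ((0 * v$1 + 0 * v$2 + 1 * v$3) * ((0 * v$1 + 0 * v$2 + 1 * v$3) * q v)))"
    by (rule splits_div_form[OF convex_field_splits[OF convex_field] inflection]) (auto intro!: continuous_intros cont)
  then have "splits_over (invariant_lines Z) (\<lambda>v. (0 * v$1 + 0 * v$2 + 1 * v$3) * ((0 * v$1 + 0 * v$2 + 1 * v$3) * q v))"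
    by (rule splits_div_form[OF _ refl]) (auto intro!: continuous_intros cont)
  then have "splits_over (invariant_lines Z) (\<lambda>v. (0 * v$1 + 0 * v$2 + 1 * v$3) * q v)"
    by (rule splits_div_form[OF _ refl]) (auto intro!: continuous_intros cont)
  then have sq: "splits_over (invariant_lines Z) q"
    by (rule splits_div_form[OF _ refl]) (use cont in auto)
  have "q (vector [0, 1, 0]) = 0" by (simp add: q_def)
  from splits_root[OF sq this] obtain l where l: "l \<in> invariant_lines Z" "lform l (vector [0, 1, 0]) = 0"
    "\<And>v. lform l v = 0 \<Longrightarrow> q v = 0" by blast
  have l2: "l $ 2 = 0" using l(2) by (simp add: lform_def)
  have l1: "l $ 1 \<noteq> 0"
  proof
    assume "l $ 1 = 0"
    then have "q (vector [1, 1, 0]) = 0" using l2 by (intro l(3)) (simp add: lform_def)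
    then show False using nz by (simp add: q_def)
  qed
  have "lform l (Z (vector [- l $ 3 / l $ 1, 0, 1])) = 0" by (rule invariant_linesD[OF l(1)]) (use l1 in \<open>simp add: lform_def\<close>)
  then have l3: "l $ 3 = 0" using nz l2 by (simp add: lform_def Z)
  have q0: "q (vector [0, y, 1]) = 0" for y by (rule l(3)) (simp add: lform_def l2 l3)
  have "h = 0" using q0[of 0] nz by (simp add: q_def)
  then show False using q0[of 1] nz by (simp add: q_def)
qed

text \<open>
Besides \<open>x, z\<close> and \<open>g z - p x\<close> there is one more line in the inflection divisor, and its invariance
gives \<open>f = 0\<close>.
\<close>

lemma squares_diagonal:
  assumes convex_field: "convex_field Z"
    and Z: "\<And>v. Z v = vector [p * (v$1)^2, f * v$1 * v$3, g * (v$3)^2]"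
    and nz: "p \<noteq> 0" "g \<noteq> 0"
  shows "equiv_to_model Z"
proof -
  have Zq: "Z v = vector [qform p 0 0 0 0 0 v, qform 0 0 0 f 0 0 v, qform 0 0 0 0 0 g v]" for v
    by (simp add: Z qform_def)
  let ?l = "vector [f * p, - (2 * p * g), f * g] :: complex ^ 3"
  have "inflection Z v = (v$1)^2 * (v$3)^2 * (g * v$3 - p * v$1) * lform ?l v" for v
    unfolding inflection_qforms[OF Zq]
    by (simp add: det_col_matrix qform_deriv_def Z lform_def power2_eq_square algebra_simps)
  then have "?l \<in> invariant_lines Z"
    by (intro splits_line[OF convex_field_splits[OF convex_field]]) (auto simp: vec3_nz nz)
  from invariant_linesD[OF this, of "vector [0, f / (2 * p), 1]"] have "f = 0"
    using nz by (simp add: lform_def Z)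
  then have "field_equiv Z model_H1"
    by (intro field_equivI[of "vector [p, 0, 0]" "vector [0, 0, g]" "vector [0, 1, 0]" 1 _ _ 0])
      (use nz in \<open>simp_all add: det_row_matrix lform_def Z model_H1_def vec3_eq_iff power2_eq_square\<close>)
  then show ?thesis by (simp add: equiv_to_model_def)
qed

text \<open>
The component \<open>x\<close> is constant along the field, so the extra inflection line \<open>2 f\<^sub>1 x + f\<^sub>4 z\<close> is invariant
only if it is \<open>x = 0\<close>. This is where the model \<open>F\<^sub>1\<close> appears.
\<close>

lemma squares_nilpotent:
  assumes convex_field: "convex_field Z"
    and Z: "\<And>v. Z v = vector [0, f1 * (v$1)^2 + f4 * v$1 * v$3, g * (v$3)^2]"
    and nz: "g \<noteq> 0"
  shows "equiv_to_model Z"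
proof -
  have Zq: "Z v = vector [qform 0 0 0 0 0 0 v, qform f1 0 0 f4 0 0 v, qform 0 0 0 0 0 g v]" for v
    by (simp add: Z qform_def)
  have f1: "f1 \<noteq> 0"
  proof
    assume "f1 = 0"
    then show False
      by (intro convex_field_coprime[OF convex_field, of "vector [0, 0, 1]" 0 "vector [f4, 0, 0]" "vector [0, 0, g]" 0])
        (simp_all add: vec3_nz Z lform_def vec3_eq_iff power2_eq_square algebra_simps)
  qed
  let ?l = "vector [2 * f1, 0, f4] :: complex ^ 3"
  have "inflection Z v = g^2 * (v$1)^2 * (v$3)^3 * lform ?l v" for v
    unfolding inflection_qforms[OF Zq]
    by (simp add: det_col_matrix qform_deriv_def Z lform_def power2_eq_square power3_eq_cube algebra_simps)
  then have "?l \<in> invariant_lines Z"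
    by (intro splits_line[OF convex_field_splits[OF convex_field]]) (auto simp: vec3_nz f1)
  from invariant_linesD[OF this, of "vector [- f4, 0, 2 * f1]"] have "f4 = 0"
    using nz f1 by (simp add: lform_def Z)
  then have "field_equiv Z model_F1"
    by (intro field_equivI[of "vector [1, 0, 0]" "vector [0, 0, g]" "vector [0, 1 / f1, 0]" 1 _ _ 0])
      (use nz f1 in \<open>simp_all add: det_row_matrix lform_def Z model_F1_def vec3_eq_iff power2_eq_square\<close>)
  then show ?thesis by (simp add: equiv_to_model_def)
qed

lemma invariant_lines_squares:
  assumes convex_field: "convex_field Z"
    and Z: "\<And>v. Z v = vector [p * (v$1)^2, f1 * (v$1)^2 + f4 * v$1 * v$3 + f6 * (v$3)^2, g * (v$3)^2]"
  shows "equiv_to_model Z"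
proof -
  consider "p \<noteq> 0" "g \<noteq> 0" | "p = 0" "g \<noteq> 0" | "p \<noteq> 0" "g = 0" | "p = 0" "g = 0" by blast
  then show ?thesis
  proof cases
    case 1
    define Z' where "Z' v = (vector [p * (v$1)^2, f4 * v$1 * v$3, g * (v$3)^2] :: complex ^ 3)" for v :: "complex ^ 3"
    have field_equiv: "field_equiv Z Z'"
      by (rule field_equivI[of "vector [1, 0, 0]" "vector [- f1 / p, 1, - f6 / g]" "vector [0, 0, 1]" 1 _ _ 0])
        (use 1 in \<open>simp_all add: det_row_matrix lform_def Z Z'_def vec3_eq_iff power2_eq_square algebra_simps\<close>)
    show ?thesis using squares_diagonal[OF convex_field_equiv[OF convex_field field_equiv] Z'_def 1] equiv_to_model_trans[OF field_equiv] by blast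
  next
    case 2
    define Z' where "Z' v = (vector [0, f1 * (v$1)^2 + f4 * v$1 * v$3, g * (v$3)^2] :: complex ^ 3)" for v :: "complex ^ 3"
    have field_equiv: "field_equiv Z Z'"
      by (rule field_equivI[of "vector [1, 0, 0]" "vector [0, 1, - f6 / g]" "vector [0, 0, 1]" 1 _ _ 0])
        (use 2 in \<open>simp_all add: det_row_matrix lform_def Z Z'_def vec3_eq_iff power2_eq_square algebra_simps\<close>)
    show ?thesis using squares_nilpotent[OF convex_field_equiv[OF convex_field field_equiv] Z'_def 2(2)] equiv_to_model_trans[OF field_equiv] by blast
  next
    case 3
    define Z' where "Z' v = (vector [0, f6 * (v$1)^2 + f4 * v$1 * v$3, p * (v$3)^2] :: complex ^ 3)" for v :: "complex ^ 3"
    have field_equiv: "field_equiv Z Z'"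
      by (rule field_equivI[of "vector [0, 0, 1]" "vector [- f1 / p, 1, 0]" "vector [1, 0, 0]" 1 _ _ 0])
        (use 3 in \<open>simp_all add: det_row_matrix lform_def Z Z'_def vec3_eq_iff power2_eq_square algebra_simps\<close>)
    show ?thesis using squares_nilpotent[OF convex_field_equiv[OF convex_field field_equiv] Z'_def 3(1)] equiv_to_model_trans[OF field_equiv] by blast
  next
    case 4
    have Zq: "Z v = vector [qform 0 0 0 0 0 0 v, qform f1 0 0 f4 0 f6 v, qform 0 0 0 0 0 0 v]" for v
      by (simp add: Z qform_def 4)
    have "inflection Z v = 0" for v
      unfolding inflection_qforms[OF Zq] by (simp add: det_col_matrix qform_deriv_def Z 4)
    then show ?thesis using convex_field_inflection_nonzero[OF convex_field] by blast
  qed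
qed

text \<open>
Subtracting \<open>p x R\<close> and completing the second component in \<open>y\<close> gives the saddle-node form.
\<close>

lemma saddle_node_not_convex_radial:
  assumes convex_field: "convex_field Z"
    and Z: "\<And>v. Z v = vector [p * (v$1)^2, f1 * (v$1)^2 + f4 * v$1 * v$3 + f6 * (v$3)^2, v$3 * (p * v$1 + g * v$3)]"
    and nz: "p \<noteq> 0" "g \<noteq> 0"
  shows False
proof -
  define Z' where "Z' v = (vector [0, (f6 - f4 * g / p) * (v$3)^2 - p * v$1 * v$2, g * (v$3)^2] :: complex ^ 3)" for v :: "complex ^ 3"
  have field_equiv: "field_equiv Z Z'"
    by (rule field_equivI[of "vector [1, 0, 0]" "vector [- f1 / p, 1, - f4 / p]" "vector [0, 0, 1]" 1 _ _ "vector [- p, 0, 0]"])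
      (use nz in \<open>simp_all add: det_row_matrix lform_def Z Z'_def vec3_eq_iff power2_eq_square field_simps\<close>)
  show False by (rule saddle_node_not_convex[OF convex_field_equiv[OF convex_field field_equiv] Z'_def nz])
qed

text \<open>
Modulo \<open>R\<close> only the second component survives, so all orbits are straight lines and \<open>I = 0\<close>.
\<close>

lemma degenerate_not_convex:
  assumes convex_field: "convex_field Z"
    and Z: "\<And>v. Z v = vector [v$1 * (p1 * v$1 + p2 * v$2 + p3 * v$3), f1 * (v$1)^2 + f4 * v$1 * v$3 + f6 * (v$3)^2,
       v$3 * (p1 * v$1 + p2 * v$2 + p3 * v$3)]"
  shows False
proof -
  have Zq: "Z v = vector [qform p1 p2 0 p3 0 0 v, qform f1 0 0 f4 0 f6 v, qform 0 0 0 p1 p2 p3 v]" for v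
    by (simp add: Z qform_def power2_eq_square algebra_simps)
  have "inflection Z v = 0" for v
    unfolding inflection_qforms[OF Zq] by (simp add: det_col_matrix qform_deriv_def Z power2_eq_square algebra_simps)
  then show ?thesis using convex_field_inflection_nonzero[OF convex_field] by blast
qed

text \<open>
Subtracting \<open>R\<close> times the quotient of the third component by \<open>z\<close>, respectively of the first by \<open>x\<close>,
gives the form \<open>(E, F, 0)\<close> along either line. If both restrictions are dependent, comparing coefficients
leaves fields in which \<open>x\<close> and \<open>z\<close> evolve without \<open>y\<close>.
\<close>

lemma two_lines_normalized:
  assumes convex_field: "convex_field Z"
    and Z: "\<And>v. Z v = vector [v$1 * (p1 * v$1 + p2 * v$2 + p3 * v$3), f1 * (v$1)^2 + f4 * v$1 * v$3 + f6 * (v$3)^2,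
       v$3 * (g1 * v$1 + g2 * v$2 + g3 * v$3)]"
  shows "equiv_to_model Z"
proof -
  define Z1 where "Z1 v = (vector [qform (p1 - g1) (p2 - g2) 0 (p3 - g3) 0 0 v, qform f1 (- g1) (- g2) f4 (- g3) f6 v, 0] :: complex ^ 3)" for v
  have rel1: "field_equiv Z Z1"
    by (rule field_equivI[of "vector [1, 0, 0]" "vector [0, 1, 0]" "vector [0, 0, 1]" 1 _ _ "vector [- g1, - g2, - g3]"])
      (simp_all add: det_row_matrix lform_def Z Z1_def qform_def vec3_eq_iff power2_eq_square algebra_simps)
  define Z2 where "Z2 v = (vector [qform (g3 - p3) (g2 - p2) 0 (g1 - p1) 0 0 v, qform f6 (- p3) (- p2) f4 (- p1) f1 v, 0] :: complex ^ 3)" for v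
  have rel2: "field_equiv Z Z2"
    by (rule field_equivI[of "vector [0, 0, 1]" "vector [0, 1, 0]" "vector [1, 0, 0]" 1 _ _ "vector [- p1, - p2, - p3]"])
      (simp_all add: det_row_matrix lform_def Z Z2_def qform_def vec3_eq_iff power2_eq_square algebra_simps)
  show ?thesis
  proof (cases "indep_at_infinity Z1 \<or> indep_at_infinity Z2")
    case True
    then show ?thesis
      using equiv_to_model_if_indep[OF convex_field_equiv[OF convex_field rel1] Z1_def] equiv_to_model_if_indep[OF convex_field_equiv[OF convex_field rel2] Z2_def]
        equiv_to_model_trans[OF rel1] equiv_to_model_trans[OF rel2] by blast
  next
    case False
    then obtain s t s' t' where st: "s \<noteq> 0 \<or> t \<noteq> 0" "\<And>v. v $ 3 = 0 \<Longrightarrow> s * Z1 v $ 1 + t * Z1 v $ 2 = 0"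
      and st': "s' \<noteq> 0 \<or> t' \<noteq> 0" "\<And>v. v $ 3 = 0 \<Longrightarrow> s' * Z2 v $ 1 + t' * Z2 v $ 2 = 0"
      unfolding indep_at_infinity_def by metis
    have 1: "t * g2 = 0" "s * (p1 - g1) + t * f1 = 0"
      using st(2)[of "vector [0, 1, 0]"] st(2)[of "vector [1, 0, 0]"]
      by (simp_all add: Z1_def qform_def)
    have "s * (p2 - g2) - t * g1 = (s * (p1 - g1 + (p2 - g2)) + t * (f1 - g1 - g2)) - (s * (p1 - g1) + t * f1) + t * g2"
      by (simp add: algebra_simps)
    also have "s * (p1 - g1 + (p2 - g2)) + t * (f1 - g1 - g2) = 0"
      using st(2)[of "vector [1, 1, 0]"] by (simp add: Z1_def qform_def)
    finally have 2: "s * (p2 - g2) = t * g1" unfolding 1 by simp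
    have 3: "t' * p2 = 0" "s' * (g3 - p3) + t' * f6 = 0"
      using st'(2)[of "vector [0, 1, 0]"] st'(2)[of "vector [1, 0, 0]"]
      by (simp_all add: Z2_def qform_def)
    have "s' * (g2 - p2) - t' * p3 = (s' * (g3 - p3 + (g2 - p2)) + t' * (f6 - p3 - p2)) - (s' * (g3 - p3) + t' * f6) + t' * p2"
      by (simp add: algebra_simps)
    also have "s' * (g3 - p3 + (g2 - p2)) + t' * (f6 - p3 - p2) = 0"
      using st'(2)[of "vector [1, 1, 0]"] by (simp add: Z2_def qform_def)
    finally have 4: "s' * (g2 - p2) = t' * p3" unfolding 3 by simp
    have not_eq: "\<not> (p1 = g1 \<and> p2 = g2 \<and> p3 = g3)"
      using degenerate_not_convex[OF convex_field, of p1 p2 p3 f1 f4 f6] Z by auto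
    have "p2 = 0 \<and> g2 = 0"
      using st(1) st'(1) 1 2 3 4 not_eq by (cases "t = 0"; cases "t' = 0") auto
    moreover have "g1 = 0 \<or> p1 = g1" "p3 = 0 \<or> p3 = g3"
      using st(1) st'(1) 1 2 3 4 \<open>p2 = 0 \<and> g2 = 0\<close> by (cases "t = 0"; cases "t' = 0"; auto)+
    ultimately consider "p2 = 0" "g2 = 0" "g1 = 0" "p3 = 0"
      | "p2 = 0" "g2 = 0" "p1 = g1" "g1 \<noteq> 0" "p3 = 0" "g3 \<noteq> 0"
      | "p2 = 0" "g2 = 0" "g1 = 0" "p3 = g3" "p3 \<noteq> 0" "p1 \<noteq> 0"
      using not_eq by (cases "g1 = 0"; cases "p3 = 0") auto
    then show ?thesis
    proof cases
      case 1
      then show ?thesis using invariant_lines_squares[OF convex_field, of p1 f1 f4 f6 g3] Z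
        by (simp add: power2_eq_square algebra_simps)
    next
      case 2
      then have False using saddle_node_not_convex_radial[OF convex_field, of g1 f1 f4 f6 g3] Z
        by (simp add: power2_eq_square algebra_simps)
      then show ?thesis ..
    next
      case 3
      define Z' where "Z' v = (vector [p3 * (v$1)^2, f6 * (v$1)^2 + f4 * v$1 * v$3 + f1 * (v$3)^2, v$3 * (p3 * v$1 + p1 * v$3)] :: complex ^ 3)" for v :: "complex ^ 3"
      have field_equiv: "field_equiv Z Z'"
        by (rule field_equivI[of "vector [0, 0, 1]" "vector [0, 1, 0]" "vector [1, 0, 0]" 1 _ _ 0])
          (use 3 in \<open>simp_all add: det_row_matrix lform_def Z Z'_def qform_def vec3_eq_iff power2_eq_square algebra_simps\<close>)
      have False by (rule saddle_node_not_convex_radial[OF convex_field_equiv[OF convex_field field_equiv] Z'_def 3(5,6)])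
      then show ?thesis ..
    qed
  qed
qed

lemma third_component_zero:
  fixes Z' :: "complex ^ 3 \<Rightarrow> complex ^ 3"
  assumes "l \<in> invariant_lines Z" and Z': "\<And>v. Z' (vector [lform a v, lform b v, lform l v]) = vector [lform a (Z v), lform b (Z v), lform l (Z v)]"
    and surj: "\<And>u :: complex ^ 3. \<exists>v. u = vector [lform a v, lform b v, lform l v]" and "u $ 3 = 0"
  shows "Z' u $ 3 = 0"
proof -
  obtain v where v: "u = vector [lform a v, lform b v, lform l v]" using surj by blast
  then have "lform l v = 0" using assms(4) by simp
  then show ?thesis unfolding v Z' using invariant_linesD[OF assms(1)] by simp
qed

text \<open>
A multiple of \<open>R\<close> is available to remove the three monomials divisible by \<open>y\<close> from the second
component.
\<close>

lemma two_lines: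
  assumes convex_field: "convex_field Z" and l: "l \<in> invariant_lines Z" and m: "m \<in> invariant_lines Z" and indep: "\<nexists>k. m = k *s l"
  shows "equiv_to_model Z"
proof -
  have "\<exists>b. det (row_matrix m b l) \<noteq> 0"
  proof (rule ccontr)
    assume "\<not> ?thesis"
    then have 0: "det (row_matrix m b l) = 0" for b by blast
    have eqs: "m $ 2 * l $ 3 = l $ 2 * m $ 3" "m $ 1 * l $ 3 = l $ 1 * m $ 3" "m $ 1 * l $ 2 = l $ 1 * m $ 2"
      using 0[of "vector [1, 0, 0]"] 0[of "vector [0, 1, 0]"] 0[of "vector [0, 0, 1]"] by (simp_all add: det_row_matrix)
    have "l \<noteq> 0" using l by (simp add: invariant_lines_def)
    then consider "l $ 1 \<noteq> 0" | "l $ 2 \<noteq> 0" | "l $ 3 \<noteq> 0" by (auto simp: vec3_eq_iff)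
    then show False
    proof cases
      case 1
      have "m = (m $ 1 / l $ 1) *s l" using 1 eqs by (simp add: vec3_eq_iff field_simps)
      then show False using indep by blast
    next
      case 2
      have "m = (m $ 2 / l $ 2) *s l" using 2 eqs by (simp add: vec3_eq_iff field_simps)
      then show False using indep by blast
    next
      case 3
      have "m = (m $ 3 / l $ 3) *s l" using 3 eqs by (simp add: vec3_eq_iff field_simps)
      then show False using indep by blast
    qed
  qed
  then obtain b where det: "det (row_matrix m b l) \<noteq> 0" by blast
  obtain Z' where field_equiv: "field_equiv Z Z'"
    and Z': "\<And>v. Z' (vector [lform m v, lform b v, lform l v]) = vector [lform m (Z v), lform b (Z v), lform l (Z v)]"
    and surj: "\<And>u :: complex ^ 3. \<exists>v. u = vector [lform m v, lform b v, lform l v]"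
    by (rule field_equiv_coords[OF det, where Z = Z]) blast
  have cvx': "convex_field Z'" by (rule convex_field_equiv[OF convex_field field_equiv])
  have third: "Z' u $ 3 = 0" if "u $ 3 = 0" for u
    by (rule third_component_zero[OF l Z' surj that])
  have first: "Z' u $ 1 = 0" if "u $ 1 = 0" for u
  proof -
    obtain v where v: "u = vector [lform m v, lform b v, lform l v]" using surj by blast
    then have "lform m v = 0" using that by simp
    then show ?thesis unfolding v Z' using invariant_linesD[OF m] by simp
  qed
  have "is_qform (\<lambda>v. Z' v $ 1)" "is_qform (\<lambda>v. Z' v $ 2)" "is_qform (\<lambda>v. Z' v $ 3)" using cvx' by (auto simp: convex_field_def)
  then obtain a1 b1 c1 d1 e1 f1 a2 b2 c2 d2 e2 f2 a3 b3 c3 d3 e3 f3 where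
    E: "\<And>u. Z' u $ 1 = qform a1 b1 c1 d1 e1 f1 u" and F: "\<And>u. Z' u $ 2 = qform a2 b2 c2 d2 e2 f2 u"
    and G: "\<And>u. Z' u $ 3 = qform a3 b3 c3 d3 e3 f3 u"
    unfolding is_qform_def by metis
  have z1: "c1 = 0" "f1 = 0" "e1 = 0"
    using first[of "vector [0, 1, 0]"] first[of "vector [0, 0, 1]"] first[of "vector [0, 1, 1]"]
    by (auto simp: E qform_def)
  have z3: "a3 = 0" "c3 = 0" "b3 = 0"
    using third[of "vector [1, 0, 0]"] third[of "vector [0, 1, 0]"] third[of "vector [1, 1, 0]"]
    by (auto simp: G qform_def)
  have ZZ: "Z' u = vector [qform a1 b1 0 d1 0 0 u, qform a2 b2 c2 d2 e2 f2 u, qform 0 0 0 d3 e3 f3 u]" for u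
    by (simp add: vec3_eq_iff E F G z1 z3)
  define Z'' where "Z'' v = (vector [v$1 * ((a1 - b2) * v$1 + (b1 - c2) * v$2 + (d1 - e2) * v$3), a2 * (v$1)^2 + d2 * v$1 * v$3 + f2 * (v$3)^2,
       v$3 * ((d3 - b2) * v$1 + (e3 - c2) * v$2 + (f3 - e2) * v$3)] :: complex ^ 3)" for v :: "complex ^ 3"
  have rel': "field_equiv Z' Z''"
    by (rule field_equivI[of "vector [1, 0, 0]" "vector [0, 1, 0]" "vector [0, 0, 1]" 1 _ _ "vector [- b2, - c2, - e2]"])
      (simp_all add: det_row_matrix lform_def ZZ Z''_def qform_def vec3_eq_iff power2_eq_square algebra_simps)
  have "equiv_to_model Z''" by (rule two_lines_normalized[OF convex_field_equiv[OF cvx' rel'] Z''_def])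
  then show ?thesis using equiv_to_model_trans field_equiv rel' by blast
qed

section \<open>A single invariant line\<close>

lemma inflection_coords:
  assumes "convex_field Z" and "\<And>v. Z' (vector [lform a v, lform b v, lform c v]) = vector [lform a (Z v), lform b (Z v), lform c (Z v)]"
  shows "inflection Z' (vector [lform a v, lform b v, lform c v]) = det (row_matrix a b c) * inflection Z v"
  using inflection_field_equiv[of Z Z' "row_matrix a b c" 1 0 v] assms by (simp add: row_matrix_mv convex_field_def lform_def)

text \<open>
With \<open>z = 1\<close> the inflection polynomial is a nonzero constant; since the second component vanishes on
\<open>x = 0\<close>, this makes \<open>E\<close> constant on that line, and then everywhere.
\<close>

lemma single_line_normal_form:
  assumes convex_field: "convex_field Z"
    and Z: "\<And>v. Z v = vector [qform a b c d e f v, qform 0 0 0 1 0 0 v, 0]"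
    and const: "\<And>v. v $ 3 = 1 \<Longrightarrow> inflection Z v = C" and C: "C \<noteq> 0"
  shows False
proof -
  have 1: "inflection Z (vector [x, y, 1]) = C" for x y by (rule const) simp
  have "poly ([:f, e, c:] * [:f, e, c:] - [:C:]) y = 0" for y
    using 1[of 0 y] by (simp add: inflection_planar[OF Z] qform_def power2_eq_square algebra_simps)
  then have "[:f, e, c:] * [:f, e, c:] - [:C:] = 0" using poly_all_0_iff_0 by blast
  then have ff: "f * f = C" and "e * f = 0" and "2 * c * f + e * e = 0"
    by (auto simp: algebra_simps)
  then have z: "f \<noteq> 0" "e = 0" "c = 0" using C by auto
  have 2: "(a * x^2 + b * x * y + d * x + f) * (f - a * x^2) - b * x^3 = f * f" for x y
    using 1[of x y] unfolding ff[symmetric]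
    by (simp add: inflection_planar[OF Z] qform_def z power2_eq_square power3_eq_cube algebra_simps)
  have b1: "b * x * (f - a * x^2) = 0" for x
    using 2[of x 1] 2[of x 0] by (simp add: algebra_simps)
  have "b = 0"
  proof (rule ccontr)
    assume "b \<noteq> 0"
    then have "f = a" "f = 4 * a" using b1[of 1] b1[of 2] by auto
    then show False using z by simp
  qed
  then have "poly ([:f, d, a:] * [:f, 0, - a:] - [:f * f:]) x = 0" for x
    using 2[of x 0] by (simp add: power2_eq_square algebra_simps)
  then have "[:f, d, a:] * [:f, 0, - a:] - [:f * f:] = 0" using poly_all_0_iff_0 by blast
  then have "d = 0" "a = 0" using z by auto
  with \<open>b = 0\<close> z show False
    by (intro convex_field_coprime[OF convex_field, of "vector [0, 0, 1]" "vector [0, 0, f]" "vector [1, 0, 0]" 0 0])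
      (simp_all add: vec3_nz Z qform_def lform_def vec3_eq_iff power2_eq_square algebra_simps)
qed

text \<open>
The second component is \<open>z\<close> times a linear form. If that form involves \<open>x\<close> it becomes the new \<open>x\<close>;
if it involves \<open>y\<close> but not \<open>x\<close>, then \<open>I\<close> vanishes where it does; if it is a multiple of \<open>z\<close>, a comparison of
coefficients makes \<open>z\<close> a common factor.
\<close>

lemma single_line_dependent:
  assumes convex_field: "convex_field Z"
    and Z: "\<And>v. Z v = vector [qform a b c d e f v, qform 0 0 0 f1 f2 f3 v, 0]"
    and const: "\<And>v. v $ 3 = 1 \<Longrightarrow> inflection Z v = C" and C: "C \<noteq> 0"
  shows False
proof -
  have 1: "inflection Z (vector [x, y, 1]) = C" for x y by (rule const) simp
  consider "f1 \<noteq> 0" | "f1 = 0" "f2 \<noteq> 0" | "f1 = 0" "f2 = 0" "f3 = 0" | "f1 = 0" "f2 = 0" "f3 \<noteq> 0" by blast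
  then show False
  proof cases
    case 1
    let ?a = "vector [f1, f2, f3] :: complex ^ 3" and ?b = "vector [0, 1, 0] :: complex ^ 3" and ?c = "vector [0, 0, 1] :: complex ^ 3"
    have det: "det (row_matrix ?a ?b ?c) \<noteq> 0" using 1 by (simp add: det_row_matrix)
    obtain Z' where field_equiv: "field_equiv Z Z'"
      and Z': "\<And>v. Z' (vector [lform ?a v, lform ?b v, lform ?c v]) = vector [lform ?a (Z v), lform ?b (Z v), lform ?c (Z v)]"
      and surj: "\<And>u :: complex ^ 3. \<exists>v. u = vector [lform ?a v, lform ?b v, lform ?c v]"
      by (rule field_equiv_coords[OF det, where Z = Z]) blast
    have cvx': "convex_field Z'" by (rule convex_field_equiv[OF convex_field field_equiv])
    then have "is_qform (\<lambda>v. Z' v $ 1)" by (auto simp: convex_field_def)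
    then obtain a' b' c' d' e' f' where E: "\<And>u. Z' u $ 1 = qform a' b' c' d' e' f' u" unfolding is_qform_def by blast
    have F: "Z' u $ 2 = u $ 1 * u $ 3 \<and> Z' u $ 3 = 0" for u
    proof -
      obtain v where v: "u = vector [lform ?a v, lform ?b v, lform ?c v]" using surj by blast
      have "Z' u $ 2 = lform ?b (Z v)" "Z' u $ 3 = lform ?c (Z v)" unfolding v Z' by simp_all
      moreover have "u $ 1 = lform ?a v" "u $ 3 = lform ?c v" unfolding v by simp_all
      ultimately show ?thesis by (simp add: lform_def Z qform_def power2_eq_square algebra_simps)
    qed
    have ZZ: "Z' u = vector [qform a' b' c' d' e' f' u, qform 0 0 0 1 0 0 u, 0]" for u
      using E F by (simp add: vec3_eq_iff qform_def)
    have const': "inflection Z' u = det (row_matrix ?a ?b ?c) * C" if u: "u $ 3 = 1" for u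
    proof -
      obtain v where v: "u = vector [lform ?a v, lform ?b v, lform ?c v]" using surj by blast
      then have "v $ 3 = 1" using u by (simp add: lform_def)
      then show ?thesis unfolding v inflection_coords[OF convex_field Z'] by (simp add: const)
    qed
    show False by (rule single_line_normal_form[OF cvx' ZZ const']) (use det C in auto)
  next
    case 2
    then show False using 1[of 0 "- f3 / f2"] C by (simp add: inflection_planar[OF Z] qform_def)
  next
    case 3
    then show False using 1[of 0 0] C by (simp add: inflection_planar[OF Z] qform_def)
  next
    case 4
    define K where "K = - C / f3"
    have K: "K \<noteq> 0" using C 4 by (simp add: K_def)
    have 2: "(2 * a * x + b * y + d) * (a * x^2 + b * x * y + c * y^2 + d * x + e * y + f) + f3 * (b * x + 2 * c * y + e) = K" for x y
    proof -
      have "- f3 * ((2 * a * x + b * y + d) * (a * x^2 + b * x * y + c * y^2 + d * x + e * y + f) + f3 * (b * x + 2 * c * y + e)) = C"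
        using 1[of x y] 4 by (simp add: inflection_planar[OF Z] qform_def algebra_simps)
      from this[symmetric] show ?thesis unfolding K_def using 4 by simp
    qed
    have "poly ([:d, 2 * a:] * [:f, d, a:] + [:f3 * e - K, f3 * b:]) x = 0" for x
      using 2[of x 0] by (simp add: power2_eq_square algebra_simps)
    then have "[:d, 2 * a:] * [:f, d, a:] + [:f3 * e - K, f3 * b:] = 0" using poly_all_0_iff_0 by blast
    then have a: "a = 0" by auto
    have "poly ([:d, b:] * [:d, b:] + [:f3 * b:]) y = 0" for y
    proof -
      have "poly ([:d, b:] * [:d, b:] + [:f3 * b:]) y =
        ((2 * a * 1 + b * y + d) * (a * 1^2 + b * 1 * y + c * y^2 + d * 1 + e * y + f) + f3 * (b * 1 + 2 * c * y + e))
        - ((2 * a * 0 + b * y + d) * (a * 0^2 + b * 0 * y + c * y^2 + d * 0 + e * y + f) + f3 * (b * 0 + 2 * c * y + e))"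
        unfolding a by (simp add: power2_eq_square algebra_simps)
      then show ?thesis unfolding 2 by simp
    qed
    then have "[:d, b:] * [:d, b:] + [:f3 * b:] = 0" using poly_all_0_iff_0 by blast
    then have b: "b = 0" "d = 0" by auto
    have c: "c = 0" using 2[of 0 0] 2[of 0 1] 4 unfolding a b by (simp add: algebra_simps)
    show False
      by (rule convex_field_coprime[OF convex_field, of "vector [0, 0, 1]" "vector [0, e, f]" "vector [0, 0, f3]" 0 0])
        (simp_all add: vec3_nz Z qform_def a b c 4 lform_def vec3_eq_iff power2_eq_square algebra_simps)
  qed
qed

lemma single_line:
  assumes convex_field: "convex_field Z"
    and Z: "\<And>v. Z v = vector [qform a1 b1 c1 d1 e1 f1 v, qform a2 b2 c2 d2 e2 f2 v, 0]"
    and const: "\<And>v. v $ 3 = 1 \<Longrightarrow> inflection Z v = C" and C: "C \<noteq> 0"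
  shows "equiv_to_model Z"
proof (cases "indep_at_infinity Z")
  case True
  then show ?thesis by (rule equiv_to_model_if_indep[OF convex_field Z])
next
  case False
  then obtain s t where st: "s \<noteq> 0 \<or> t \<noteq> 0" "\<And>v. v $ 3 = 0 \<Longrightarrow> s * Z v $ 1 + t * Z v $ 2 = 0"
    unfolding indep_at_infinity_def by metis
  obtain a :: "complex ^ 3" where a: "det (row_matrix a (vector [s, t, 0]) (vector [0, 0, 1])) \<noteq> 0"
  proof (cases "t = 0")
    case True then show ?thesis using st(1) that[of "vector [0, 1, 0]"] by (simp add: det_row_matrix)
  next
    case False then show ?thesis using that[of "vector [1, 0, 0]"] by (simp add: det_row_matrix)
  qed
  let ?b = "vector [s, t, 0] :: complex ^ 3" and ?c = "vector [0, 0, 1] :: complex ^ 3"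
  obtain Z' where field_equiv: "field_equiv Z Z'"
    and Z': "\<And>v. Z' (vector [lform a v, lform ?b v, lform ?c v]) = vector [lform a (Z v), lform ?b (Z v), lform ?c (Z v)]"
    and surj: "\<And>u :: complex ^ 3. \<exists>v. u = vector [lform a v, lform ?b v, lform ?c v]"
    by (rule field_equiv_coords[OF a, where Z = Z]) blast
  have cvx': "convex_field Z'" by (rule convex_field_equiv[OF convex_field field_equiv])
  then have "is_qform (\<lambda>v. Z' v $ 1)" "is_qform (\<lambda>v. Z' v $ 2)" by (auto simp: convex_field_def)
  then obtain a1 b1 c1 d1 e1 f1 a2 b2 c2 d2 e2 f2 where
    E: "\<And>u. Z' u $ 1 = qform a1 b1 c1 d1 e1 f1 u" and F: "\<And>u. Z' u $ 2 = qform a2 b2 c2 d2 e2 f2 u"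
    unfolding is_qform_def by metis
  have F0: "Z' u $ 3 = 0" "u $ 3 = 0 \<Longrightarrow> Z' u $ 2 = 0" "u $ 3 = 1 \<Longrightarrow> inflection Z' u = det (row_matrix a ?b ?c) * C" for u
  proof -
    obtain v where v: "u = vector [lform a v, lform ?b v, lform ?c v]" using surj by blast
    have "Z' u $ 2 = lform ?b (Z v)" "Z' u $ 3 = lform ?c (Z v)" unfolding v Z' by simp_all
    moreover have "u $ 3 = lform ?c v" unfolding v by simp
    ultimately show "Z' u $ 3 = 0" "u $ 3 = 0 \<Longrightarrow> Z' u $ 2 = 0" 
      using st(2)[of v] by (simp_all add: lform_def Z)
    assume "u $ 3 = 1"
    then have "v $ 3 = 1" unfolding v by (simp add: lform_def)
    then show "inflection Z' u = det (row_matrix a ?b ?c) * C" unfolding v inflection_coords[OF convex_field Z'] by (simp add: const)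
  qed
  have z: "a2 = 0" "c2 = 0" "b2 = 0"
    using F0(2)[of "vector [1, 0, 0]"] F0(2)[of "vector [0, 1, 0]"] F0(2)[of "vector [1, 1, 0]"]
    by (auto simp: F qform_def)
  have ZZ: "Z' u = vector [qform a1 b1 c1 d1 e1 f1 u, qform 0 0 0 d2 e2 f2 u, 0]" for u
    by (simp add: vec3_eq_iff E F F0(1) z)
  have False by (rule single_line_dependent[OF cvx' ZZ F0(3)]) (use a C in auto)
  then show ?thesis ..
qed

lemma extend_to_basis:
  assumes "l \<noteq> (0 :: complex ^ 3)"
  obtains a b where "det (row_matrix a b l) \<noteq> 0"
proof -
  consider "l $ 1 \<noteq> 0" | "l $ 2 \<noteq> 0" | "l $ 3 \<noteq> 0" using assms by (auto simp: vec3_eq_iff)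
  then show ?thesis
  proof cases
    case 1 then show ?thesis using that[of "vector [0, 1, 0]" "vector [0, 0, 1]"] by (simp add: det_row_matrix)
  next
    case 2 then show ?thesis using that[of "vector [1, 0, 0]" "vector [0, 0, 1]"] by (simp add: det_row_matrix)
  next
    case 3 then show ?thesis using that[of "vector [1, 0, 0]" "vector [0, 1, 0]"] by (simp add: det_row_matrix)
  qed
qed

section \<open>Classification of convex quadratic fields\<close>

text \<open>
An invariant line exists because \<open>I\<close> vanishes at the origin. If all invariant lines are multiples of
one form \<open>l\<close>, then \<open>I\<close> is constant on \<open>l = 1\<close>.
\<close>

theorem convex_field_equiv_to_model:
  assumes convex_field: "convex_field Z" shows "equiv_to_model Z"
proof -
  have "inflection Z 0 = 0" by (simp add: inflection_def det_col_matrix)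
  from splits_root[OF convex_field_splits[OF convex_field] this] obtain l where l: "l \<in> invariant_lines Z" by blast
  show ?thesis
  proof (cases "\<forall>m\<in>invariant_lines Z. \<exists>k. m = k *s l")
    case False
    then show ?thesis using two_lines[OF convex_field l] by blast
  next
    case True
    obtain c vs where s: "c \<noteq> 0" "set vs \<subseteq> invariant_lines Z" "\<And>v. inflection Z v = c * prod_list (map (\<lambda>l. lform l v) vs)"
      using convex_field_splits[OF convex_field] unfolding splits_over_def by blast
    have "\<exists>C. C \<noteq> 0 \<and> (\<forall>v. lform l v = 1 \<longrightarrow> prod_list (map (\<lambda>l. lform l v) vs) = C)"
      using s(2)
    proof (induction vs)
      case Nil
      show ?case by (intro exI[of _ 1]) simp
    next
      case (Cons m vs)
      then obtain C where C: "C \<noteq> 0" "\<And>v. lform l v = 1 \<Longrightarrow> prod_list (map (\<lambda>l. lform l v) vs) = C" by auto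
      obtain k where k: "m = k *s l" using True Cons.prems by auto
      have "k \<noteq> 0" using Cons.prems k by (auto simp: invariant_lines_def)
      then show ?case using C k by (intro exI[of _ "k * C"]) (simp add: lform_smult_left)
    qed
    then obtain C where C: "C \<noteq> 0" "\<And>v. lform l v = 1 \<Longrightarrow> inflection Z v = C"
      using s by (metis mult_eq_0_iff)
    have "l \<noteq> 0" using l by (simp add: invariant_lines_def)
    then obtain a b where det: "det (row_matrix a b l) \<noteq> 0" by (rule extend_to_basis)
    obtain Z' where field_equiv: "field_equiv Z Z'"
      and Z': "\<And>v. Z' (vector [lform a v, lform b v, lform l v]) = vector [lform a (Z v), lform b (Z v), lform l (Z v)]"
      and surj: "\<And>u :: complex ^ 3. \<exists>v. u = vector [lform a v, lform b v, lform l v]"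
      by (rule field_equiv_coords[OF det, where Z = Z]) blast
    have cvx': "convex_field Z'" by (rule convex_field_equiv[OF convex_field field_equiv])
    have third: "Z' u $ 3 = 0" if "u $ 3 = 0" for u
      by (rule third_component_zero[OF l Z' surj that])
    have const': "inflection Z' u = det (row_matrix a b l) * C" if u: "u $ 3 = 1" for u
    proof -
      obtain v where v: "u = vector [lform a v, lform b v, lform l v]" using surj by blast
      then have "lform l v = 1" using u by simp
      then show ?thesis unfolding v inflection_coords[OF convex_field Z'] by (simp add: C)
    qed
    have "is_qform (\<lambda>v. Z' v $ 1)" "is_qform (\<lambda>v. Z' v $ 2)" "is_qform (\<lambda>v. Z' v $ 3)" using cvx' by (auto simp: convex_field_def)
    then obtain a1 b1 c1 d1 e1 f1 a2 b2 c2 d2 e2 f2 a3 b3 c3 d3 e3 f3 where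
      E: "\<And>u. Z' u $ 1 = qform a1 b1 c1 d1 e1 f1 u" and F: "\<And>u. Z' u $ 2 = qform a2 b2 c2 d2 e2 f2 u"
      and G: "\<And>u. Z' u $ 3 = qform a3 b3 c3 d3 e3 f3 u"
      unfolding is_qform_def by metis
    have z3: "a3 = 0" "c3 = 0" "b3 = 0"
      using third[of "vector [1, 0, 0]"] third[of "vector [0, 1, 0]"] third[of "vector [1, 1, 0]"]
      by (auto simp: G qform_def)
    have ZZ: "Z' u = vector [qform a1 b1 c1 d1 e1 f1 u, qform a2 b2 c2 d2 e2 f2 u, qform 0 0 0 d3 e3 f3 u]" for u
      by (simp add: vec3_eq_iff E F G z3)
    define Z'' where "Z'' v = (vector [qform (a1 - d3) (b1 - e3) c1 (d1 - f3) e1 f1 v,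
       qform a2 (b2 - d3) (c2 - e3) d2 (e2 - f3) f2 v, 0] :: complex ^ 3)" for v
    let ?L = "vector [- d3, - e3, - f3] :: complex ^ 3"
    have eq: "Z'' v = Z' v + lform ?L v *s v" for v
      by (simp add: ZZ Z''_def lform_def qform_def vec3_eq_iff power2_eq_square algebra_simps)
    have rel': "field_equiv Z' Z''"
      unfolding field_equiv_def
      by (rule exI[of _ "mat 1"], rule exI[of _ 1], rule exI[of _ ?L])
        (simp add: eq matrix_vector_mul_lid invertible_det_nz)
    have const'': "inflection Z'' u = det (row_matrix a b l) * C" if u: "u $ 3 = 1" for u
      using inflection_field_equiv[of Z' Z'' "mat 1" 1 ?L u] eq const'[OF u] cvx' by (simp add: convex_field_def)
    have "equiv_to_model Z''"
      by (rule single_line[OF convex_field_equiv[OF cvx' rel'] Z''_def const'']) (use det C in auto)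
    then show ?thesis using equiv_to_model_trans field_equiv rel' by blast
  qed
qed

section \<open>Polynomials and their values\<close>

definition eval3 :: "poly3 \<Rightarrow> complex ^ 3 \<Rightarrow> complex" where
  "eval3 p v = poly (poly (poly p [:[:v $ 3:]:]) [:v $ 2:]) (v $ 1)"

lemma eval3_simps [simp]:
  "eval3 (p + q) v = eval3 p v + eval3 q v" "eval3 (p - q) v = eval3 p v - eval3 q v" "eval3 (- p) v = - eval3 p v"
  "eval3 (p * q) v = eval3 p v * eval3 q v" "eval3 0 v = 0" "eval3 1 v = 1" "eval3 (const3 c) v = c"
  by (simp_all add: eval3_def const3_def)

lemma eval3_power [simp]: "eval3 (p ^ n) v = eval3 p v ^ n"
  by (induction n) auto

lemma eval3_sum [simp]: "eval3 (\<Sum>i\<in>A. f i) v = (\<Sum>i\<in>A. eval3 (f i) v)"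
  by (induction A rule: infinite_finite_induct) auto

lemma eval3_prod_list [simp]: "eval3 (prod_list ps) v = prod_list (map (\<lambda>p. eval3 p v) ps)"
  by (induction ps) auto

lemma eval3_coord [simp]: "eval3 (coord $ i) v = v $ i"
  using exhaust_3[of i] by (auto simp: eval3_def coord_def)

lemma eval3_linear_form [simp]: "eval3 (linear_form l) v = lform l v"
  by (simp add: linear_form_def lform_def sum_3)

lemma poly_zero_if_zero_on_constants:
  fixes p :: "'a :: {idom, ring_char_0} poly poly"
  assumes "\<And>z. poly p [:z:] = 0" shows "p = 0"
proof (rule ccontr)
  assume "p \<noteq> 0"
  then have "finite {x. poly p x = 0}" by (rule poly_roots_finite)
  moreover have "range (\<lambda>z. [:z:]) \<subseteq> {x. poly p x = 0}" using assms by auto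
  ultimately have "finite (range (\<lambda>z::'a. [:z:]))" by (rule finite_subset[rotated])
  then have "finite (UNIV :: 'a set)" by (rule finite_imageD) (auto intro: injI)
  then show False by (simp add: infinite_UNIV_char_0)
qed

text \<open>
One variable at a time: a nonzero polynomial over a domain has finitely many roots, hence does not
vanish at all constants.
\<close>

lemma eval3_zero_imp:
  assumes "\<And>v. eval3 p v = 0" shows "p = 0"
proof (rule ccontr)
  assume "p \<noteq> 0"
  then have "finite {x. poly p x = 0}" by (rule poly_roots_finite)
  moreover have "range (\<lambda>z::complex. [:[:z:]:]) \<subseteq> {x. poly p x = 0}"
  proof clarify
    fix z
    have "poly (poly (poly p [:[:z:]:]) [:y:]) x = 0" for x y
      using assms[of "vector [x, y, z]"] by (simp add: eval3_def)
    then have "poly (poly p [:[:z:]:]) [:y:] = 0" for y using poly_all_0_iff_0 by blast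
    then show "poly p [:[:z:]:] = 0" by (rule poly_zero_if_zero_on_constants)
  qed
  ultimately have "finite (range (\<lambda>z::complex. [:[:z:]:]))" by (rule finite_subset[rotated])
  then have "finite (UNIV :: complex set)" by (rule finite_imageD) (auto intro: injI)
  then show False by (simp add: infinite_UNIV_char_0)
qed

lemma eval3_inject: "(\<And>v. eval3 p v = eval3 q v) \<Longrightarrow> p = q"
  using eval3_zero_imp[of "p - q"] by simp

lemma eval3_poly_map_poly:
  assumes "f 0 = 0"
  shows "eval3 (poly (map_poly f q) a) v = poly (map_poly (\<lambda>r. eval3 (f r) v) q) (eval3 a v)"
  by (induction q) (simp_all add: map_poly_pCons assms)

lemma poly_map_poly_poly: "poly (map_poly (\<lambda>r. poly r x) q) y = poly (poly q [:y:]) x"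
  by (induction q) (simp_all add: map_poly_pCons)

lemma poly_map_poly_poly_poly:
  "poly (map_poly (\<lambda>q. poly (poly q [:y:]) x) p) z = poly (poly (poly p [:[:z:]:]) [:y:]) x"
  by (induction p) (simp_all add: map_poly_pCons)

text \<open>
Both sides evaluate the nested polynomial one variable at a time, from the inside out.
\<close>

lemma eval3_subst3: "eval3 (subst3 w p) v = eval3 p (\<chi> i. eval3 (w $ i) v)"
proof -
  have c0: "const3 0 = 0" by (simp add: const3_def)
  have id: "map_poly (\<lambda>c. c) r = r" for r :: "complex poly" by (rule map_poly_idI) simp
  have 1: "eval3 (poly (map_poly const3 r) (w $ 1)) v = poly r (eval3 (w $ 1) v)" for r
    using eval3_poly_map_poly[where f = const3, OF c0, of r "w $ 1" v] by (simp add: id)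
  have 2: "eval3 (poly (map_poly (\<lambda>r. poly (map_poly const3 r) (w $ 1)) q) (w $ 2)) v
    = poly (poly q [:eval3 (w $ 2) v:]) (eval3 (w $ 1) v)" for q
    by (subst eval3_poly_map_poly) (simp_all add: 1 poly_map_poly_poly)
  show ?thesis unfolding subst3_def
    by (subst eval3_poly_map_poly) (simp_all add: 2 poly_map_poly_poly_poly eval3_def[of p])
qed

lemma eval3_pullback: "eval3 (pullback M \<omega> $ j) v = (\<Sum>i\<in>UNIV. M $ i $ j * eval3 (\<omega> $ i) (M *v v))"
proof -
  have "(\<chi> i. eval3 ((\<chi> k. \<Sum>l\<in>UNIV. const3 (M $ k $ l) * coord $ l) $ i) v) = M *v v"
    by (simp add: vec_eq_iff matrix_vector_mult_def)
  then show ?thesis by (simp add: pullback_def eval3_subst3)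
qed

section \<open>Quadratic polynomial fields\<close>

definition quadratic :: "complex \<Rightarrow> complex \<Rightarrow> complex \<Rightarrow> complex \<Rightarrow> complex \<Rightarrow> complex \<Rightarrow> poly3" where
  "quadratic a b c d e f = [: [: [:0, 0, a:], [:0, b:], [:c:] :], [: [:0, d:], [:e:] :], [: [:f:] :] :]"

lemma coeff_quadratic: "coeff (coeff (coeff (quadratic a b c d e f) k) j) i =
  (if k = 0 then (if j = 0 then (if i = 2 then a else 0) else if j = 1 then (if i = 1 then b else 0) else
     if j = 2 then (if i = 0 then c else 0) else 0)
   else if k = 1 then (if j = 0 then (if i = 1 then d else 0) else if j = 1 then (if i = 0 then e else 0) else 0)
   else if k = 2 then (if j = 0 \<and> i = 0 then f else 0) else 0)"
proof -
  have 3: "n = 0 \<or> n = 1 \<or> n = 2 \<or> (\<exists>m. n = Suc (Suc (Suc m)))" for n :: nat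
    by (metis One_nat_def not0_implies_Suc numeral_2_eq_2)
  show ?thesis
    using 3[of k] 3[of j] 3[of i]
    by (elim disjE exE) (simp_all add: quadratic_def numeral_2_eq_2)
qed

lemma homogeneous_2_quadratic:
  assumes "homogeneous 2 p" obtains a b c d e f where "p = quadratic a b c d e f"
proof -
  define P where "P = quadratic (coeff (coeff (coeff p 0) 0) 2) (coeff (coeff (coeff p 0) 1) 1) (coeff (coeff (coeff p 0) 2) 0)
     (coeff (coeff (coeff p 1) 0) 1) (coeff (coeff (coeff p 1) 1) 0) (coeff (coeff (coeff p 2) 0) 0)"
  have "coeff (coeff (coeff p k) j) i = coeff (coeff (coeff P k) j) i" for i j k
  proof (cases "i + j + k = 2")
    case True
    then have "i = 2 - j - k" "j \<le> 2 - k" "k \<le> 2" by simp_all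
    then have "k = 0 \<or> k = 1 \<or> k = 2" "j = 0 \<or> j = 1 \<or> j = 2" by auto
    then show ?thesis using True unfolding P_def coeff_quadratic
      by (elim disjE) simp_all
  next
    case False
    then have "coeff (coeff (coeff p k) j) i = 0" using assms unfolding homogeneous_def by blast
    moreover have "coeff (coeff (coeff P k) j) i = 0"
      using False unfolding P_def coeff_quadratic by simp
    ultimately show ?thesis by simp
  qed
  then have "p = P" by (intro poly_eqI)
  then show ?thesis using that unfolding P_def by blast
qed

lemma eval3_quadratic: "eval3 (quadratic a b c d e f) v = qform a b c d e f v"
  by (simp add: eval3_def quadratic_def qform_def power2_eq_square algebra_simps)

lemma eval3_pd_quadratic:
  "eval3 (pd 1 (quadratic a b c d e f)) v = 2 * a * v $ 1 + b * v $ 2 + d * v $ 3"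
  "eval3 (pd 2 (quadratic a b c d e f)) v = b * v $ 1 + 2 * c * v $ 2 + e * v $ 3"
  "eval3 (pd 3 (quadratic a b c d e f)) v = d * v $ 1 + e * v $ 2 + 2 * f * v $ 3"
  by (simp_all add: eval3_def quadratic_def pd_def map_poly_pCons pderiv_pCons algebra_simps)

definition field_fun :: "poly3 ^ 3 \<Rightarrow> complex ^ 3 \<Rightarrow> complex ^ 3" where
  "field_fun Z v = (\<chi> i. eval3 (Z $ i) v)"

lemma field_fun_nth [simp]: "field_fun Z v $ i = eval3 (Z $ i) v"
  by (simp add: field_fun_def)

lemma eval3_vf_apply_quadratic:
  "eval3 (vf_apply Z (quadratic a b c d e f)) v = qform_deriv a b c d e f v (field_fun Z v)"
  by (simp add: vf_apply_def sum_3 eval3_pd_quadratic qform_deriv_def algebra_simps)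

lemma eval3_inflection_poly:
  assumes "\<And>i. homogeneous 2 (Z $ i)"
  shows "eval3 (inflection_poly Z) v = inflection (field_fun Z) v"
proof -
  obtain a1 b1 c1 d1 e1 f1 where 1: "Z $ 1 = quadratic a1 b1 c1 d1 e1 f1"
    using homogeneous_2_quadratic[OF assms] by blast
  obtain a2 b2 c2 d2 e2 f2 where 2: "Z $ 2 = quadratic a2 b2 c2 d2 e2 f2"
    using homogeneous_2_quadratic[OF assms] by blast
  obtain a3 b3 c3 d3 e3 f3 where 3: "Z $ 3 = quadratic a3 b3 c3 d3 e3 f3"
    using homogeneous_2_quadratic[OF assms] by blast
  have "inflection (field_fun Z) v = det (col_matrix v (field_fun Z v) (vector [qform_deriv a1 b1 c1 d1 e1 f1 v (field_fun Z v),
     qform_deriv a2 b2 c2 d2 e2 f2 v (field_fun Z v), qform_deriv a3 b3 c3 d3 e3 f3 v (field_fun Z v)]))"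
    by (rule inflection_qforms) (simp add: vec3_eq_iff 1 2 3 eval3_quadratic)
  moreover have "eval3 (vf_apply Z (Z $ 1)) v = qform_deriv a1 b1 c1 d1 e1 f1 v (field_fun Z v)"
    "eval3 (vf_apply Z (Z $ 2)) v = qform_deriv a2 b2 c2 d2 e2 f2 v (field_fun Z v)"
    "eval3 (vf_apply Z (Z $ 3)) v = qform_deriv a3 b3 c3 d3 e3 f3 v (field_fun Z v)"
    unfolding 1 2 3 by (rule eval3_vf_apply_quadratic)+
  ultimately show ?thesis
    unfolding det_col_matrix by (simp add: inflection_poly_def det_3 algebra_simps)
qed

lemma is_qform_field_fun:
  assumes "homogeneous 2 (Z $ i)" shows "is_qform (\<lambda>v. field_fun Z v $ i)"
  using homogeneous_2_quadratic[OF assms] unfolding is_qform_def by (metis eval3_quadratic field_fun_nth)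

lemma contract_vol_nth:
  "contract_vol Z $ 1 = coord $ 3 * Z $ 2 - coord $ 2 * Z $ 3"
  "contract_vol Z $ 2 = coord $ 1 * Z $ 3 - coord $ 3 * Z $ 1"
  "contract_vol Z $ 3 = coord $ 2 * Z $ 1 - coord $ 1 * Z $ 2"
  by (simp_all add: contract_vol_def)

lemma pd_linear_form: "pd i (linear_form l) = const3 (l $ i)"
proof -
  have "linear_form l = [: [: [:0, l $ 1:], [:l $ 2:] :], [: [:l $ 3:] :] :]"
    by (simp add: linear_form_def sum_3 coord_def const3_def)
  then show ?thesis using exhaust_3[of i]
    by (auto simp: pd_def const3_def map_poly_pCons pderiv_pCons)
qed

text \<open>
For the form \<open>\<omega> = Z \<times> R\<close> the triple product identity gives \<open>l \<times> \<omega> = (l \<cdot> R) Z - (l \<cdot> Z) R\<close>. On the line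
\<open>l = 0\<close> the left-hand side vanishes, hence so does \<open>l \<cdot> Z\<close> at every point except possibly the origin.
\<close>

lemma invariant_lines_if_invariant_curve:
  assumes "l \<noteq> 0" and inv: "invariant_curve (linear_form l) (contract_vol Z)" and Z0: "field_fun Z 0 = 0"
  shows "l \<in> invariant_lines (field_fun Z)"
  unfolding invariant_lines_def mem_Collect_eq
proof (intro conjI allI impI)
  fix v assume v: "lform l v = 0"
  have *: "l $ i * eval3 (contract_vol Z $ j) v = l $ j * eval3 (contract_vol Z $ i) v" for i j
  proof -
    obtain h where "pd i (linear_form l) * contract_vol Z $ j - pd j (linear_form l) * contract_vol Z $ i = linear_form l * h"
      using inv unfolding invariant_curve_def by (meson dvdE)
    from arg_cong[OF this, of "\<lambda>p. eval3 p v"] show ?thesis by (simp add: pd_linear_form v)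
  qed
  have "v $ k * lform l (field_fun Z v) = field_fun Z v $ k * lform l v" for k
    using exhaust_3[of k] *[of 1 2] *[of 2 3] *[of 3 1]
    by (auto simp: contract_vol_nth lform_def algebra_simps)
  then have *: "v $ k * lform l (field_fun Z v) = 0" for k using v by simp
  then show "lform l (field_fun Z v) = 0"
  proof (cases "v = 0")
    case False
    then obtain k where "v $ k \<noteq> 0" by (auto simp: vec_eq_iff)
    then show ?thesis using *[of k] by simp
  qed (simp add: Z0)
qed fact

text \<open>
If \<open>Z = l G + L R\<close> then \<open>Z \<times> R = l (G \<times> R)\<close>, and \<open>l\<close> divides the form.
\<close>

lemma coprime_field_fun:
  assumes \<omega>: "foliation_form d \<omega>" and Z: "const3 k *s \<omega> = contract_vol Z" and k: "k \<noteq> 0" and l: "l \<noteq> 0"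
  shows "\<exists>v. field_fun Z v \<noteq> lform l v *s (G *v v) + lform L v *s v"
proof (rule ccontr)
  assume "\<not> ?thesis"
  then have *: "field_fun Z v = lform l v *s (G *v v) + lform L v *s v" for v by blast
  have **: "eval3 (Z $ i) v = lform l v * lform (G $ i) v + lform L v * v $ i" for i v
    using arg_cong[OF *[of v], of "\<lambda>u. u $ i"] by (simp add: mv_eq_lform)
  define Y where "Y = (\<chi> i. linear_form (G $ i))"
  have "contract_vol Z $ i = linear_form l * contract_vol Y $ i" for i
    using exhaust_3[of i]
    by (intro eval3_inject) (auto simp: contract_vol_nth ** Y_def algebra_simps)
  then have "const3 k * \<omega> $ i = linear_form l * contract_vol Y $ i" for i
    using arg_cong[OF Z, of "\<lambda>u. u $ i"] by simp
  then have "const3 (1 / k) * (const3 k * \<omega> $ i) = linear_form l * (const3 (1 / k) * contract_vol Y $ i)" for i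
    by (simp add: mult_ac)
  moreover have "const3 (1 / k) * (const3 k * p) = p" for p
    by (rule eval3_inject) (simp add: k)
  ultimately have "linear_form l dvd \<omega> $ i" for i by (metis dvdI)
  then have "linear_form l dvd 1" using \<omega> by (auto simp: foliation_form_def)
  then obtain h where "1 = linear_form l * h" by (rule dvdE)
  from arg_cong[OF this, of "\<lambda>p. eval3 p 0"] show False by simp
qed

section \<open>From foliations to quadratic fields and back\<close>

lemma mem_foliation_of: "\<omega> \<in> foliation_of \<omega>"
  unfolding foliation_of_def
  by (rule CollectI, rule exI[of _ 1]) (simp add: vec_eq_iff const3_def one_pCons[symmetric])

lemma foliation_of_scale:
  assumes "c \<noteq> 0" shows "foliation_of (const3 c *s \<omega>) = foliation_of \<omega>"
proof -
  have eq: "const3 a *s (const3 b *s \<omega>) = const3 (a * b) *s \<omega>" for a b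
    by (simp add: vec_eq_iff const3_def mult.commute)
  show ?thesis unfolding foliation_of_def
  proof (intro set_eqI iffI; clarify)
    fix a :: complex assume "a \<noteq> 0"
    then show "\<exists>b. const3 a *s (const3 c *s \<omega>) = const3 b *s \<omega> \<and> b \<noteq> 0"
      using assms by (intro exI[of _ "a * c"]) (simp add: eq del: vector_smult_assoc)
  next
    fix a :: complex assume "a \<noteq> 0"
    then show "\<exists>b. const3 a *s \<omega> = const3 b *s (const3 c *s \<omega>) \<and> b \<noteq> 0"
      using assms by (intro exI[of _ "a / c"]) (simp add: eq del: vector_smult_assoc)
  qed
qed

lemma convex_foliation_imp_convex_field:
  assumes "convex_foliation 2 F"
  obtains Z where "\<And>i. homogeneous 2 (Z $ i)" "F = foliation_of (contract_vol Z)" "convex_field (field_fun Z)"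
proof -
  obtain \<omega>0 \<omega> Z c vs where \<omega>0: "foliation_form 2 \<omega>0" "F = foliation_of \<omega>0" and \<omega>: "\<omega> \<in> F"
    and Z: "describing_field 2 \<omega> Z" and c: "c \<noteq> 0"
    and vs: "\<And>l. l \<in> set vs \<Longrightarrow> l \<noteq> 0 \<and> invariant_curve (linear_form l) \<omega>"
    and eq: "inflection_poly Z = const3 c * prod_list (map linear_form vs)"
    using assms unfolding convex_foliation_def foliation_def by blast
  have hom: "\<And>i. homogeneous 2 (Z $ i)" and \<omega>Z: "\<omega> = contract_vol Z"
    using Z by (auto simp: describing_field_def)
  obtain k where k: "k \<noteq> 0" "\<omega> = const3 k *s \<omega>0" using \<omega> \<omega>0 by (auto simp: foliation_of_def)
  have Z0: "field_fun Z 0 = 0"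
  proof -
    have "eval3 (Z $ i) 0 = 0" for i
      using homogeneous_2_quadratic[OF hom[of i]] by (metis eval3_quadratic qform_def zero_index mult_zero_right
          add.right_neutral zero_power2)
    then show ?thesis by (simp add: vec_eq_iff)
  qed
  have "convex_field (field_fun Z)"
    unfolding convex_field_def
  proof (intro conjI allI impI)
    show "is_qform (\<lambda>v. field_fun Z v $ i)" for i by (rule is_qform_field_fun[OF hom])
    show "\<exists>v. field_fun Z v \<noteq> lform l v *s (G *v v) + lform L v *s v" if "l \<noteq> 0" for l G L
      by (rule coprime_field_fun[OF \<omega>0(1) _ k(1) that]) (use k \<omega>Z in simp)
    show "splits_over (invariant_lines (field_fun Z)) (inflection (field_fun Z))"
      unfolding splits_over_def
    proof (intro exI conjI allI)
      show "set vs \<subseteq> invariant_lines (field_fun Z)" using vs invariant_lines_if_invariant_curve[OF _ _ Z0] \<omega>Z by auto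
      show "inflection (field_fun Z) v = c * prod_list (map (\<lambda>l. lform l v) vs)" for v
        using arg_cong[OF eq, of "\<lambda>p. eval3 p v"] by (simp add: eval3_inflection_poly[OF hom] o_def)
    qed fact
  qed
  moreover have "F = foliation_of (contract_vol Z)"
    using foliation_of_scale[OF k(1), of \<omega>0] \<omega>0 k(2) \<omega>Z by simp
  ultimately show ?thesis using that hom by blast
qed

text \<open>
The form is \<open>Z \<times> R\<close>, and a linear map \<open>N\<close> acts on cross products by its cofactor matrix. The transpose
of \<open>N\<close>, which enters the pullback, turns this into multiplication by \<open>det N\<close>.
\<close>

lemma conjugate_if_field_equiv:
  assumes "field_equiv (field_fun Z) (field_fun Y)"
  shows "conjugate (foliation_of (contract_vol Z)) (foliation_of (contract_vol Y))"
proof -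
  obtain N c L where N: "invertible N" "c \<noteq> 0"
    and Y: "\<And>v. field_fun Y (N *v v) = c *s (N *v field_fun Z v) + lform L v *s (N *v v)"
    using assms unfolding field_equiv_def by blast
  define k where "k = c * det N"
  have k: "k \<noteq> 0" using N by (simp add: k_def invertible_det_nz)
  have Ye: "eval3 (Y $ i) (N *v v) = c * (N *v field_fun Z v) $ i + lform L v * (N *v v) $ i" for i v
    using arg_cong[OF Y[of v], of "\<lambda>u. u $ i"] by simp
  have pb: "pullback N (const3 a *s contract_vol Y) = const3 a *s (const3 k *s contract_vol Z)" for a
  proof -
    have "pullback N (const3 a *s contract_vol Y) $ j = (const3 a *s (const3 k *s contract_vol Z)) $ j" for j
    proof (rule eval3_inject)
      fix v
      show "eval3 (pullback N (const3 a *s contract_vol Y) $ j) v = eval3 ((const3 a *s (const3 k *s contract_vol Z)) $ j) v"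
        using exhaust_3[of j]
        by (auto simp: eval3_pullback sum_3 contract_vol_nth Ye k_def det_3 mv3 algebra_simps)
    qed
    then show ?thesis by (simp add: vec_eq_iff)
  qed
  have "foliation_of (contract_vol Z) = pullback N ` foliation_of (contract_vol Y)"
    unfolding foliation_of_scale[OF k, symmetric, of "contract_vol Z"]
    unfolding foliation_of_def using pb by (auto simp: image_iff) metis
  then show ?thesis unfolding conjugate_def using N by blast
qed

section \<open>Uniqueness of the projective extension of an affine form\<close>

lemma homogeneous_diff: "homogeneous n p \<Longrightarrow> homogeneous n q \<Longrightarrow> homogeneous n (p - q)"
  unfolding homogeneous_def by (metis coeff_diff diff_zero)

lemma homogeneous_coord_mult:
  assumes "homogeneous n p" shows "homogeneous (n + 1) (coord $ i * p)"
proof -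
  have "coord $ 1 * p = smult [:[:0, 1:]:] p" "coord $ 2 * p = smult [:0, 1:] p" "coord $ 3 * p = pCons 0 p"
    by (simp_all add: coord_def)
  then show ?thesis using assms exhaust_3[of i]
    by (auto simp: homogeneous_def coeff_pCons split: nat.splits)
qed

lemma homogeneous_quadratic: "homogeneous 2 (quadratic a b c d e f)"
  unfolding homogeneous_def coeff_quadratic by simp

lemma homogeneous_contract_vol:
  assumes "\<And>i. homogeneous 2 (Z $ i)" shows "homogeneous (2 + 1) (contract_vol Z $ i)"
proof -
  have *: "homogeneous (2 + 1) (coord $ j * Z $ k)" for j k by (rule homogeneous_coord_mult[OF assms])
  show ?thesis using exhaust_3[of i]
    by (auto simp only: contract_vol_nth intro!: homogeneous_diff *)
qed

text \<open>
For given \<open>i\<close> and \<open>j\<close>, homogeneity leaves one possible power of \<open>z\<close>.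
\<close>

lemma coeff_dehomogenize:
  assumes "homogeneous m p"
  shows "coeff (coeff (poly p 1) j) i = (if i + j \<le> m then coeff (coeff (coeff p (m - i - j)) j) i else 0)"
proof -
  have "coeff (coeff (poly p 1) j) i = (\<Sum>k\<le>degree p. coeff (coeff (coeff p k) j) i)"
    by (simp add: poly_altdef coeff_sum)
  also have "\<dots> = (\<Sum>k\<in>{..degree p} \<inter> {k. i + j + k = m}. coeff (coeff (coeff p k) j) i)"
    by (rule sum.mono_neutral_right) (use assms in \<open>auto simp: homogeneous_def\<close>)
  also have "\<dots> = (if i + j \<le> m then coeff (coeff (coeff p (m - i - j)) j) i else 0)"
  proof (cases "i + j \<le> m \<and> m - i - j \<le> degree p")
    case True
    then have "{..degree p} \<inter> {k. i + j + k = m} = {m - i - j}" by auto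
    then show ?thesis using True by simp
  next
    case False
    then have e: "{..degree p} \<inter> {k. i + j + k = m} = {}" by auto
    show ?thesis using False unfolding e by (auto simp: coeff_eq_0)
  qed
  finally show ?thesis .
qed

lemma homogeneous_same_dehomogenization:
  assumes p: "homogeneous m p" and q: "homogeneous n q" and "m \<le> n" and eq: "poly p 1 = poly q 1"
  shows "q = (coord $ 3) ^ (n - m) * p"
proof -
  have mon: "(coord $ 3) ^ (n - m) = (monom 1 (n - m) :: poly3)"
    by (simp add: coord_def monom_altdef)
  have "coeff (coeff (coeff q k) j) i = coeff (coeff (coeff (monom 1 (n - m) * p) k) j) i" for i j k
  proof (cases "i + j + k = n")
    case True
    then have "coeff (coeff (coeff q k) j) i = coeff (coeff (poly q 1) j) i"
      using coeff_dehomogenize[OF q, of j i] by auto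
    also have "\<dots> = (if i + j \<le> m then coeff (coeff (coeff p (m - i - j)) j) i else 0)"
      unfolding eq[symmetric] by (rule coeff_dehomogenize[OF p])
    also have "\<dots> = coeff (coeff (coeff (monom 1 (n - m) * p) k) j) i"
    proof (cases "i + j \<le> m")
      case le: True
      then have "k - (n - m) = m - i - j" "\<not> k < n - m" using True \<open>m \<le> n\<close> by auto
      then show ?thesis using le by (simp add: coeff_monom_mult)
    next
      case False
      then have "k < n - m" using True \<open>m \<le> n\<close> by auto
      then show ?thesis using False by (simp add: coeff_monom_mult)
    qed
    finally show ?thesis .
  next
    case False
    then have "coeff (coeff (coeff q k) j) i = 0" using q unfolding homogeneous_def by blast
    moreover have "coeff (coeff (coeff (monom 1 (n - m) * p) k) j) i = 0"
    proof (cases "k < n - m")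
      case False
      then have "i + j + (k - (n - m)) \<noteq> m" using \<open>i + j + k \<noteq> n\<close> \<open>m \<le> n\<close> by auto
      then have "coeff (coeff (coeff p (k - (n - m))) j) i = 0" using p unfolding homogeneous_def by blast
      then show ?thesis using False by (simp add: coeff_monom_mult)
    qed (simp add: coeff_monom_mult)
    ultimately show ?thesis by simp
  qed
  then show ?thesis unfolding mon by (intro poly_eqI)
qed

text \<open>
Only the power of \<open>z\<close> is lost when \<open>z = 1\<close>. The third component is determined by the other two through
the contraction with \<open>R\<close>, so all three differ by the same power of \<open>z\<close>, which is trivial as the
components have no common factor.
\<close>

lemma foliation_form_unique_le:
  assumes w: "foliation_form m \<omega>" and w': "foliation_form n \<omega>'" and "m \<le> n"
    and eq: "poly (\<omega> $ 1) 1 = poly (\<omega>' $ 1) 1" "poly (\<omega> $ 2) 1 = poly (\<omega>' $ 2) 1"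
  shows "\<omega> = \<omega>'"
proof -
  let ?c = "(coord $ 3) ^ (n - m)"
  have h: "homogeneous (m + 1) (\<omega> $ i)" "homogeneous (n + 1) (\<omega>' $ i)" for i
    using w w' by (auto simp: foliation_form_def)
  have 1: "\<omega>' $ 1 = ?c * \<omega> $ 1" and 2: "\<omega>' $ 2 = ?c * \<omega> $ 2"
    using homogeneous_same_dehomogenization[OF h(1) h(2) _ eq(1)]
      homogeneous_same_dehomogenization[OF h(1) h(2) _ eq(2)] \<open>m \<le> n\<close> by simp_all
  have "coord $ 1 * \<omega> $ 1 + coord $ 2 * \<omega> $ 2 + coord $ 3 * \<omega> $ 3 = 0"
    "coord $ 1 * \<omega>' $ 1 + coord $ 2 * \<omega>' $ 2 + coord $ 3 * \<omega>' $ 3 = 0"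
    using w w' by (simp_all add: foliation_form_def sum_3)
  then have 3: "coord $ 3 * \<omega> $ 3 = - (coord $ 1 * \<omega> $ 1 + coord $ 2 * \<omega> $ 2)"
    "coord $ 3 * \<omega>' $ 3 = - (coord $ 1 * \<omega>' $ 1 + coord $ 2 * \<omega>' $ 2)"
    by (metis add.commute eq_neg_iff_add_eq_0)+
  have "coord $ 3 * \<omega>' $ 3 = ?c * - (coord $ 1 * \<omega> $ 1 + coord $ 2 * \<omega> $ 2)"
    unfolding 3 1 2 by (simp add: algebra_simps)
  also have "\<dots> = coord $ 3 * (?c * \<omega> $ 3)"
    unfolding 3[symmetric] by (simp add: algebra_simps)
  finally have "\<omega>' $ 3 = ?c * \<omega> $ 3" by (simp add: coord_def)
  with 1 2 have all: "\<omega>' $ i = ?c * \<omega> $ i" for i using exhaust_3[of i] by auto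
  then have "?c dvd \<omega>' $ i" for i by simp
  then have "?c dvd 1" using w' by (auto simp: foliation_form_def)
  then obtain h where "1 = ?c * h" by (rule dvdE)
  from arg_cong[OF this, of "\<lambda>p. eval3 p 0"] have "n - m = 0" by (cases "n - m") auto
  with all show ?thesis by (simp add: vec_eq_iff)
qed

lemma foliation_form_scale:
  assumes "foliation_form d \<omega>" "c \<noteq> 0" shows "foliation_form d (const3 c *s \<omega>)"
proof -
  have "const3 c * p = smult [:[:c:]:] p" for p by (simp add: const3_def)
  then have "homogeneous n p \<Longrightarrow> homogeneous n (const3 c * p)" for n p by (simp add: homogeneous_def)
  moreover have "h dvd \<omega> $ i" if "h dvd const3 c * \<omega> $ i" for h i
  proof -
    have "h dvd const3 (1 / c) * (const3 c * \<omega> $ i)" using that by (rule dvd_mult)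
    also have "const3 (1 / c) * (const3 c * \<omega> $ i) = \<omega> $ i" by (rule eval3_inject) (simp add: assms)
    finally show ?thesis .
  qed
  moreover have "(\<Sum>i\<in>UNIV. coord $ i * (const3 c *s \<omega>) $ i) = const3 c * (\<Sum>i\<in>UNIV. coord $ i * \<omega> $ i)"
    by (simp add: sum_3 algebra_simps)
  ultimately show ?thesis using assms unfolding foliation_form_def by simp
qed

lemma affine_foliation_eq:
  assumes w: "foliation_form d \<omega>" and A: "poly (\<omega> $ 1) 1 = A" "poly (\<omega> $ 2) 1 = B"
  shows "affine_foliation A B = foliation_of \<omega>"
  unfolding affine_foliation_def
proof (rule the_equality)
  show "(\<exists>d. foliation d (foliation_of \<omega>)) \<and>
      (\<exists>\<omega>'\<in>foliation_of \<omega>. poly (\<omega>' $ 1) 1 = A \<and> poly (\<omega>' $ 2) 1 = B)"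
    using w A mem_foliation_of unfolding foliation_def by blast
next
  fix F assume "(\<exists>d. foliation d F) \<and> (\<exists>\<omega>'\<in>F. poly (\<omega>' $ 1) 1 = A \<and> poly (\<omega>' $ 2) 1 = B)"
  then obtain n \<omega>0 c where w0: "foliation_form n \<omega>0" "F = foliation_of \<omega>0" and c: "c \<noteq> 0"
    and A': "poly ((const3 c *s \<omega>0) $ 1) 1 = A" "poly ((const3 c *s \<omega>0) $ 2) 1 = B"
    unfolding foliation_def foliation_of_def by auto
  have w': "foliation_form n (const3 c *s \<omega>0)" by (rule foliation_form_scale[OF w0(1) c])
  have "const3 c *s \<omega>0 = \<omega>"
    using foliation_form_unique_le[OF w' w] foliation_form_unique_le[OF w w'] A A'
    by (metis nat_le_linear)
  then show "F = foliation_of \<omega>" using foliation_of_scale[OF c, of \<omega>0] w0 by simp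
qed

section \<open>The three models\<close>

lemma prime_elem_monic_linear: "prime_elem [:- a, 1 :: 'a :: idom:]"
proof (rule prime_elemI)
  show "\<not> [:- a, 1:] dvd 1" unfolding poly_eq_0_iff_dvd[symmetric] by simp
  show "[:- a, 1:] dvd p \<or> [:- a, 1:] dvd q" if "[:- a, 1:] dvd p * q" for p q
    using that unfolding poly_eq_0_iff_dvd[symmetric] by simp
qed simp

lemma prime_elem_X: "prime_elem [:0, 1 :: 'a :: idom:]"
  using prime_elem_monic_linear[of "0 :: 'a"] by simp

lemma prime_elem_coord: "prime_elem (coord $ i)"
proof -
  have "prime_elem (coord $ 1)" "prime_elem (coord $ 2)" "prime_elem (coord $ 3)"
    unfolding coord_def vector_3 by (rule lift_prime_elem_poly lift_prime_elem_poly[OF lift_prime_elem_poly] prime_elem_X)+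
  then show ?thesis using exhaust_3[of i] by auto
qed

lemma prime_elem_coord_diff: "prime_elem (coord $ 3 - coord $ 2)"
  using prime_elem_monic_linear[of "[:0, 1:] :: complex poly poly"] by (simp add: coord_def)

text \<open>
Used to strip the prime factors of one coefficient of a form from a common divisor \<open>h\<close>, each being
excluded by another coefficient.
\<close>

lemma dvd_cancel_prime:
  fixes h :: poly3
  assumes "prime_elem p" "h dvd p * q" "\<not> p dvd h" shows "h dvd q"
proof -
  obtain k where k: "p * q = h * k" using assms(2) by (rule dvdE)
  then have "p dvd h * k" by (metis dvd_triv_left)
  then have "p dvd k" using assms by (auto dest: prime_elem_dvd_multD)
  then obtain k' where "k = p * k'" by (rule dvdE)
  with k have "p * q = p * (h * k')" by (simp add: mult_ac)
  then have "q = h * k'" using assms(1) by (simp add: prime_elem_def)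
  then show ?thesis by simp
qed

lemma not_dvd_if_eval3:
  assumes "eval3 p v = 0" "eval3 q v \<noteq> 0" shows "\<not> p dvd q"
  using assms by (auto elim!: dvdE)

definition field_H1 :: "poly3 ^ 3" where "field_H1 = vector [coord $ 1 ^ 2, coord $ 2 ^ 2, 0]"
definition field_F1 :: "poly3 ^ 3" where "field_F1 = vector [0, coord $ 2 ^ 2, coord $ 1 ^ 2]"
definition field_F0 :: "poly3 ^ 3" where
  "field_F0 = vector [coord $ 1 * coord $ 3 - coord $ 1 ^ 2, coord $ 2 * coord $ 3 - coord $ 2 ^ 2, 0]"

lemma field_fun_H1: "field_fun field_H1 = model_H1" and field_fun_F1: "field_fun field_F1 = model_F1" and field_fun_F0: "field_fun field_F0 = model_F0"
  by (simp_all add: fun_eq_iff vec3_eq_iff field_H1_def field_F1_def field_F0_def model_H1_def model_F1_def model_F0_def)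

lemma homogeneous_2I:
  assumes "is_qform (eval3 p)" shows "homogeneous 2 p"
proof -
  obtain a b c d e f where "\<And>v. eval3 p v = qform a b c d e f v" using assms unfolding is_qform_def by blast
  then have "p = quadratic a b c d e f" by (intro eval3_inject) (simp add: eval3_quadratic)
  then show ?thesis by (simp add: homogeneous_quadratic)
qed

lemma is_qformI: "(\<And>v. p v = qform a b c d e f v) \<Longrightarrow> is_qform p"
  unfolding is_qform_def by blast

lemma homogeneous_field_H1: "homogeneous 2 (field_H1 $ i)"
  using exhaust_3[of i] is_qformI[of "eval3 (coord $ 1 ^ 2)" 1 0 0 0 0 0] is_qformI[of "eval3 (coord $ 2 ^ 2)" 0 0 1 0 0 0]
    is_qformI[of "eval3 0" 0 0 0 0 0 0]
  by (auto simp: field_H1_def qform_def intro!: homogeneous_2I)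

lemma homogeneous_field_F1: "homogeneous 2 (field_F1 $ i)"
  using exhaust_3[of i] is_qformI[of "eval3 (coord $ 1 ^ 2)" 1 0 0 0 0 0] is_qformI[of "eval3 (coord $ 2 ^ 2)" 0 0 1 0 0 0]
    is_qformI[of "eval3 0" 0 0 0 0 0 0]
  by (auto simp: field_F1_def qform_def intro!: homogeneous_2I)

lemma homogeneous_field_F0: "homogeneous 2 (field_F0 $ i)"
  using exhaust_3[of i] is_qformI[of "eval3 (coord $ 1 * coord $ 3 - coord $ 1 ^ 2)" "- 1" 0 0 1 0 0]
    is_qformI[of "eval3 (coord $ 2 * coord $ 3 - coord $ 2 ^ 2)" 0 0 "- 1" 0 1 0]
    is_qformI[of "eval3 0" 0 0 0 0 0 0]
  by (auto simp: field_F0_def qform_def intro!: homogeneous_2I)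

lemma foliation_form_contract_vol:
  assumes "\<And>i. homogeneous 2 (Z $ i)" "\<And>h. (\<And>i. h dvd contract_vol Z $ i) \<Longrightarrow> h dvd 1"
  shows "foliation_form 2 (contract_vol Z)"
  unfolding foliation_form_def
  using assms homogeneous_contract_vol[OF assms(1)]
  by (auto simp: sum_3 contract_vol_nth algebra_simps)

lemma foliation_form_H1: "foliation_form 2 (contract_vol field_H1)"
proof (rule foliation_form_contract_vol[OF homogeneous_field_H1])
  fix h assume h: "\<And>i. h dvd contract_vol field_H1 $ i"
  have y: "\<not> coord $ 2 dvd h"
    using not_dvd_if_eval3[of "coord $ 2" "vector [1, 0, 1]" "contract_vol field_H1 $ 2"] h[of 2]
    by (auto dest: dvd_trans simp: contract_vol_nth field_H1_def)
  have z: "\<not> coord $ 3 dvd h"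
    using not_dvd_if_eval3[of "coord $ 3" "vector [1, 2, 0]" "contract_vol field_H1 $ 3"] h[of 3]
    by (auto dest: dvd_trans simp: contract_vol_nth field_H1_def)
  have "h dvd coord $ 3 * (coord $ 2 * (coord $ 2 * 1))"
    using h[of 1] by (simp add: contract_vol_nth field_H1_def power2_eq_square)
  from dvd_cancel_prime[OF prime_elem_coord this z] have "h dvd coord $ 2 * (coord $ 2 * 1)" .
  from dvd_cancel_prime[OF prime_elem_coord this y] have "h dvd coord $ 2 * 1" .
  from dvd_cancel_prime[OF prime_elem_coord this y] show "h dvd 1" .
qed

lemma foliation_form_F1: "foliation_form 2 (contract_vol field_F1)"
proof (rule foliation_form_contract_vol[OF homogeneous_field_F1])
  fix h assume h: "\<And>i. h dvd contract_vol field_F1 $ i"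
  have x: "\<not> coord $ 1 dvd h"
    using not_dvd_if_eval3[of "coord $ 1" "vector [0, 1, 1]" "contract_vol field_F1 $ 1"] h[of 1]
    by (auto dest: dvd_trans simp: contract_vol_nth field_F1_def)
  have "h dvd coord $ 1 * (coord $ 1 * (coord $ 1 * 1))"
    using h[of 2] by (simp add: contract_vol_nth field_F1_def power2_eq_square)
  from dvd_cancel_prime[OF prime_elem_coord this x] have "h dvd coord $ 1 * (coord $ 1 * 1)" .
  from dvd_cancel_prime[OF prime_elem_coord this x] have "h dvd coord $ 1 * 1" .
  from dvd_cancel_prime[OF prime_elem_coord this x] show "h dvd 1" .
qed

lemma foliation_form_F0: "foliation_form 2 (contract_vol field_F0)"
proof (rule foliation_form_contract_vol[OF homogeneous_field_F0])
  fix h assume h: "\<And>i. h dvd contract_vol field_F0 $ i"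
  have y: "\<not> coord $ 2 dvd h"
    using not_dvd_if_eval3[of "coord $ 2" "vector [2, 0, 1]" "contract_vol field_F0 $ 2"] h[of 2]
    by (auto dest: dvd_trans simp: contract_vol_nth field_F0_def)
  have z: "\<not> coord $ 3 dvd h"
    using not_dvd_if_eval3[of "coord $ 3" "vector [1, 2, 0]" "contract_vol field_F0 $ 3"] h[of 3]
    by (auto dest: dvd_trans simp: contract_vol_nth field_F0_def)
  have zy: "\<not> (coord $ 3 - coord $ 2) dvd h"
    using not_dvd_if_eval3[of "coord $ 3 - coord $ 2" "vector [2, 1, 1]" "contract_vol field_F0 $ 2"] h[of 2]
    by (auto dest: dvd_trans simp: contract_vol_nth field_F0_def)
  have "h dvd coord $ 3 * (coord $ 2 * ((coord $ 3 - coord $ 2) * 1))"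
    using h[of 1] by (simp add: contract_vol_nth field_F0_def power2_eq_square algebra_simps)
  from dvd_cancel_prime[OF prime_elem_coord this z] have "h dvd coord $ 2 * ((coord $ 3 - coord $ 2) * 1)" .
  from dvd_cancel_prime[OF prime_elem_coord this y] have "h dvd (coord $ 3 - coord $ 2) * 1" .
  from dvd_cancel_prime[OF prime_elem_coord_diff this zy] show "h dvd 1" .
qed

lemma fol_H1_eq: "fol_H1 = foliation_of (contract_vol field_H1)"
  unfolding fol_H1_def
  by (rule affine_foliation_eq[OF foliation_form_H1])
    (simp_all add: contract_vol_nth field_H1_def coord_def x2_def y2_def)

lemma fol_F1_eq: "fol_F1 = foliation_of (contract_vol field_F1)"
  unfolding fol_F1_def
  by (rule affine_foliation_eq[OF foliation_form_F1])
    (simp_all add: contract_vol_nth field_F1_def coord_def x2_def y2_def power2_eq_square power3_eq_cube)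

lemma fol_F0_eq: "fol_F0 = foliation_of (contract_vol field_F0)"
  unfolding fol_F0_def
  by (rule affine_foliation_eq[OF foliation_form_F0])
    (simp_all add: contract_vol_nth field_F0_def coord_def x2_def y2_def power2_eq_square)

text \<open>
The converse of the argument above, again from \<open>l \<times> (Z \<times> R) = (l \<cdot> R) Z - (l \<cdot> Z) R\<close>: if \<open>l\<close> divides
\<open>l \<cdot> Z\<close>, then it divides the right-hand side.
\<close>

lemma invariant_curve_if_cofactor:
  assumes "\<And>v. lform l (field_fun Z v) = lform l v * lform m v"
  shows "invariant_curve (linear_form l) (contract_vol Z)"
proof -
  let ?l = "linear_form l" and ?m = "linear_form m"
  have H: "const3 (l $ 1) * Z $ 1 + const3 (l $ 2) * Z $ 2 + const3 (l $ 3) * Z $ 3 = ?l * ?m"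
    by (rule eval3_inject) (use assms in \<open>simp add: lform_def\<close>)
  have L: "const3 (l $ 1) * coord $ 1 + const3 (l $ 2) * coord $ 2 + const3 (l $ 3) * coord $ 3 = ?l"
    by (simp add: linear_form_def sum_3)
  define w where "w i j = const3 (l $ i) * contract_vol Z $ j - const3 (l $ j) * contract_vol Z $ i" for i j
  have 12: "w 1 2 = ?l * Z $ 3 - (?l * ?m) * coord $ 3"
    and 23: "w 2 3 = ?l * Z $ 1 - (?l * ?m) * coord $ 1"
    and 31: "w 3 1 = ?l * Z $ 2 - (?l * ?m) * coord $ 2"
    unfolding H[symmetric] unfolding L[symmetric]
    by (simp_all add: w_def contract_vol_nth algebra_simps)
  have d: "?l dvd w 1 2" "?l dvd w 2 3" "?l dvd w 3 1" unfolding 12 23 31 by (auto simp: mult.assoc)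
  have anti: "w j i = - w i j" for i j by (simp add: w_def)
  have "?l dvd w i j" for i j
    using exhaust_3[of i] exhaust_3[of j] d anti[of 1 2] anti[of 2 3] anti[of 3 1]
    by (auto simp: w_def[of 1 1] w_def[of 2 2] w_def[of 3 3])
  then show ?thesis by (simp add: invariant_curve_def pd_linear_form w_def)
qed

lemma convex_contract_volI:
  assumes fol: "foliation_form 2 (contract_vol Z)" and hom: "\<And>i. homogeneous 2 (Z $ i)" and c: "c \<noteq> 0"
    and lines: "\<And>l. l \<in> set vs \<Longrightarrow> l \<noteq> 0 \<and> (\<exists>m. \<forall>v. lform l (field_fun Z v) = lform l v * lform m v)"
    and inflection: "\<And>v. inflection (field_fun Z) v = c * prod_list (map (\<lambda>l. lform l v) vs)"
  shows "convex_foliation 2 (foliation_of (contract_vol Z))"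
proof -
  have "inflection_poly Z = const3 c * prod_list (map linear_form vs)"
    by (rule eval3_inject) (simp add: eval3_inflection_poly[OF hom] inflection o_def)
  moreover have "\<forall>l\<in>set vs. l \<noteq> 0 \<and> invariant_curve (linear_form l) (contract_vol Z)"
    using lines invariant_curve_if_cofactor by blast
  moreover have "describing_field 2 (contract_vol Z) Z" using hom by (simp add: describing_field_def)
  ultimately show ?thesis unfolding convex_foliation_def foliation_def using fol mem_foliation_of c by blast
qed

lemma convex_H1: "convex_foliation 2 fol_H1"
  unfolding fol_H1_eq
proof (rule convex_contract_volI[OF foliation_form_H1 homogeneous_field_H1, of 2
      "[vector [0,0,1], vector [1,0,0], vector [1,0,0], vector [0,1,0], vector [0,1,0], vector [-1,1,0]]"])
  fix l :: "complex ^ 3"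
  assume "l \<in> set [vector [0,0,1], vector [1,0,0], vector [1,0,0], vector [0,1,0], vector [0,1,0], vector [-1,1,0]]"
  then consider "l = vector [0,0,1]" | "l = vector [1,0,0]" | "l = vector [0,1,0]" | "l = vector [-1,1,0]" by auto
  then show "l \<noteq> 0 \<and> (\<exists>m. \<forall>v. lform l (field_fun field_H1 v) = lform l v * lform m v)"
  proof cases
    case 1 then show ?thesis by (intro conjI exI[of _ 0]) (simp_all add: vec3_nz lform_def field_fun_H1 model_H1_def)
  next
    case 2 then show ?thesis
      by (intro conjI exI[of _ "vector [1,0,0]"]) (simp_all add: vec3_nz lform_def field_fun_H1 model_H1_def power2_eq_square)
  next
    case 3 then show ?thesis
      by (intro conjI exI[of _ "vector [0,1,0]"]) (simp_all add: vec3_nz lform_def field_fun_H1 model_H1_def power2_eq_square)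
  next
    case 4 then show ?thesis
      by (intro conjI exI[of _ "vector [1,1,0]"]) (simp_all add: vec3_nz lform_def field_fun_H1 model_H1_def power2_eq_square algebra_simps)
  qed
next
  show "inflection (field_fun field_H1) v = 2 * prod_list (map (\<lambda>l. lform l v)
    [vector [0,0,1], vector [1,0,0], vector [1,0,0], vector [0,1,0], vector [0,1,0], vector [-1,1,0]])" for v
    by (simp add: inflection_def det_col_matrix field_fun_H1 model_H1_def lform_def power2_eq_square algebra_simps)
qed simp

lemma convex_F1: "convex_foliation 2 fol_F1"
  unfolding fol_F1_eq
proof (rule convex_contract_volI[OF foliation_form_F1 homogeneous_field_F1, of "- 2"
      "[vector [1,0,0], vector [1,0,0], vector [1,0,0], vector [0,1,0], vector [0,1,0], vector [0,1,0]]"])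
  fix l :: "complex ^ 3"
  assume "l \<in> set [vector [1,0,0], vector [1,0,0], vector [1,0,0], vector [0,1,0], vector [0,1,0], vector [0,1,0]]"
  then consider "l = vector [1,0,0]" | "l = vector [0,1,0]" by auto
  then show "l \<noteq> 0 \<and> (\<exists>m. \<forall>v. lform l (field_fun field_F1 v) = lform l v * lform m v)"
  proof cases
    case 1 then show ?thesis by (intro conjI exI[of _ 0]) (simp_all add: vec3_nz lform_def field_fun_F1 model_F1_def)
  next
    case 2 then show ?thesis
      by (intro conjI exI[of _ "vector [0,1,0]"]) (simp_all add: vec3_nz lform_def field_fun_F1 model_F1_def power2_eq_square)
  qed
next
  show "inflection (field_fun field_F1) v = - 2 * prod_list (map (\<lambda>l. lform l v)
    [vector [1,0,0], vector [1,0,0], vector [1,0,0], vector [0,1,0], vector [0,1,0], vector [0,1,0]])" for v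
    by (simp add: inflection_def det_col_matrix field_fun_F1 model_F1_def lform_def power2_eq_square algebra_simps)
qed simp

lemma convex_F0: "convex_foliation 2 fol_F0"
  unfolding fol_F0_eq
proof (rule convex_contract_volI[OF foliation_form_F0 homogeneous_field_F0, of "- 2"
      "[vector [0,0,1], vector [1,0,0], vector [0,1,0], vector [1,0,-1], vector [0,1,-1], vector [-1,1,0]]"])
  fix l :: "complex ^ 3"
  assume "l \<in> set [vector [0,0,1], vector [1,0,0], vector [0,1,0], vector [1,0,-1], vector [0,1,-1], vector [-1,1,0]]"
  then consider "l = vector [0,0,1]" | "l = vector [1,0,0]" | "l = vector [0,1,0]"
    | "l = vector [1,0,-1]" | "l = vector [0,1,-1]" | "l = vector [-1,1,0]" by auto
  then show "l \<noteq> 0 \<and> (\<exists>m. \<forall>v. lform l (field_fun field_F0 v) = lform l v * lform m v)"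
  proof cases
    case 1 then show ?thesis by (intro conjI exI[of _ 0]) (simp_all add: vec3_nz lform_def field_fun_F0 model_F0_def)
  next
    case 2 then show ?thesis
      by (intro conjI exI[of _ "vector [-1,0,1]"]) (simp_all add: vec3_nz lform_def field_fun_F0 model_F0_def power2_eq_square algebra_simps)
  next
    case 3 then show ?thesis
      by (intro conjI exI[of _ "vector [0,-1,1]"]) (simp_all add: vec3_nz lform_def field_fun_F0 model_F0_def power2_eq_square algebra_simps)
  next
    case 4 then show ?thesis
      by (intro conjI exI[of _ "vector [-1,0,0]"]) (simp_all add: vec3_nz lform_def field_fun_F0 model_F0_def power2_eq_square algebra_simps)
  next
    case 5 then show ?thesis
      by (intro conjI exI[of _ "vector [0,-1,0]"]) (simp_all add: vec3_nz lform_def field_fun_F0 model_F0_def power2_eq_square algebra_simps)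
  next
    case 6 then show ?thesis
      by (intro conjI exI[of _ "vector [-1,-1,1]"]) (simp_all add: vec3_nz lform_def field_fun_F0 model_F0_def power2_eq_square algebra_simps)
  qed
next
  show "inflection (field_fun field_F0) v = - 2 * prod_list (map (\<lambda>l. lform l v)
    [vector [0,0,1], vector [1,0,0], vector [0,1,0], vector [1,0,-1], vector [0,1,-1], vector [-1,1,0]])" for v
    by (simp add: inflection_def det_col_matrix field_fun_F0 model_F0_def lform_def power2_eq_square algebra_simps)
qed simp

section \<open>Singular points\<close>

definition singular_at :: "poly3 ^ 3 \<Rightarrow> complex ^ 3 \<Rightarrow> bool" where
  "singular_at \<omega> v \<longleftrightarrow> (\<forall>i. eval3 (\<omega> $ i) v = 0)"

text \<open>
The pullback multiplies the values of the form by the transposed matrix, which is invertible.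
\<close>

lemma conjugate_singular:
  assumes "conjugate (foliation_of \<omega>) (foliation_of \<omega>')"
  obtains M :: "complex ^ 3 ^ 3" where "det M \<noteq> 0" "\<And>v. singular_at \<omega> v \<longleftrightarrow> singular_at \<omega>' (M *v v)"
proof -
  obtain M :: "complex ^ 3 ^ 3" where M: "invertible M" "foliation_of \<omega> = pullback M ` foliation_of \<omega>'"
    using assms unfolding conjugate_def by blast
  have "pullback M \<omega>' \<in> foliation_of \<omega>" using M mem_foliation_of by blast
  then obtain k where k: "k \<noteq> 0" "pullback M \<omega>' = const3 k *s \<omega>" unfolding foliation_of_def by blast
  have eq: "k * eval3 (\<omega> $ j) v = (\<Sum>i\<in>UNIV. M $ i $ j * eval3 (\<omega>' $ i) (M *v v))" for j v
    using arg_cong[OF k(2), of "\<lambda>w. eval3 (w $ j) v"] by (simp add: eval3_pullback)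
  have "singular_at \<omega> v \<longleftrightarrow> singular_at \<omega>' (M *v v)" for v
  proof
    assume "singular_at \<omega>' (M *v v)"
    then show "singular_at \<omega> v" using eq[of _ v] k(1) by (simp add: singular_at_def)
  next
    assume "singular_at \<omega> v"
    then have "transpose M *v (\<chi> i. eval3 (\<omega>' $ i) (M *v v)) = 0"
      using eq[of _ v] by (simp add: singular_at_def vec_eq_iff matrix_vector_mult_def transpose_def del: transpose_matrix_vector)
    moreover have "invertible (transpose M)" using M(1) by (simp add: invertible_det_nz)
    then obtain A where A: "A ** transpose M = mat 1" unfolding invertible_def by blast
    ultimately have "A *v (transpose M *v (\<chi> i. eval3 (\<omega>' $ i) (M *v v))) = 0"
      by (simp del: transpose_matrix_vector)
    then have "(\<chi> i. eval3 (\<omega>' $ i) (M *v v)) = 0"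
      unfolding matrix_vector_mul_assoc A by simp
    then show "singular_at \<omega>' (M *v v)" by (simp add: singular_at_def vec_eq_iff)
  qed
  then show ?thesis using that M(1) by (simp add: invertible_det_nz)
qed

lemma singular_contract_vol:
  "singular_at (contract_vol Z) v \<longleftrightarrow> v $ 3 * field_fun Z v $ 2 = v $ 2 * field_fun Z v $ 3 \<and>
     v $ 1 * field_fun Z v $ 3 = v $ 3 * field_fun Z v $ 1 \<and> v $ 2 * field_fun Z v $ 1 = v $ 1 * field_fun Z v $ 2"
  by (simp add: singular_at_def forall_3 contract_vol_nth)

lemma singular_at_H1: "singular_at (contract_vol field_H1) v \<Longrightarrow> v $ 3 = 0 \<or> v $ 1 = 0 \<and> v $ 2 = 0"
  unfolding singular_contract_vol field_fun_H1 by (auto simp: model_H1_def)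

lemma singular_at_F1: "singular_at (contract_vol field_F1) v \<Longrightarrow> v $ 1 = 0"
  unfolding singular_contract_vol field_fun_F1 by (auto simp: model_F1_def)

lemma singular_at_H1_basis:
  "singular_at (contract_vol field_H1) (vector [1,0,0])" "singular_at (contract_vol field_H1) (vector [0,1,0])"
  "singular_at (contract_vol field_H1) (vector [0,0,1])"
  unfolding singular_contract_vol field_fun_H1 by (simp_all add: model_H1_def)

lemma singular_F0_points:
  "singular_at (contract_vol field_F0) (vector [1,0,0])" "singular_at (contract_vol field_F0) (vector [0,1,0])"
  "singular_at (contract_vol field_F0) (vector [0,0,1])" "singular_at (contract_vol field_F0) (vector [1,1,1])"
  unfolding singular_contract_vol field_fun_F0 by (simp_all add: model_F0_def)

lemma singular_not_in_plane:
  fixes M :: "complex ^ 3 ^ 3"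
  assumes "det M \<noteq> 0" shows "\<not> ((M *v vector [1,0,0]) $ 1 = 0 \<and> (M *v vector [0,1,0]) $ 1 = 0 \<and> (M *v vector [0,0,1]) $ 1 = 0)"
proof
  assume "(M *v vector [1,0,0]) $ 1 = 0 \<and> (M *v vector [0,1,0]) $ 1 = 0 \<and> (M *v vector [0,0,1]) $ 1 = 0"
  then have "M $ 1 $ 1 = 0" "M $ 1 $ 2 = 0" "M $ 1 $ 3 = 0" by (simp_all add: mv3)
  then show False using assms by (simp add: det_3)
qed

lemma inverse_matrix:
  assumes "det (M :: complex ^ 3 ^ 3) \<noteq> 0"
  obtains N where "det N \<noteq> 0" "\<And>v. M *v (N *v v) = v"
proof -
  obtain N where N: "M ** N = mat 1" using assms invertible_det_nz unfolding invertible_def by blast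
  then have "det M * det N = 1" by (metis det_mul det_I)
  then have "det N \<noteq> 0" by auto
  moreover have "M *v (N *v v) = v" for v by (simp add: matrix_vector_mul_assoc N)
  ultimately show ?thesis using that by blast
qed

lemma not_conjugate_H1_F1: "\<not> conjugate fol_H1 fol_F1"
proof
  assume "conjugate fol_H1 fol_F1"
  then obtain M where M: "det M \<noteq> 0" "\<And>v. singular_at (contract_vol field_H1) v \<longleftrightarrow> singular_at (contract_vol field_F1) (M *v v)"
    unfolding fol_H1_eq fol_F1_eq by (rule conjugate_singular) blast
  then show False using singular_not_in_plane[OF M(1)] singular_at_H1_basis singular_at_F1 by blast
qed

lemma not_conjugate_F1_F0: "\<not> conjugate fol_F1 fol_F0"
proof
  assume "conjugate fol_F1 fol_F0"
  then obtain M where M: "det M \<noteq> 0" "\<And>v. singular_at (contract_vol field_F1) v \<longleftrightarrow> singular_at (contract_vol field_F0) (M *v v)"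
    unfolding fol_F1_eq fol_F0_eq by (rule conjugate_singular) blast
  obtain N where N: "det N \<noteq> 0" "\<And>v. M *v (N *v v) = v" using inverse_matrix[OF M(1)] by blast
  have "(N *v v) $ 1 = 0" if "singular_at (contract_vol field_F0) v" for v
    using that M(2)[of "N *v v"] N(2) singular_at_F1 by simp
  then show False using singular_not_in_plane[OF N(1)] singular_F0_points by blast
qed

text \<open>
The four points form a projective frame, so at most one of them can go to the isolated point
\<open>[0 : 0 : 1]\<close> and the other three would be collinear.
\<close>

lemma not_conjugate_H1_F0: "\<not> conjugate fol_H1 fol_F0"
proof
  assume "conjugate fol_H1 fol_F0"
  then obtain M where M: "det M \<noteq> 0" "\<And>v. singular_at (contract_vol field_H1) v \<longleftrightarrow> singular_at (contract_vol field_F0) (M *v v)"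
    unfolding fol_H1_eq fol_F0_eq by (rule conjugate_singular) blast
  obtain N where N: "det N \<noteq> 0" "\<And>v. M *v (N *v v) = v" using inverse_matrix[OF M(1)] by blast
  have *: "(N *v v) $ 3 = 0 \<or> (N *v v) $ 1 = 0 \<and> (N *v v) $ 2 = 0" if "singular_at (contract_vol field_F0) v" for v
    using that M(2)[of "N *v v"] N(2) singular_at_H1 by simp
  have det: "det N = N$1$1*N$2$2*N$3$3 + N$1$2*N$2$3*N$3$1 + N$1$3*N$2$1*N$3$2
     - N$1$1*N$2$3*N$3$2 - N$1$2*N$2$1*N$3$3 - N$1$3*N$2$2*N$3$1" by (simp add: det_3)
  have c: "N$3$1 = 0 \<or> N$1$1 = 0 \<and> N$2$1 = 0" "N$3$2 = 0 \<or> N$1$2 = 0 \<and> N$2$2 = 0"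
    "N$3$3 = 0 \<or> N$1$3 = 0 \<and> N$2$3 = 0"
    "N$3$1 + N$3$2 + N$3$3 = 0 \<or> N$1$1 + N$1$2 + N$1$3 = 0 \<and> N$2$1 + N$2$2 + N$2$3 = 0"
    using *[OF singular_F0_points(1)] *[OF singular_F0_points(2)] *[OF singular_F0_points(3)] *[OF singular_F0_points(4)]
    by (simp_all add: mv3)
  have "det N = 0"
    using c unfolding det by (elim disjE conjE) (auto simp: eq_neg_iff_add_eq_0[symmetric])
  then show False using N(1) by simp
qed

section \<open>The classification\<close>

theorem mainTheorem1:
  shows "convex_foliation 2 fol_H1 \<and> convex_foliation 2 fol_F1 \<and> convex_foliation 2 fol_F0 \<and>
    \<not> conjugate fol_H1 fol_F1 \<and> \<not> conjugate fol_H1 fol_F0 \<and> \<not> conjugate fol_F1 fol_F0 \<and>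
    (\<forall>F. convex_foliation 2 F \<longrightarrow>
       conjugate F fol_H1 \<or> conjugate F fol_F1 \<or> conjugate F fol_F0)"
proof (intro conjI allI impI)
  fix F assume "convex_foliation 2 F"
  then obtain Z where F: "F = foliation_of (contract_vol Z)" and "convex_field (field_fun Z)" by (rule convex_foliation_imp_convex_field)
  then have "equiv_to_model (field_fun Z)" by (intro convex_field_equiv_to_model)
  then show "conjugate F fol_H1 \<or> conjugate F fol_F1 \<or> conjugate F fol_F0"
    unfolding equiv_to_model_def field_fun_H1[symmetric] field_fun_F1[symmetric] field_fun_F0[symmetric] fol_H1_eq fol_F1_eq fol_F0_eq F
    using conjugate_if_field_equiv by blast
qed (fact convex_H1 convex_F1 convex_F0 not_conjugate_H1_F1 not_conjugate_H1_F0 not_conjugate_F1_F0)+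

end
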